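(* Let $\alpha,\beta,\gamma\in\mathbb C$. The monodromy of the hypergeometric equation $$u''+\frac{\gamma-(1+\alpha+\beta)z}{z(1-z)}\,u'-\frac{\alpha\beta}{z(1-z)}\,u=0$$ belongs to $SL(2,\mathbb Z)$ if and only if $$\gamma\in\mathbb Z,\qquad \alpha+\beta\in\mathbb Z,\qquad e^{2\pi i\alpha}+e^{2\pi i\beta}\in\mathbb Z .$$
   Context: The monodromy of the equation is the image of the representation $\pi_1(\mathbb{CP}^1\setminus\{0,1,\infty\})\to GL(2,\mathbb C)$ obtained by analytic continuation of a basis of the two-dimensional solution space along loops ($Y=Y^*G_\gamma$, where $Y^*$ is the continuation of the basis $Y$ along the loop); it is defined up to simultaneous conjugation, i.e. choice of basis. "The monodromy belongs to $SL(2,\mathbb Z)$" means that there is a basis of solutions in which all monodromy matrices lie in $SL(2,\mathbb Z)$. *)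

theory Defs
  imports "HOL-Complex_Analysis.Complex_Analysis"
begin

definition hypergeometric_solution_on ::
  "complex \<Rightarrow> complex \<Rightarrow> complex \<Rightarrow> complex set \<Rightarrow> (complex \<Rightarrow> complex) \<Rightarrow> bool" where
  "hypergeometric_solution_on \<alpha> \<beta> \<gamma> U u \<longleftrightarrow>
     u holomorphic_on U \<and>
     (\<forall>z\<in>U. deriv (deriv u) z
            + (\<gamma> - (1 + \<alpha> + \<beta>) * z) / (z * (1 - z)) * deriv u z
            - \<alpha> * \<beta> / (z * (1 - z)) * u z = 0)"

definition hypergeometric_solution_near ::
  "complex \<Rightarrow> complex \<Rightarrow> complex \<Rightarrow> complex \<Rightarrow> (complex \<Rightarrow> complex) \<Rightarrow> bool" where
  "hypergeometric_solution_near \<alpha> \<beta> \<gamma> z0 u \<longleftrightarrow>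
     (\<exists>U. open U \<and> z0 \<in> U \<and> U \<subseteq> - {0, 1} \<and> hypergeometric_solution_on \<alpha> \<beta> \<gamma> U u)"

text \<open>
  The row vector \<open>Y = (y\<^sub>1, y\<^sub>2)\<close> is a basis of the space of germs at \<open>z0\<close> of solutions.
  Germs are represented by total functions, which are identified if they agree near \<open>z0\<close>.
\<close>
definition solution_basis ::
  "complex \<Rightarrow> complex \<Rightarrow> complex \<Rightarrow> complex \<Rightarrow> (complex \<Rightarrow> complex^2) \<Rightarrow> bool" where
  "solution_basis \<alpha> \<beta> \<gamma> z0 Y \<longleftrightarrow>
     (\<forall>i. hypergeometric_solution_near \<alpha> \<beta> \<gamma> z0 (\<lambda>z. Y z $ i)) \<and>
     (\<forall>v::complex^2. (\<forall>\<^sub>F z in nhds z0. (\<Sum>i\<in>UNIV. v $ i * Y z $ i) = 0) \<longrightarrow> v = 0) \<and>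
     (\<forall>u. hypergeometric_solution_near \<alpha> \<beta> \<gamma> z0 u \<longrightarrow>
        (\<exists>v::complex^2. \<forall>\<^sub>F z in nhds z0. u z = (\<Sum>i\<in>UNIV. v $ i * Y z $ i)))"

text \<open>
  \<open>F t\<close> represents a germ at \<open>p t\<close>, for \<open>t\<close> in the unit interval; for \<open>s\<close> close to \<open>t\<close> the germ
  at \<open>p s\<close> is the one given by a fixed holomorphic representative of the germ at \<open>p t\<close>.
\<close>
definition analytic_continuation_along ::
  "(real \<Rightarrow> complex) \<Rightarrow> (real \<Rightarrow> complex \<Rightarrow> complex) \<Rightarrow> bool" where
  "analytic_continuation_along p F \<longleftrightarrow>
     (\<forall>t\<in>{0..1}. \<exists>r>0. F t holomorphic_on ball (p t) r \<and>
        (\<exists>\<epsilon>>0. \<forall>s\<in>{0..1}. \<bar>s - t\<bar> < \<epsilon> \<longrightarrow>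
           p s \<in> ball (p t) r \<and> (\<forall>\<^sub>F z in nhds (p s). F s z = F t z)))"

text \<open>
  Here \<open>F 1\<close> is the continuation \<open>Y\<^sup>*\<close> of the row vector \<open>Y\<close> along the loop \<open>p\<close>, and the matrix
  is determined by \<open>Y = Y\<^sup>* G\<close> near the base point.
\<close>
definition monodromy_matrix ::
  "(real \<Rightarrow> complex) \<Rightarrow> (complex \<Rightarrow> complex^2) \<Rightarrow> complex^2^2 \<Rightarrow> bool" where
  "monodromy_matrix p Y G \<longleftrightarrow>
     (\<exists>F :: real \<Rightarrow> complex \<Rightarrow> complex^2.
        (\<forall>i. analytic_continuation_along p (\<lambda>t z. F t z $ i)) \<and>
        (\<forall>\<^sub>F z in nhds (pathstart p). F 0 z = Y z) \<and>
        (\<forall>\<^sub>F z in nhds (pathstart p). Y z = F 1 z v* G))"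

text \<open>
  The complement of \<open>{0, 1}\<close> in the complex plane is the Riemann sphere without \<open>0, 1, \<infinity>\<close>.
  By the monodromy theorem a monodromy matrix depends only on the homotopy class of the loop, so
  ranging over all loops yields the image of the fundamental group.
\<close>
definition monodromy :: "complex \<Rightarrow> (complex \<Rightarrow> complex^2) \<Rightarrow> (complex^2^2) set" where
  "monodromy z0 Y =
     {G. \<exists>p. path p \<and> path_image p \<subseteq> - {0, 1} \<and> pathstart p = z0 \<and> pathfinish p = z0 \<and>
             monodromy_matrix p Y G}"

definition SL2Z :: "(complex^2^2) set" where
  "SL2Z = {G. (\<forall>i j. G $ i $ j \<in> \<int>) \<and> det G = 1}"

definition hypergeometric_monodromy_in_SL2Z ::
  "complex \<Rightarrow> complex \<Rightarrow> complex \<Rightarrow> complex \<Rightarrow> bool" where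
  "hypergeometric_monodromy_in_SL2Z \<alpha> \<beta> \<gamma> z0 \<longleftrightarrow>
     (\<exists>Y. solution_basis \<alpha> \<beta> \<gamma> z0 Y \<and> monodromy z0 Y \<subseteq> SL2Z)"

end

theory Submission
  imports Defs
begin

text \<open>
  The plane without \<open>0\<close> and \<open>1\<close> is covered by three slit planes, each containing both open half planes
  and one of the real intervals between the singular points. On each slit plane there is a fundamental
  system of solutions; the systems can be chosen to agree on the upper half plane, and on the lower
  half plane they differ by constant matrices \<open>C\<^sub>L\<close> and \<open>C\<^sub>R\<close> (relative to the middle interval). Following a
  germ along a path only multiplies its coordinates by these matrices, so the monodromy group is
  conjugate to the group generated by \<open>C\<^sub>L\<close> and \<open>C\<^sub>R\<close>.

  The Wronskian gives the determinants \<open>exp (-2\<pi>i\<gamma>)\<close> and \<open>exp (-2\<pi>i(\<gamma>-\<alpha>-\<beta>))\<close>, and the solution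
  \<open>z\<^sup>-\<^sup>\<alpha> h(1/z)\<close> at infinity an eigenvalue \<open>exp (-2\<pi>i\<alpha>)\<close> of \<open>C\<^sub>R\<^sup>-\<^sup>1 C\<^sub>L\<close>; this yields necessity. Conversely, under
  the integrality conditions \<open>C\<^sub>L\<close> and \<open>C\<^sub>R\<close> are unipotent, since there are power series solutions at \<open>0\<close> and
  at \<open>1\<close>. If their fixed lines differ, a diagonal scaling makes them integral because \<open>C\<^sub>R\<^sup>-\<^sup>1 C\<^sub>L\<close> has integral
  trace. If a line is fixed by both and neither is trivial, then all parameters are integers, the
  invariant solution is a polynomial with rational coefficients, and the off-diagonal entries
  of \<open>C\<^sub>L\<close> and \<open>C\<^sub>R\<close> are a common multiple of residues of a rational function over the rationals.
\<close>

section \<open>Linear differential equations on starlike domains\<close>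

text \<open>Homotopy classes of loops never enter. Integrality of all monodromy matrices is proved
  by carrying an invariant along an arbitrary path, and the occurrence of enough matrices by
  exhibiting loops.

  The delicate case is the reducible one. Two unipotent matrices with a common fixed vector are
  triangular with off-diagonal entries a and b; every change of basis that keeps the common line
  multiplies both by the same number, and the trace at infinity is 2 whatever a and b are.
  Integrality can then only come from rationality of a / b, about which the three conditions say
  nothing directly. It is an arithmetic property of the equation: the quotient of a second solution
  by the invariant solution g is a primitive of W / g^2, where W is the Wronskian, and its jumps at
  0 and 1 are governed by the residues there.

  The power series at the singular points have to exist without any genericity assumption, because
  integral exponent differences are exactly the case of interest.\<close>

lemma norm_segment_primitive_le:
  fixes f f' :: "complex \<Rightarrow> complex"
  assumes der: "\<And>w. w \<in> closed_segment c z \<Longrightarrow> (f has_field_derivative f' w) (at w)"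
    and zero: "f c = 0"
    and bound: "\<And>w. w \<in> closed_segment c z \<Longrightarrow> norm (f' w) \<le> B * norm (w - c) ^ n / fact n"
  shows "norm (f z) \<le> B * norm (z - c) ^ Suc n / fact (Suc n)"
proof -
  \<comment> \<open>Majorant along the segment: its derivative is the given bound times the speed
    \<open>norm (z - c)\<close>, and integrating t^n supplies the factor that turns
    \<open>fact n\<close> into \<open>fact (Suc n)\<close>.\<close>
  define \<phi> where "\<phi> t = B * (t * norm (z - c)) ^ Suc n / fact (Suc n)" for t :: real
  define \<phi>' where "\<phi>' t = norm (z - c) * (B * (t * norm (z - c)) ^ n / fact n)" for t :: real
  let ?l = "\<lambda>t::real. c + of_real t * (z - c)"
  have seg: "?l t \<in> closed_segment c z" if "t \<in> {0..1}" for t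
    using that by (auto simp: in_segment algebra_simps scaleR_conv_of_real intro!: exI[of _ t])
  have dl: "((\<lambda>t. f (?l t)) has_vector_derivative (z - c) * f' (?l t)) (at t)" if "t \<in> {0..1}" for t
  proof -
    have "(?l has_vector_derivative (z - c)) (at t)"
      by (auto intro!: derivative_eq_intros)
    from field_vector_diff_chain_at[OF this der[OF seg[OF that]]]
    show ?thesis by (simp add: o_def)
  qed
  have d\<phi>: "(\<phi> has_vector_derivative \<phi>' t) (at t)" for t
  proof -
    have "((\<lambda>t. B * norm (z - c) ^ Suc n / fact (Suc n) * t ^ Suc n) has_real_derivative
        B * norm (z - c) ^ Suc n / fact (Suc n) * (real (Suc n) * t ^ n)) (at t)"
      by (intro DERIV_cmult) (use DERIV_pow[of "Suc n" t UNIV] in simp)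
    also have "(\<lambda>t. B * norm (z - c) ^ Suc n / fact (Suc n) * t ^ Suc n) = \<phi>"
      by (simp add: \<phi>_def fun_eq_iff power_mult_distrib)
    also have "B * norm (z - c) ^ Suc n / fact (Suc n) * (real (Suc n) * t ^ n) = \<phi>' t"
      by (simp add: \<phi>'_def power_mult_distrib divide_simps del: of_nat_Suc)
    finally show ?thesis by (simp add: has_real_derivative_iff_has_vector_derivative)
  qed
  have "norm (f (?l 1) - f (?l 0)) \<le> \<phi> 1 - \<phi> 0"
  proof (rule differentiable_bound_general)
    show "continuous_on {0..1} (\<lambda>t. f (?l t))"
      by (intro continuous_at_imp_continuous_on ballI has_vector_derivative_continuous[OF dl])
    show "continuous_on {0..1} \<phi>"
      by (intro continuous_at_imp_continuous_on ballI has_vector_derivative_continuous[OF d\<phi>])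
    fix t :: real assume t: "0 < t" "t < 1"
    show "((\<lambda>t. f (?l t)) has_vector_derivative (z - c) * f' (?l t)) (at t)" using dl t by auto
    show "(\<phi> has_vector_derivative \<phi>' t) (at t)" by (rule d\<phi>)
    have "norm (f' (?l t)) \<le> B * norm (?l t - c) ^ n / fact n"
      using t by (intro bound seg) auto
    also have "norm (?l t - c) = t * norm (z - c)" using t by (simp add: norm_mult)
    finally show "norm ((z - c) * f' (?l t)) \<le> \<phi>' t"
      unfolding \<phi>'_def norm_mult by (intro mult_left_mono) auto
  qed auto
  then show ?thesis by (simp add: zero \<phi>_def)
qed

text \<open>The Picard iterates \<open>(d\<^sub>n, e\<^sub>n)\<close> are the terms of the series that solves the first order system.\<close>
lemma linear_ode_starlike_exists:
  fixes P Q :: "complex \<Rightarrow> complex" and a b c :: complex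
  assumes "open V" and c: "c \<in> V" and star: "\<And>z. z \<in> V \<Longrightarrow> closed_segment c z \<subseteq> V"
    and P: "P holomorphic_on V" and Q: "Q holomorphic_on V"
  obtains u v where "u c = a" "v c = b"
    "\<And>z. z \<in> V \<Longrightarrow> (u has_field_derivative v z) (at z)"
    "\<And>z. z \<in> V \<Longrightarrow> (v has_field_derivative P z * u z + Q z * v z) (at z)"
proof -
  have prim: "\<exists>g. g c = 0 \<and> (\<forall>z\<in>V. (g has_field_derivative f z) (at z))" if "f holomorphic_on V" for f
  proof -
    have f: "f holomorphic_on V" by (rule that)
    have "starlike V" using c star unfolding starlike_def by blast
    then obtain g where g: "\<forall>z\<in>V. (g has_field_derivative f z) (at z)"
      using holomorphic_starlike_primitive[of V f "{}"] f \<open>open V\<close>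
        holomorphic_on_imp_continuous_on holomorphic_on_imp_differentiable_at by blast
    then show ?thesis
      by (intro exI[of _ "\<lambda>z. g z - g c"]) (auto intro!: derivative_eq_intros)
  qed
  \<comment> \<open>Primitives are normalised to vanish at c, so the initial values are carried by
    the zeroth iterates alone.\<close>
  define prim where "prim f = (SOME g. g c = 0 \<and> (\<forall>z\<in>V. (g has_field_derivative f z) (at z)))" for f
  have prim: "prim f c = 0" "\<And>z. z \<in> V \<Longrightarrow> (prim f has_field_derivative f z) (at z)"
    if "f holomorphic_on V" for f
    using someI_ex[OF prim[OF that]] unfolding prim_def by auto
  define D where "D = rec_nat (\<lambda>_. a, \<lambda>_. b)
    (\<lambda>_ (d, e). (prim e, prim (\<lambda>z. P z * d z + Q z * e z)))"
  define d where "d n = fst (D n)" for n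
  define e where "e n = snd (D n)" for n
  have d0: "d 0 = (\<lambda>_. a)" and e0: "e 0 = (\<lambda>_. b)" by (simp_all add: d_def e_def D_def)
  have dS: "d (Suc n) = prim (e n)" and eS: "e (Suc n) = prim (\<lambda>z. P z * d n z + Q z * e n z)" for n
    by (simp_all add: d_def e_def D_def case_prod_beta)
  have hol: "d n holomorphic_on V \<and> e n holomorphic_on V" for n
  proof (induction n)
    case (Suc n)
    then have "(\<lambda>z. P z * d n z + Q z * e n z) holomorphic_on V"
      by (intro holomorphic_intros P Q) auto
    then show ?case using Suc unfolding dS eS
      by (metis prim(2) holomorphic_onI has_field_derivative_at_within field_differentiable_def)
  qed (simp add: d0 e0)
  have hPQ: "(\<lambda>z. P z * d n z + Q z * e n z) holomorphic_on V" for n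
    using hol[of n] by (intro holomorphic_intros P Q) auto
  \<comment> \<open>The derivatives are the iterates shifted by one index, with 0 in front for the
    constant zeroth terms; termwise differentiation of the series for u thus reproduces the series
    for v.\<close>
  define d' where "d' n = (case n of 0 \<Rightarrow> (\<lambda>_. 0) | Suc m \<Rightarrow> e m)" for n
  define e' where "e' n = (case n of 0 \<Rightarrow> (\<lambda>_. 0) | Suc m \<Rightarrow> (\<lambda>z. P z * d m z + Q z * e m z))" for n
  have dd: "(d n has_field_derivative d' n z) (at z)" if "z \<in> V" for n z
    using prim(2)[of "e (n - 1)" z] hol that by (cases n) (auto simp: d0 d'_def dS)
  have de: "(e n has_field_derivative e' n z) (at z)" if "z \<in> V" for n z
    using prim(2)[OF hPQ that, of "n - 1"] that by (cases n) (auto simp: e0 e'_def eS)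
  have dc: "d (Suc n) c = 0" and ec: "e (Suc n) c = 0" for n
    using prim(1)[of "e n"] prim(1)[OF hPQ] hol by (auto simp: dS eS)
  have conv: "\<exists>r h. 0 < r \<and> summable h \<and>
      (\<forall>n. \<forall>y\<in>ball x r. norm (d n y) \<le> h n \<and> norm (e n y) \<le> h n)" if "x \<in> V" for x
  proof -
    obtain r where r: "r > 0" "cball x r \<subseteq> V" using \<open>open V\<close> \<open>x \<in> V\<close> open_contains_cball by blast
    \<comment> \<open>The cone over a closed ball with apex c. It is compact and contains with each
      point its segment to c, so bounds for P and Q on K support an induction along
      segments.\<close>
    define K where "K = (\<lambda>(t, y). c + of_real t * (y - c)) ` ({0..1::real} \<times> cball x r)"
    have K: "compact K" unfolding K_def
      by (intro compact_continuous_image compact_Times compact_Icc compact_cball)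
         (auto intro!: continuous_intros simp: case_prod_beta)
    have segK: "closed_segment c y \<subseteq> K" if "y \<in> K" for y
    proof
      fix w assume "w \<in> closed_segment c y"
      then obtain s where s: "w = c + of_real s * (y - c)" "0 \<le> s" "s \<le> 1"
        by (auto simp: in_segment algebra_simps scaleR_conv_of_real)
      from that obtain t y' where t: "y = c + of_real t * (y' - c)" "0 \<le> t" "t \<le> 1" "y' \<in> cball x r"
        by (auto simp: K_def)
      show "w \<in> K" unfolding K_def
        by (rule image_eqI[of _ _ "(s * t, y')"]) (use s t in \<open>auto simp: mult_le_one\<close>)
    qed
    have "K \<subseteq> V"
    proof
      fix w assume "w \<in> K"
      then obtain t y where t: "w = c + of_real t * (y - c)" "0 \<le> t" "t \<le> 1" "y \<in> cball x r"
        by (auto simp: K_def)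
      then have "w \<in> closed_segment c y"
        by (auto simp: in_segment algebra_simps scaleR_conv_of_real intro!: exI[of _ t])
      then show "w \<in> V" using star[of y] t r by blast
    qed
    have "bounded (P ` K)" "bounded (Q ` K)"
      by (intro compact_imp_bounded compact_continuous_image K
            continuous_on_subset[OF holomorphic_on_imp_continuous_on \<open>K \<subseteq> V\<close>] P Q)+
    then obtain M1 M2 where "\<And>z. z \<in> K \<Longrightarrow> norm (P z) \<le> M1" "\<And>z. z \<in> K \<Longrightarrow> norm (Q z) \<le> M2"
      by (auto simp: bounded_iff)
    \<comment> \<open>The growth factor 2 * M has to serve both components: the summands P d and Q e
      take M each, and M \<ge> 1 makes it also cover the coefficient 1 in d' = e.\<close>
    define M where "M = max 1 (max M1 M2)"
    have M: "M \<ge> 1" "\<And>z. z \<in> K \<Longrightarrow> norm (P z) \<le> M" "\<And>z. z \<in> K \<Longrightarrow> norm (Q z) \<le> M"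
      unfolding M_def using \<open>\<And>z. z \<in> K \<Longrightarrow> norm (P z) \<le> M1\<close> \<open>\<And>z. z \<in> K \<Longrightarrow> norm (Q z) \<le> M2\<close>
      by (fastforce)+
    define B where "B = norm a + norm b"
    have bd: "norm (d n z) \<le> B * (2 * M) ^ n * norm (z - c) ^ n / fact n \<and>
        norm (e n z) \<le> B * (2 * M) ^ n * norm (z - c) ^ n / fact n" if "z \<in> K" for n z
      using that
    proof (induction n arbitrary: z)
      case 0 then show ?case by (simp add: d0 e0 B_def)
    next
      case (Suc n)
      have seg: "w \<in> K" "w \<in> V" if "w \<in> closed_segment c z" for w
        using segK Suc.prems \<open>K \<subseteq> V\<close> that by auto
      have nn: "0 \<le> B * (2 * M) ^ n * norm (w - c) ^ n / fact n" for w
        using M(1) by (auto simp: B_def)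
      have "norm (d (Suc n) z) \<le> (B * (2 * M) ^ n * (2 * M)) * norm (z - c) ^ Suc n / fact (Suc n)"
      proof (rule norm_segment_primitive_le[where f' = "e n"])
        fix w assume w: "w \<in> closed_segment c z"
        show "(d (Suc n) has_field_derivative e n w) (at w)" using dd[OF seg(2)[OF w], of "Suc n"] by (simp add: d'_def)
        have "norm (e n w) \<le> 1 * (B * (2 * M) ^ n * norm (w - c) ^ n / fact n)"
          using Suc.IH[OF seg(1)[OF w]] by simp
        also have "\<dots> \<le> (2 * M) * (B * (2 * M) ^ n * norm (w - c) ^ n / fact n)"
          using M nn by (intro mult_right_mono) auto
        finally show "norm (e n w) \<le> (B * (2 * M) ^ n * (2 * M)) * norm (w - c) ^ n / fact n"
          by (simp add: mult_ac)
      qed (rule dc)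
      moreover have "norm (e (Suc n) z) \<le> (B * (2 * M) ^ n * (2 * M)) * norm (z - c) ^ Suc n / fact (Suc n)"
      proof (rule norm_segment_primitive_le[where f' = "\<lambda>w. P w * d n w + Q w * e n w"])
        fix w assume w: "w \<in> closed_segment c z"
        show "(e (Suc n) has_field_derivative P w * d n w + Q w * e n w) (at w)"
          using de[OF seg(2)[OF w], of "Suc n"] by (simp add: e'_def)
        let ?X = "B * (2 * M) ^ n * norm (w - c) ^ n / fact n"
        have "norm (P w * d n w + Q w * e n w) \<le> norm (P w) * norm (d n w) + norm (Q w) * norm (e n w)"
          by (metis norm_mult norm_triangle_ineq)
        also have "\<dots> \<le> M * ?X + M * ?X"
          using Suc.IH[OF seg(1)[OF w]] M(1) M(2,3)[OF seg(1)[OF w]]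
          by (intro add_mono mult_mono) auto
        finally show "norm (P w * d n w + Q w * e n w) \<le> (B * (2 * M) ^ n * (2 * M)) * norm (w - c) ^ n / fact n"
          by (simp add: mult_ac)
      qed (rule ec)
      ultimately show ?case by (simp add: mult_ac)
    qed
    define R where "R = norm (x - c) + r"
    define h where "h n = B * ((2 * M * R) ^ n / fact n)" for n
    have "summable h" unfolding h_def
      using summable_exp_generic[of "2 * M * R"] by (intro summable_mult) (simp add: field_simps scaleR_conv_of_real)
    moreover have "norm (d n y) \<le> h n \<and> norm (e n y) \<le> h n" if "y \<in> ball x r" for n y
    proof -
      have "norm (y - c) \<le> R" using that norm_triangle_ineq[of "x - c" "y - x"]
        by (simp add: R_def dist_norm norm_minus_commute algebra_simps)
      then have "B * (2 * M) ^ n * norm (y - c) ^ n / fact n \<le> B * (2 * M) ^ n * R ^ n / fact n"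
        using M(1) by (intro divide_right_mono mult_left_mono power_mono) (auto simp: B_def)
      moreover have "y \<in> K" unfolding K_def
        by (rule image_eqI[of _ _ "(1, y)"]) (use that in auto)
      ultimately show ?thesis using bd[of y n] by (auto simp: h_def power_mult_distrib mult_ac)
    qed
    ultimately show ?thesis using r by blast
  qed
  obtain u u' where u: "\<And>x. x \<in> V \<Longrightarrow> ((\<lambda>n. d n x) sums u x) \<and> ((\<lambda>n. d' n x) sums u' x) \<and> (u has_field_derivative u' x) (at x)"
  proof -
    have "\<exists>r h. 0 < r \<and> summable h \<and> (\<forall>\<^sub>F n in sequentially. \<forall>y\<in>ball x r \<inter> V. norm (d n y) \<le> h n)" if "x \<in> V" for x
      using conv[OF that] by (fastforce intro: always_eventually)
    from series_and_derivative_comparison_local[OF \<open>open V\<close> dd this] show ?thesis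
      using that by blast
  qed
  obtain v v' where v: "\<And>x. x \<in> V \<Longrightarrow> ((\<lambda>n. e n x) sums v x) \<and> ((\<lambda>n. e' n x) sums v' x) \<and> (v has_field_derivative v' x) (at x)"
  proof -
    have "\<exists>r h. 0 < r \<and> summable h \<and> (\<forall>\<^sub>F n in sequentially. \<forall>y\<in>ball x r \<inter> V. norm (e n y) \<le> h n)" if "x \<in> V" for x
      using conv[OF that] by (fastforce intro: always_eventually)
    from series_and_derivative_comparison_local[OF \<open>open V\<close> de this] show ?thesis
      using that by blast
  qed
  have "u' x = v x" if "x \<in> V" for x
  proof -
    have "(\<lambda>n. d' (Suc n) x) sums u' x" using u[OF that] sums_Suc_iff[of "\<lambda>n. d' n x" "u' x"] by (simp add: d'_def)
    then show ?thesis using v[OF that] by (auto simp: d'_def intro: sums_unique2)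
  qed
  moreover have "v' x = P x * u x + Q x * v x" if "x \<in> V" for x
  proof -
    have "(\<lambda>n. e' (Suc n) x) sums v' x" using v[OF that] sums_Suc_iff[of "\<lambda>n. e' n x" "v' x"] by (simp add: e'_def)
    moreover have "(\<lambda>n. P x * d n x + Q x * e n x) sums (P x * u x + Q x * v x)"
      using u[OF that] v[OF that] by (intro sums_add sums_mult) auto
    ultimately show ?thesis by (auto simp: e'_def intro: sums_unique2)
  qed
  moreover have "u c = a"
  proof -
    have "(\<lambda>n. d n c) sums (\<Sum>n\<in>{0}. d n c)"
      by (rule sums_finite) (use dc in \<open>auto simp: gr0_conv_Suc\<close>)
    then show ?thesis using u[OF c] sums_unique2 by (fastforce simp: d0)
  qed
  moreover have "v c = b"
  proof -
    have "(\<lambda>n. e n c) sums (\<Sum>n\<in>{0}. e n c)"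
      by (rule sums_finite) (use ec in \<open>auto simp: gr0_conv_Suc\<close>)
    then show ?thesis using v[OF c] sums_unique2 by (fastforce simp: e0)
  qed
  ultimately show ?thesis using that[of u v] u v by auto
qed

section \<open>Solutions and their Wronskian\<close>

locale hypergeometric =
  fixes \<alpha> \<beta> \<gamma> :: complex
begin

abbreviation sol :: "complex set \<Rightarrow> (complex \<Rightarrow> complex) \<Rightarrow> bool" where
  "sol \<equiv> hypergeometric_solution_on \<alpha> \<beta> \<gamma>"

definition hp :: "complex \<Rightarrow> complex" where
  "hp z = (\<gamma> - (1 + \<alpha> + \<beta>) * z) / (z * (1 - z))"

definition hq :: "complex \<Rightarrow> complex" where
  "hq z = \<alpha> * \<beta> / (z * (1 - z))"

lemma holomorphic_hp_hq:
  assumes "U \<subseteq> - {0, 1}"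
  shows "hp holomorphic_on U" "hq holomorphic_on U"
  using assms by (auto simp: hp_def[abs_def] hq_def[abs_def] intro!: holomorphic_intros)

lemma solI:
  assumes "open U" and u: "\<And>z. z \<in> U \<Longrightarrow> (u has_field_derivative v z) (at z)"
    and v: "\<And>z. z \<in> U \<Longrightarrow> (v has_field_derivative - hp z * v z + hq z * u z) (at z)"
  shows "sol U u"
proof -
  have du: "deriv u z = v z" if "z \<in> U" for z using u[OF that] by (rule DERIV_imp_deriv)
  have ddu: "deriv (deriv u) z = - hp z * v z + hq z * u z" if "z \<in> U" for z
  proof (rule DERIV_imp_deriv, rule has_field_derivative_transform_within_open[OF v[OF that] \<open>open U\<close> that])
  qed (simp add: du)
  have "u holomorphic_on U"
    using u \<open>open U\<close> holomorphic_on_open by blast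
  then show ?thesis
    unfolding hypergeometric_solution_on_def using ddu du by (auto simp: hp_def hq_def)
qed

lemma sol_has_derivs:
  assumes "open U" "sol U u" "z \<in> U"
  shows "(u has_field_derivative deriv u z) (at z)"
    and "(deriv u has_field_derivative - hp z * deriv u z + hq z * u z) (at z)"
proof -
  have u: "u holomorphic_on U" using assms by (simp add: hypergeometric_solution_on_def)
  show "(u has_field_derivative deriv u z) (at z)"
    using u assms holomorphic_derivI by blast
  have "(deriv u has_field_derivative deriv (deriv u) z) (at z)"
    using holomorphic_deriv[OF u] assms holomorphic_derivI by blast
  moreover have "deriv (deriv u) z = - hp z * deriv u z + hq z * u z"
    using assms unfolding hypergeometric_solution_on_def hp_def hq_def by (auto simp: algebra_simps)
  ultimately show "(deriv u has_field_derivative - hp z * deriv u z + hq z * u z) (at z)" by simp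
qed

lemma sol_subset: "sol U u \<Longrightarrow> V \<subseteq> U \<Longrightarrow> sol V u"
  unfolding hypergeometric_solution_on_def by (auto intro: holomorphic_on_subset)

lemma sol_holomorphic: "sol U u \<Longrightarrow> u holomorphic_on U"
  unfolding hypergeometric_solution_on_def by simp

lemma sol_comb:
  assumes "open U" "sol U u" "sol U w"
  shows "sol U (\<lambda>z. a * u z + b * w z)"
  by (rule solI[OF assms(1), where v = "\<lambda>z. a * deriv u z + b * deriv w z"])
     (auto intro!: derivative_eq_intros sol_has_derivs[OF assms(1,2)] sol_has_derivs[OF assms(1,3)]
           simp: algebra_simps)

section \<open>Wronskians: Abel's identity and Cramer's rule\<close>

definition wr :: "(complex \<Rightarrow> complex) \<Rightarrow> (complex \<Rightarrow> complex) \<Rightarrow> complex \<Rightarrow> complex" where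
  "wr u w z = u z * deriv w z - w z * deriv u z"

lemma wr_cong_open:
  assumes "open U" "z \<in> U" "\<And>z. z \<in> U \<Longrightarrow> u z = u' z" "\<And>z. z \<in> U \<Longrightarrow> w z = w' z"
  shows "wr u w z = wr u' w' z"
proof -
  have "deriv u z = deriv u' z" "deriv w z = deriv w' z"
    using assms by (auto intro!: deriv_cong_ev eventually_nhds_in_open elim!: eventually_mono[rotated] simp: eventually_nhds)
  then show ?thesis using assms by (simp add: wr_def)
qed

lemma wr_has_derivative:
  assumes "open U" "sol U u" "sol U w" "z \<in> U"
  shows "(wr u w has_field_derivative - hp z * wr u w z) (at z)"
  unfolding wr_def[abs_def]
  by (rule derivative_eq_intros sol_has_derivs[OF assms(1,2,4)] sol_has_derivs[OF assms(1,3,4)] refl)+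
     (simp add: algebra_simps)

text \<open>Abel's identity: every Wronskian satisfies W' = - hp W, so the quotient of two of them
  has derivative zero on a connected set.\<close>

lemma wr_ratio_constant:
  assumes "open U" "connected U" "sol U y1" "sol U y2" "sol U u" "sol U w"
    and nz: "\<And>z. z \<in> U \<Longrightarrow> wr y1 y2 z \<noteq> 0"
  obtains c where "\<And>z. z \<in> U \<Longrightarrow> wr u w z = c * wr y1 y2 z"
proof -
  have "((\<lambda>z. wr u w z / wr y1 y2 z) has_field_derivative 0) (at z)" if z: "z \<in> U" for z
    by (rule derivative_eq_intros wr_has_derivative[OF assms(1) _ _ z] assms refl nz z)+
       (simp add: algebra_simps)
  then obtain c where "\<And>z. z \<in> U \<Longrightarrow> wr u w z / wr y1 y2 z = c"
    using has_field_derivative_0_imp_constant_on[of U "\<lambda>z. wr u w z / wr y1 y2 z"] assms(1,2)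
    unfolding constant_on_def by blast
  then show ?thesis using that[of c] nz by (simp add: field_simps)
qed

text \<open>Cramer's rule: the coordinates of u are quotients of Wronskians, which are constant by
  \<open>wr_ratio_constant\<close>. This is where the two-dimensionality of the solution space comes
  from.\<close>

lemma sol_expand:
  assumes "open U" "connected U" "sol U y1" "sol U y2" "sol U u"
    and nz: "\<And>z. z \<in> U \<Longrightarrow> wr y1 y2 z \<noteq> 0"
  obtains a b where "\<And>z. z \<in> U \<Longrightarrow> u z = a * y1 z + b * y2 z"
proof -
  obtain a where a: "\<And>z. z \<in> U \<Longrightarrow> wr u y2 z = a * wr y1 y2 z"
    using wr_ratio_constant[OF assms(1-4,5,4) nz] by blast
  obtain b where b: "\<And>z. z \<in> U \<Longrightarrow> wr u y1 z = b * wr y1 y2 z"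
    using wr_ratio_constant[OF assms(1-4,5,3) nz] by blast
  have "u z = a * y1 z + - b * y2 z" if z: "z \<in> U" for z
  proof -
    have "u z * wr y1 y2 z = y1 z * wr u y2 z - y2 z * wr u y1 z"
      by (simp add: wr_def algebra_simps)
    also have "\<dots> = (a * y1 z + - b * y2 z) * wr y1 y2 z" by (simp add: a b z algebra_simps)
    finally show ?thesis using nz[OF z] by simp
  qed
  then show ?thesis using that by blast
qed

lemma sol_independent:
  assumes "open U" "z \<in> U" "sol U y1" "sol U y2" "wr y1 y2 z \<noteq> 0"
    and zero: "\<And>z. z \<in> U \<Longrightarrow> a * y1 z + b * y2 z = 0"
  shows "a = 0 \<and> b = 0"
proof -
  have "((\<lambda>z. a * y1 z + b * y2 z) has_field_derivative a * deriv y1 z + b * deriv y2 z) (at z)"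
    by (auto intro!: derivative_eq_intros sol_has_derivs[OF assms(1,3,2)] sol_has_derivs[OF assms(1,4,2)])
  moreover have "((\<lambda>z. a * y1 z + b * y2 z) has_field_derivative 0) (at z)"
    by (rule has_field_derivative_transform_within_open[OF DERIV_const assms(1,2)]) (simp add: zero)
  ultimately have d: "a * deriv y1 z + b * deriv y2 z = 0" by (rule DERIV_unique)
  \<comment> \<open>Cramer's rule for the linear system formed by the relation and its derivative;
    the determinant of that system is the Wronskian.\<close>
  have "a * wr y1 y2 z = deriv y2 z * (a * y1 z + b * y2 z) - y2 z * (a * deriv y1 z + b * deriv y2 z)"
    "b * wr y1 y2 z = y1 z * (a * deriv y1 z + b * deriv y2 z) - deriv y1 z * (a * y1 z + b * y2 z)"
    by (simp_all add: wr_def algebra_simps)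
  then have "a * wr y1 y2 z = 0" "b * wr y1 y2 z = 0" unfolding d zero[OF assms(2)] by simp_all
  then show ?thesis using assms(5) by simp
qed

end

section \<open>Slit planes and branches of the logarithm\<close>

definition cut_plane :: "real set \<Rightarrow> complex set" where
  "cut_plane I = {z. Im z \<noteq> 0 \<or> Re z \<in> I}"

lemma open_cut_plane: "open I \<Longrightarrow> open (cut_plane I)"
proof -
  assume "open I"
  then have "open (Re -` I)" "open (Im -` (- {0}))"
    by (auto intro!: open_vimage continuous_intros)
  moreover have "cut_plane I = Im -` (- {0}) \<union> Re -` I" by (auto simp: cut_plane_def)
  ultimately show ?thesis by auto
qed

lemma cut_plane_segment:
  assumes "convex I" "c \<in> I" "z \<in> cut_plane I"
  shows "closed_segment (of_real c) z \<subseteq> cut_plane I"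
proof
  fix w assume "w \<in> closed_segment (of_real c) z"
  then obtain t where t: "0 \<le> t" "t \<le> 1" "w = (1 - t) *\<^sub>R of_real c + t *\<^sub>R z"
    by (auto simp: in_segment)
  have "Re w = (1 - t) *\<^sub>R c + t *\<^sub>R Re z" "Im w = t * Im z" using t by auto
  moreover have "(1 - t) *\<^sub>R c + t *\<^sub>R Re z \<in> I" if "Re z \<in> I"
    using convexD_alt[OF assms(1,2) that, of t] t by simp
  ultimately show "w \<in> cut_plane I" using assms(2,3) by (cases "t = 0") (auto simp: cut_plane_def)
qed

lemma starlike_cut_plane_Int:
  assumes "convex I" "c \<in> I" "convex B" "of_real c \<in> B"
  shows "starlike (cut_plane I \<inter> B)"
  unfolding starlike_def
proof (intro bexI ballI Int_greatest)
  fix z assume z: "z \<in> cut_plane I \<inter> B"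
  show "closed_segment (of_real c) z \<subseteq> cut_plane I" using cut_plane_segment[OF assms(1,2)] z by blast
  show "closed_segment (of_real c) z \<subseteq> B" using assms(3,4) z by (simp add: closed_segment_subset)
qed (use assms in \<open>auto simp: cut_plane_def\<close>)

lemma connected_cut_plane_Int:
  assumes "convex I" "c \<in> I" "convex B" "of_real c \<in> B"
  shows "connected (cut_plane I \<inter> B)"
  using starlike_imp_connected[OF starlike_cut_plane_Int[OF assms]] .

definition charts :: "real set set" where
  "charts = {{..<0}, {0<..<1}, {1<..}}"

lemma chartsE:
  assumes "I \<in> charts"
  obtains "I = {..<0}" | "I = {0<..<1}" | "I = {1<..}"
  using assms by (auto simp: charts_def)

lemma charts_mem [simp]: "{..<0} \<in> charts" "{0<..<1} \<in> charts" "{1<..} \<in> charts"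
  by (auto simp: charts_def)

lemma charts_props:
  assumes "I \<in> charts"
  shows "open I" "convex I" "I \<noteq> {}" "I \<subseteq> {..<0} \<or> I \<subseteq> {0<..}" "I \<subseteq> {..<1} \<or> I \<subseteq> {1<..}"
proof -
  have "-1 \<in> I \<or> 1 / 2 \<in> I \<or> 2 \<in> I" using assms by (auto elim!: chartsE)
  then show "I \<noteq> {}" by blast
qed (use assms in \<open>auto elim!: chartsE simp: is_interval_convex_1[symmetric]\<close>)

lemma charts_cover: "z \<notin> {0, 1} \<Longrightarrow> \<exists>I\<in>charts. z \<in> cut_plane I"
proof -
  assume z: "z \<notin> {0, 1}"
  show ?thesis
  proof (cases "Im z = 0")
    case True
    then have "Re z \<noteq> 0" "Re z \<noteq> 1" using z by (auto simp: complex_eq_iff)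
    then have "Re z \<in> {..<0} \<or> Re z \<in> {0<..<1} \<or> Re z \<in> {1<..}" by auto
    then show ?thesis unfolding charts_def cut_plane_def by blast
  qed (auto simp: charts_def cut_plane_def)
qed

text \<open>Distinct charts meet only in the two open half planes, so a change of chart is described
  by one constant matrix above and one below the axis, and nothing happens at real points.\<close>

lemma charts_disjoint:
  assumes "I \<in> charts" "J \<in> charts" "z \<in> cut_plane I" "z \<in> cut_plane J" "Im z = 0"
  shows "I = J"
  using assms by (auto simp: cut_plane_def elim!: chartsE)

lemma open_chart: "I \<in> charts \<Longrightarrow> open (cut_plane I)"
  by (simp add: open_cut_plane charts_props)

lemma connected_chart: "I \<in> charts \<Longrightarrow> connected (cut_plane I)"
  using connected_cut_plane_Int[of I _ UNIV] charts_props(2,3)[of I] by auto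

lemma chart_subset: "I \<in> charts \<Longrightarrow> cut_plane I \<subseteq> - {0, 1}"
  by (auto simp: cut_plane_def elim!: chartsE)

text \<open>A branch of log (z - x) that is the principal one above the real axis in every chart;
  the summand pi i in charts left of x achieves this. All discrepancies between charts are thereby
  moved to the lower half plane, where a chart left of x is ahead by 2 pi i.\<close>

definition log_branch :: "real \<Rightarrow> real set \<Rightarrow> complex \<Rightarrow> complex" where
  "log_branch x I z =
     (if I \<subseteq> {x<..} then Ln (z - of_real x) else Ln (of_real x - z) + \<i> * of_real pi)"

lemma log_branch_has_derivative:
  assumes "I \<subseteq> {..<x} \<or> I \<subseteq> {x<..}" "z \<in> cut_plane I"
  shows "(log_branch x I has_field_derivative 1 / (z - of_real x)) (at z)"
proof (cases "I \<subseteq> {x<..}")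
  case True
  then have *: "z - of_real x \<notin> \<real>\<^sub>\<le>\<^sub>0"
    using assms(2) by (auto simp: cut_plane_def complex_nonpos_Reals_iff)
  show ?thesis unfolding log_branch_def[abs_def] using True *
    by (auto intro!: derivative_eq_intros simp: field_simps)
next
  case False
  then have *: "of_real x - z \<notin> \<real>\<^sub>\<le>\<^sub>0"
    using assms by (auto simp: cut_plane_def complex_nonpos_Reals_iff)
  then have "z \<noteq> of_real x" by auto
  then show ?thesis unfolding log_branch_def[abs_def] using False *
    by (auto intro!: derivative_eq_intros simp: divide_simps)
qed

lemma log_branch_upper:
  assumes "Im z > 0"
  shows "log_branch x I z = Ln (z - of_real x)"
proof -
  have "z - of_real x \<noteq> 0" using assms by (auto simp: complex_eq_iff)
  then show ?thesis using Ln_minus[of "z - of_real x"] assms by (auto simp: log_branch_def)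
qed

lemma log_branch_lower:
  assumes "Im z < 0"
  shows "log_branch x I z = Ln (z - of_real x) + (if I \<subseteq> {x<..} then 0 else 2 * of_real pi * \<i>)"
proof -
  have "z - of_real x \<noteq> 0" using assms by (auto simp: complex_eq_iff)
  then show ?thesis using Ln_minus[of "z - of_real x"] assms by (auto simp: log_branch_def)
qed

lemma exp_log_branch:
  assumes "z \<noteq> of_real x"
  shows "exp (log_branch x I z) = z - of_real x"
  using assms by (auto simp: log_branch_def exp_add)

section \<open>Connection matrices\<close>

no_notation fps_nth (infixl \<open>$\<close> 75)

lemma open_half_planes: "open {z. Im z > 0}" "open {z. Im z < 0}"
  "connected {z. Im z > 0}" "connected {z. Im z < 0}"
  by (auto simp: open_halfspace_Im_gt open_halfspace_Im_lt convex_halfspace_Im_gt convex_halfspace_Im_lt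
        intro!: convex_connected)

lemma half_planes_subset_chart: "{z. Im z > 0} \<subseteq> cut_plane I" "{z. Im z < 0} \<subseteq> cut_plane I"
  by (auto simp: cut_plane_def)

lemma chart_position:
  "\<not> {..<0::real} \<subseteq> {0<..}" "\<not> {..<0::real} \<subseteq> {1<..}" "{0<..<1::real} \<subseteq> {0<..}"
  "\<not> {0<..<1::real} \<subseteq> {1<..}" "{1::real<..} \<subseteq> {0<..}"
  using subsetD[of "{..<0::real}" "{0<..}" "-1"] subsetD[of "{..<0::real}" "{1<..}" "-1"]
    subsetD[of "{0<..<1::real}" "{1<..}" "1 / 2"] by auto

context hypergeometric
begin

text \<open>The integrating factor z^\<gamma> (z - 1)^(1 + \<alpha> + \<beta> - \<gamma>), obtained
  from the partial fractions hp = \<gamma> / z + (\<gamma> - 1 - \<alpha> - \<beta>) / (1 - z). By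
  Abel's identity, Wronskian times weight is constant.\<close>

definition weight :: "real set \<Rightarrow> complex \<Rightarrow> complex" where
  "weight I z = exp (\<gamma> * log_branch 0 I z - (\<gamma> - 1 - \<alpha> - \<beta>) * log_branch 1 I z)"

lemma wr_weight_constant:
  assumes I: "I \<in> charts" and sol: "sol (cut_plane I) u" "sol (cut_plane I) w"
  obtains K where "\<And>z. z \<in> cut_plane I \<Longrightarrow> wr u w z * weight I z = K"
proof -
  have "((\<lambda>z. wr u w z * weight I z) has_field_derivative 0) (at z)" if z: "z \<in> cut_plane I" for z
  proof -
    have nz: "z \<noteq> 0" "z - 1 \<noteq> 0" "1 - z \<noteq> 0" using chart_subset[OF I] z by auto
    have "(weight I has_field_derivative
        weight I z * (\<gamma> * (1 / (z - of_real 0)) - (\<gamma> - 1 - \<alpha> - \<beta>) * (1 / (z - of_real 1)))) (at z)"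
      unfolding weight_def[abs_def]
      by (rule derivative_eq_intros log_branch_has_derivative charts_props[OF I] z refl)+ simp
    also have "\<gamma> * (1 / (z - of_real 0)) - (\<gamma> - 1 - \<alpha> - \<beta>) * (1 / (z - of_real 1)) = hp z"
    proof -
      have "1 / (z - 1) = - 1 / (1 - z)" using nz by (simp add: field_simps)
      then have "\<gamma> * (1 / (z - of_real 0)) - (\<gamma> - 1 - \<alpha> - \<beta>) * (1 / (z - of_real 1))
          = \<gamma> / z + (\<gamma> - 1 - \<alpha> - \<beta>) / (1 - z)" by simp
      also have "\<dots> = hp z" using nz unfolding hp_def by (simp add: add_frac_eq) (simp add: algebra_simps)
      finally show ?thesis .
    qed
    finally have w: "(weight I has_field_derivative weight I z * hp z) (at z)" .
    show ?thesis
      by (rule derivative_eq_intros w wr_has_derivative[OF open_chart[OF I] sol z] refl)+ (simp add: algebra_simps)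
  qed
  then show ?thesis
    using has_field_derivative_0_imp_constant_on[of "cut_plane I" "\<lambda>z. wr u w z * weight I z"]
      open_chart[OF I] connected_chart[OF I] that unfolding constant_on_def by blast
qed

lemma weight_nonzero [simp]: "weight I z \<noteq> 0"
  by (simp add: weight_def)

lemma wr_nonzero_chart:
  assumes "I \<in> charts" "sol (cut_plane I) u" "sol (cut_plane I) w"
    and "z0 \<in> cut_plane I" "wr u w z0 \<noteq> 0" "z \<in> cut_plane I"
  shows "wr u w z \<noteq> 0"
  using wr_weight_constant[OF assms(1-3)] assms(4-6) weight_nonzero by (metis mult_eq_0_iff)

lemma sol_initial_value:
  assumes I: "I \<in> charts" and c: "c \<in> I"
  obtains u where "sol (cut_plane I) u" "u (of_real c) = a" "deriv u (of_real c) = b"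
proof -
  have cI: "of_real c \<in> cut_plane I" using c by (simp add: cut_plane_def)
  obtain u v where uv: "u (of_real c) = a" "v (of_real c) = b"
    "\<And>z. z \<in> cut_plane I \<Longrightarrow> (u has_field_derivative v z) (at z)"
    "\<And>z. z \<in> cut_plane I \<Longrightarrow> (v has_field_derivative hq z * u z + (- hp z) * v z) (at z)"
  proof (rule linear_ode_starlike_exists[of "cut_plane I" "of_real c" hq "\<lambda>z. - hp z" a b])
    show "(\<lambda>z. - hp z) holomorphic_on cut_plane I" "hq holomorphic_on cut_plane I"
      using holomorphic_hp_hq[OF chart_subset[OF I]] by (auto intro!: holomorphic_intros)
  qed (use open_chart[OF I] cI cut_plane_segment[OF charts_props(2)[OF I] c] in auto)
  show ?thesis
  proof (rule that)
    show "sol (cut_plane I) u"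
      by (rule solI[OF open_chart[OF I] uv(3)]) (use uv(4) in \<open>auto simp: add.commute\<close>)
    show "deriv u (of_real c) = b" using uv(2) DERIV_imp_deriv[OF uv(3)[OF cI]] by simp
  qed (rule uv)
qed

lemma fundamental_pair:
  assumes "I \<in> charts"
  obtains y1 y2 where "sol (cut_plane I) y1" "sol (cut_plane I) y2"
    "\<And>z. z \<in> cut_plane I \<Longrightarrow> wr y1 y2 z \<noteq> 0"
proof -
  obtain c where c: "c \<in> I" using charts_props(3)[OF assms] by blast
  obtain y1 where y1: "sol (cut_plane I) y1" "y1 (of_real c) = 1" "deriv y1 (of_real c) = 0"
    using sol_initial_value[OF assms c] .
  obtain y2 where y2: "sol (cut_plane I) y2" "y2 (of_real c) = 0" "deriv y2 (of_real c) = 1"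
    using sol_initial_value[OF assms c] .
  have "of_real c \<in> cut_plane I" using c by (simp add: cut_plane_def)
  moreover have "wr y1 y2 (of_real c) \<noteq> 0" by (simp add: wr_def y1 y2)
  ultimately show ?thesis using that[OF y1(1) y2(1)] wr_nonzero_chart[OF assms y1(1) y2(1)] by blast
qed

text \<open>The expansion of u in a fundamental pair of the chart makes sense on the whole chart.
  This lets the bases of all charts be normalised to agree above the real axis.\<close>

lemma sol_extend_from_upper:
  assumes "I \<in> charts" "sol {z. Im z > 0} u"
  obtains v where "sol (cut_plane I) v" "\<And>z. Im z > 0 \<Longrightarrow> v z = u z"
proof -
  obtain y1 y2 where y: "sol (cut_plane I) y1" "sol (cut_plane I) y2"
    "\<And>z. z \<in> cut_plane I \<Longrightarrow> wr y1 y2 z \<noteq> 0" using fundamental_pair[OF assms(1)] by blast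
  obtain a b where "\<And>z. z \<in> {z. Im z > 0} \<Longrightarrow> u z = a * y1 z + b * y2 z"
    using sol_expand[OF open_half_planes(1,3) sol_subset[OF y(1)] sol_subset[OF y(2)] assms(2)]
      half_planes_subset_chart y(3) by blast
  then show ?thesis
    by (intro that[of "\<lambda>z. a * y1 z + b * y2 z"] sol_comb y open_chart assms) auto
qed

section \<open>Row-vector bases and compatible systems of charts\<close>

definition wrv :: "(complex \<Rightarrow> complex^2) \<Rightarrow> complex \<Rightarrow> complex" where
  "wrv Y z = wr (\<lambda>z. Y z $ 1) (\<lambda>z. Y z $ 2) z"

lemma wrv_mult:
  assumes "open U" "z \<in> U" "\<And>i. sol U (\<lambda>z. X z $ i)" "\<And>z. z \<in> U \<Longrightarrow> Y z = X z v* A"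
  shows "wrv Y z = wrv X z * det A"
proof -
  note d = sol_has_derivs(1)[OF assms(1) assms(3) assms(2)]
  have "((\<lambda>z. X z $ 1 * A $ 1 $ j + X z $ 2 * A $ 2 $ j) has_field_derivative
      deriv (\<lambda>z. X z $ 1) z * A $ 1 $ j + deriv (\<lambda>z. X z $ 2) z * A $ 2 $ j) (at z)" for j
    by (rule derivative_eq_intros d refl)+ simp
  then have "((\<lambda>z. Y z $ j) has_field_derivative
      deriv (\<lambda>z. X z $ 1) z * A $ 1 $ j + deriv (\<lambda>z. X z $ 2) z * A $ 2 $ j) (at z)" for j
    by (rule has_field_derivative_transform_within_open[OF _ assms(1,2)])
       (simp add: assms(4) vector_matrix_mult_def sum_2)
  note this[THEN DERIV_imp_deriv]
  then show ?thesis
    unfolding wrv_def wr_def by (simp add: assms(2,4) vector_matrix_mult_def sum_2 det_2 algebra_simps)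
qed

end

text \<open>Bases are row vectors, so constants act from the right: in chart \<open>I\<close> a germ
  is \<open>Y I z v* A\<close>, and a change of chart alters only \<open>A\<close>.\<close>

locale chart_system = hypergeometric \<alpha> \<beta> \<gamma> for \<alpha> \<beta> \<gamma> :: complex +
  fixes Y :: "real set \<Rightarrow> complex \<Rightarrow> complex^2" and C :: "real set \<Rightarrow> complex^2^2"
  assumes sol_Y: "I \<in> charts \<Longrightarrow> sol (cut_plane I) (\<lambda>z. Y I z $ i)"
    and wrv_nonzero: "I \<in> charts \<Longrightarrow> z \<in> cut_plane I \<Longrightarrow> wrv (Y I) z \<noteq> 0"
    and Y_upper: "I \<in> charts \<Longrightarrow> J \<in> charts \<Longrightarrow> Im z > 0 \<Longrightarrow> Y I z = Y J z"
    and Y_lower: "I \<in> charts \<Longrightarrow> Im z < 0 \<Longrightarrow> Y I z = Y {0<..<1} z v* C I"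

context hypergeometric
begin

theorem chart_system_exists: "\<exists>Y C. chart_system \<alpha> \<beta> \<gamma> Y C"
proof -
  let ?M = "{0<..<1::real}"
  obtain y1 y2 where y: "sol (cut_plane ?M) y1" "sol (cut_plane ?M) y2"
    "\<And>z. z \<in> cut_plane ?M \<Longrightarrow> wr y1 y2 z \<noteq> 0" using fundamental_pair[of ?M] by auto
  have yu: "sol {z. Im z > 0} y1" "sol {z. Im z > 0} y2"
    using y sol_subset half_planes_subset_chart by blast+
  have "\<exists>v. sol (cut_plane I) v \<and> (\<forall>z. Im z > 0 \<longrightarrow> v z = y1 z)" if "I \<in> charts" for I
    using sol_extend_from_upper[OF that yu(1)] by metis
  then obtain v1 where v1: "\<And>I. I \<in> charts \<Longrightarrow> sol (cut_plane I) (v1 I)"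
    "\<And>I z. I \<in> charts \<Longrightarrow> Im z > 0 \<Longrightarrow> v1 I z = y1 z" by metis
  have "\<exists>v. sol (cut_plane I) v \<and> (\<forall>z. Im z > 0 \<longrightarrow> v z = y2 z)" if "I \<in> charts" for I
    using sol_extend_from_upper[OF that yu(2)] by metis
  then obtain v2 where v2: "\<And>I. I \<in> charts \<Longrightarrow> sol (cut_plane I) (v2 I)"
    "\<And>I z. I \<in> charts \<Longrightarrow> Im z > 0 \<Longrightarrow> v2 I z = y2 z" by metis
  define Y where "Y I z = (vector [v1 I z, v2 I z] :: complex^2)" for I z
  have solY: "sol (cut_plane I) (\<lambda>z. Y I z $ i)" if "I \<in> charts" for I i
    using v1(1)[OF that] v2(1)[OF that] exhaust_2[of i] by (auto simp: Y_def)
  have nz: "wrv (Y I) z \<noteq> 0" if I: "I \<in> charts" and z: "z \<in> cut_plane I" for I z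
  proof -
    have i: "\<i> \<in> {z. Im z > 0}" by simp
    \<comment> \<open>All pairs agree with y1, y2 above the axis, so nonvanishing of the Wronskian
      at \<i> is inherited, and \<open>wr_nonzero_chart\<close> spreads it over the chart.\<close>
    have "wr (v1 I) (v2 I) \<i> = wr y1 y2 \<i>"
      by (rule wr_cong_open[OF open_half_planes(1) i]) (use v1(2) v2(2) I in auto)
    then have "wr (v1 I) (v2 I) \<i> \<noteq> 0" using y(3)[of \<i>] by (simp add: cut_plane_def)
    then have "wr (v1 I) (v2 I) z \<noteq> 0"
      by (rule wr_nonzero_chart[OF I v1(1)[OF I] v2(1)[OF I] _ _ z, rotated]) (simp add: cut_plane_def)
    then show ?thesis by (simp add: wrv_def Y_def)
  qed
  have "\<exists>A. \<forall>z. Im z < 0 \<longrightarrow> Y I z = Y ?M z v* A" if I: "I \<in> charts" for I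
  proof -
    have "\<exists>a b. \<forall>z. Im z < 0 \<longrightarrow> Y I z $ i = a * Y ?M z $ 1 + b * Y ?M z $ 2" for i
    proof -
      have s: "sol {z. Im z < 0} (\<lambda>z. Y J z $ j)" if "J \<in> charts" for J j
        by (rule sol_subset[OF solY[OF that] half_planes_subset_chart(2)])
      obtain a b where "\<And>z. z \<in> {z. Im z < 0} \<Longrightarrow> Y I z $ i = a * Y ?M z $ 1 + b * Y ?M z $ 2"
      proof (rule sol_expand[OF open_half_planes(2,4) s s s[OF I, of i]])
        show "wr (\<lambda>z. Y ?M z $ 1) (\<lambda>z. Y ?M z $ 2) z \<noteq> 0" if "z \<in> {z. Im z < 0}" for z
          using nz[of ?M z] that half_planes_subset_chart(2)[of ?M] by (auto simp: wrv_def)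
      qed (use that in auto)
      then show ?thesis by auto
    qed
    then obtain a b where ab: "\<And>i z. Im z < 0 \<Longrightarrow> Y I z $ i = a i * Y ?M z $ 1 + b i * Y ?M z $ 2" by metis
    show ?thesis
      by (intro exI[of _ "\<chi> i j. if i = 1 then a j else b j"])
         (simp add: vec_eq_iff ab vector_matrix_mult_def sum_2 mult.commute)
  qed
  then obtain C where C: "\<And>I z. I \<in> charts \<Longrightarrow> Im z < 0 \<Longrightarrow> Y I z = Y ?M z v* C I" by metis
  have "chart_system \<alpha> \<beta> \<gamma> Y C"
  proof
    show "Y I z = Y J z" if "I \<in> charts" "J \<in> charts" "Im z > 0" for I J z
      using that by (simp add: Y_def v1(2) v2(2))
  qed (fact solY nz C)+
  then show ?thesis by blast
qed

end

section \<open>Uniqueness of coordinates and determinants of the connection matrices\<close>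

context chart_system
begin

abbreviation CL :: "complex^2^2" where "CL \<equiv> C {..<0}"
abbreviation CR :: "complex^2^2" where "CR \<equiv> C {1<..}"

lemma Y_combination_zero:
  assumes "I \<in> charts" "open U" "U \<subseteq> cut_plane I" "z \<in> U"
    and "\<And>z. z \<in> U \<Longrightarrow> a * Y I z $ 1 + b * Y I z $ 2 = 0"
  shows "a = 0 \<and> b = 0"
  by (rule sol_independent[OF assms(2,4) sol_subset[OF sol_Y[OF assms(1)] assms(3)]
        sol_subset[OF sol_Y[OF assms(1)] assms(3)] _ assms(5)])
     (use wrv_nonzero[OF assms(1), of z] assms in \<open>auto simp: wrv_def\<close>)

lemma Y_mult_cancel:
  assumes "I \<in> charts" "open U" "U \<subseteq> cut_plane I" "z \<in> U"
    and "\<And>z. z \<in> U \<Longrightarrow> Y I z v* A = Y I z v* B"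
  shows "A = B"
proof -
  have "A $ 1 $ j - B $ 1 $ j = 0 \<and> A $ 2 $ j - B $ 2 $ j = 0" for j
  proof (rule Y_combination_zero[OF assms(1-4)])
    fix z assume "z \<in> U"
    from arg_cong[OF assms(5)[OF this], of "\<lambda>v. v $ j"]
    show "(A $ 1 $ j - B $ 1 $ j) * Y I z $ 1 + (A $ 2 $ j - B $ 2 $ j) * Y I z $ 2 = 0"
      by (simp add: vector_matrix_mult_def sum_2 algebra_simps)
  qed
  then show ?thesis by (simp add: vec_eq_iff forall_2)
qed

text \<open>One constant serves all charts, because at \<i> both the bases and the logarithms agree.
  Below the axis it turns the jumps of the weight into determinants.\<close>

lemma wrv_weight_constant:
  obtains K where "K \<noteq> 0" "\<And>I z. I \<in> charts \<Longrightarrow> z \<in> cut_plane I \<Longrightarrow> wrv (Y I) z * weight I z = K"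
proof -
  let ?M = "{0<..<1::real}"
  have pI: "\<i> \<in> cut_plane I" for I by (simp add: cut_plane_def)
  have "wrv (Y I) z * weight I z = wrv (Y ?M) \<i> * weight ?M \<i>" if I: "I \<in> charts" and z: "z \<in> cut_plane I" for I z
  proof -
    have "wrv (Y I) z * weight I z = wrv (Y I) \<i> * weight I \<i>"
      using wr_weight_constant[OF I sol_Y[OF I] sol_Y[OF I]] z pI unfolding wrv_def by metis
    also have "wrv (Y I) \<i> = wrv (Y ?M) \<i>" unfolding wrv_def
      by (rule wr_cong_open[OF open_half_planes(1)]) (auto simp: Y_upper[OF I, of ?M])
    also have "weight I \<i> = weight ?M \<i>" by (simp add: weight_def log_branch_upper)
    finally show ?thesis .
  qed
  moreover have "wrv (Y ?M) \<i> * weight ?M \<i> \<noteq> 0" using wrv_nonzero[of ?M \<i>] pI by simp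
  ultimately show ?thesis using that by blast
qed

text \<open>Compare at -\<i>: the Wronskian of \<open>Y I\<close> is that of the middle chart times
  \<open>det (C I)\<close>, while multiplication by the respective weights makes the two
  equal.\<close>

lemma det_C:
  assumes I: "I \<in> charts"
  shows "det (C I) = weight {0<..<1} (-\<i>) / weight I (-\<i>)"
proof -
  let ?M = "{0<..<1::real}"
  have m: "-\<i> \<in> cut_plane J" for J by (simp add: cut_plane_def)
  have "wrv (Y I) (-\<i>) = wrv (Y ?M) (-\<i>) * det (C I)"
    by (rule wrv_mult[OF open_half_planes(2)])
       (use Y_lower[OF I] sol_subset[OF sol_Y half_planes_subset_chart(2)] in auto)
  moreover have "wrv (Y I) (-\<i>) * weight I (-\<i>) = wrv (Y ?M) (-\<i>) * weight ?M (-\<i>)"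
    using wrv_weight_constant I m by (metis charts_mem(2))
  ultimately show ?thesis
    using wrv_nonzero[of ?M "-\<i>"] m by (simp add: field_simps)
qed

lemma det_CL: "det CL = exp (- (2 * of_real pi * \<i> * \<gamma>))"
  unfolding det_C[OF charts_mem(1)] weight_def exp_diff[symmetric]
  by (rule arg_cong[of _ _ exp])
     (simp add: log_branch_lower chart_position algebra_simps)

lemma det_CR: "det CR = exp (- (2 * of_real pi * \<i> * (\<gamma> - \<alpha> - \<beta>)))"
proof -
  \<comment> \<open>The summand 2 pi i comes from the -1 in the exponent \<gamma> - 1 - \<alpha> -
    \<beta> of the weight.\<close>
  have "det CR = exp (- (2 * of_real pi * \<i> * (\<gamma> - \<alpha> - \<beta>)) + 2 * of_real pi * \<i>)"
    unfolding det_C[OF charts_mem(3)] weight_def exp_diff[symmetric]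
    by (rule arg_cong[of _ _ exp]) (simp add: log_branch_lower chart_position algebra_simps)
  also have "\<dots> = exp (- (2 * of_real pi * \<i> * (\<gamma> - \<alpha> - \<beta>)))"
    by (subst exp_add) simp
  finally show ?thesis .
qed

lemma C_mid: "C {0<..<1} = mat 1"
  by (rule Y_mult_cancel[OF charts_mem(2) open_half_planes(2) half_planes_subset_chart(2), of "-\<i>"])
     (simp_all add: Y_lower[OF charts_mem(2), symmetric])

lemma det_C_nonzero: "I \<in> charts \<Longrightarrow> det (C I) \<noteq> 0"
  by (simp add: det_C)

end

section \<open>Inverses of two by two matrices\<close>

text \<open>The adjugate formula, from which integrality of the inverse of a matrix in
  \<open>SL2Z\<close> is read off entry by entry.\<close>

definition inv2 :: "complex^2^2 \<Rightarrow> complex^2^2" where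
  "inv2 A = vector [vector [A $ 2 $ 2 / det A, - A $ 1 $ 2 / det A],
                    vector [- A $ 2 $ 1 / det A, A $ 1 $ 1 / det A]]"

lemma mat2_eq_iff:
  "A = B \<longleftrightarrow> A $ 1 $ 1 = B $ 1 $ 1 \<and> A $ 1 $ 2 = B $ 1 $ 2 \<and> A $ 2 $ 1 = B $ 2 $ 1 \<and> A $ 2 $ 2 = B $ 2 $ 2"
  for A B :: "complex^2^2"
  by (simp add: vec_eq_iff forall_2)

lemma mat1_nth2 [simp]: "(mat 1 :: complex^2^2) $ 1 $ 1 = 1" "(mat 1 :: complex^2^2) $ 1 $ 2 = 0"
  "(mat 1 :: complex^2^2) $ 2 $ 1 = 0" "(mat 1 :: complex^2^2) $ 2 $ 2 = 1"
  by (simp_all add: mat_def)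

lemma mult2_nth: "(A ** B) $ i $ j = A $ i $ 1 * B $ 1 $ j + A $ i $ 2 * B $ 2 $ j"
  for A B :: "complex^2^2"
  by (simp add: matrix_matrix_mult_def sum_2)

lemma inv2_left: "det A \<noteq> 0 \<Longrightarrow> inv2 A ** A = mat 1"
  and inv2_right: "det A \<noteq> 0 \<Longrightarrow> A ** inv2 A = mat 1"
  by (simp_all add: mat2_eq_iff mult2_nth inv2_def add_divide_distrib[symmetric] diff_divide_distrib[symmetric])
     (simp_all add: det_2 algebra_simps)

lemma det_inv2: "det A \<noteq> 0 \<Longrightarrow> det (inv2 A) = 1 / det A"
  using arg_cong[OF inv2_left, of A det] by (simp add: det_mul field_simps)

lemma inv2_unique:
  assumes "A ** B = mat 1"
  shows "B = inv2 A" "det A \<noteq> 0"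
proof -
  show "det A \<noteq> 0" using arg_cong[OF assms, of det] by (auto simp: det_mul)
  then have "inv2 A ** (A ** B) = B" by (simp add: matrix_mul_assoc inv2_left)
  then show "B = inv2 A" by (simp add: assms)
qed

lemma inv2_mult: "det A \<noteq> 0 \<Longrightarrow> det B \<noteq> 0 \<Longrightarrow> inv2 (A ** B) = inv2 B ** inv2 A"
  by (rule inv2_unique(1)[symmetric])
     (metis inv2_right matrix_mul_assoc matrix_mul_rid)

lemma inv2_inv2: "det A \<noteq> 0 \<Longrightarrow> inv2 (inv2 A) = A"
  by (rule inv2_unique(1)[symmetric]) (rule inv2_left)

lemma SL2Z_mult: "A \<in> SL2Z \<Longrightarrow> B \<in> SL2Z \<Longrightarrow> A ** B \<in> SL2Z"
  by (auto simp: SL2Z_def det_mul mult2_nth)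

lemma SL2Z_inv2: "A \<in> SL2Z \<Longrightarrow> inv2 A \<in> SL2Z"
  unfolding SL2Z_def mem_Collect_eq
  by (intro conjI) (simp add: forall_2 inv2_def, simp add: det_inv2)

section \<open>Analytic continuation\<close>

lemma analytic_continuation_along_const:
  assumes "path p" "open U" "path_image p \<subseteq> U" "f holomorphic_on U"
  shows "analytic_continuation_along p (\<lambda>_. f)"
  unfolding analytic_continuation_along_def
proof
  fix t :: real assume t: "t \<in> {0..1}"
  then have "p t \<in> U" using assms(3) by (auto simp: path_image_def)
  then obtain r where r: "r > 0" "ball (p t) r \<subseteq> U" using assms(2) openE by blast
  obtain \<epsilon> where "\<epsilon> > 0" "\<And>s. s \<in> {0..1} \<Longrightarrow> \<bar>s - t\<bar> < \<epsilon> \<Longrightarrow> dist (p s) (p t) < r"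
    using assms(1) t r(1) unfolding path_def continuous_on_iff dist_real_def by meson
  then show "\<exists>r>0. f holomorphic_on ball (p t) r \<and> (\<exists>\<epsilon>>0. \<forall>s\<in>{0..1}. \<bar>s - t\<bar> < \<epsilon> \<longrightarrow>
      p s \<in> ball (p t) r \<and> (\<forall>\<^sub>F z in nhds (p s). f z = f z))"
    using r holomorphic_on_subset[OF assms(4) r(2)]
    by (intro exI[of _ r] conjI exI[of _ \<epsilon>]) (auto simp: dist_commute)
qed

lemma analytic_continuation_along_join:
  assumes F: "analytic_continuation_along p F" and G: "analytic_continuation_along q G"
    and q: "path q" and pq: "pathfinish p = pathstart q"
    and eq: "\<forall>\<^sub>F z in nhds (pathfinish p). F 1 z = G 0 z"
  shows "analytic_continuation_along (p +++ q) (\<lambda>t. if t \<le> 1 / 2 then F (2 * t) else G (2 * t - 1))"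
  unfolding analytic_continuation_along_def
proof
  fix t :: real assume t: "t \<in> {0..1}"
  let ?H = "\<lambda>t. if t \<le> 1 / 2 then F (2 * t) else G (2 * t - 1)"
  consider "t < 1 / 2" | "t = 1 / 2" | "t > 1 / 2" by linarith
  then show "\<exists>r>0. ?H t holomorphic_on ball ((p +++ q) t) r \<and> (\<exists>\<epsilon>>0. \<forall>s\<in>{0..1}. \<bar>s - t\<bar> < \<epsilon> \<longrightarrow>
      (p +++ q) s \<in> ball ((p +++ q) t) r \<and> (\<forall>\<^sub>F z in nhds ((p +++ q) s). ?H s z = ?H t z))"
  proof cases
    case 1
    then have "2 * t \<in> {0..1}" using t by auto
    then obtain r \<epsilon> where r: "r > 0" "F (2 * t) holomorphic_on ball (p (2 * t)) r" "\<epsilon> > 0"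
      "\<forall>s\<in>{0..1}. \<bar>s - 2 * t\<bar> < \<epsilon> \<longrightarrow> p s \<in> ball (p (2 * t)) r \<and> (\<forall>\<^sub>F z in nhds (p s). F s z = F (2 * t) z)"
      using F unfolding analytic_continuation_along_def by blast
    have "(p +++ q) s \<in> ball ((p +++ q) t) r \<and> (\<forall>\<^sub>F z in nhds ((p +++ q) s). ?H s z = ?H t z)"
      if s: "s \<in> {0..1}" "\<bar>s - t\<bar> < min (\<epsilon> / 2) (1 / 2 - t)" for s
    proof -
      have "s < 1 / 2" "2 * s \<in> {0..1}" "\<bar>2 * s - 2 * t\<bar> < \<epsilon>" using s 1 by (auto simp: abs_if split: if_splits)
      then show ?thesis using r(4) 1 by (simp add: joinpaths_def)
    qed
    moreover have "min (\<epsilon> / 2) (1 / 2 - t) > 0" using r 1 by simp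
    ultimately show ?thesis using r(1,2) 1
      by (intro exI[of _ r] conjI exI[of _ "min (\<epsilon> / 2) (1 / 2 - t)"] ballI impI) (auto simp: joinpaths_def)
  next
    case 3
    then have "2 * t - 1 \<in> {0..1}" using t by auto
    then obtain r \<epsilon> where r: "r > 0" "G (2 * t - 1) holomorphic_on ball (q (2 * t - 1)) r" "\<epsilon> > 0"
      "\<forall>s\<in>{0..1}. \<bar>s - (2 * t - 1)\<bar> < \<epsilon> \<longrightarrow> q s \<in> ball (q (2 * t - 1)) r \<and> (\<forall>\<^sub>F z in nhds (q s). G s z = G (2 * t - 1) z)"
      using G unfolding analytic_continuation_along_def by blast
    have "(p +++ q) s \<in> ball ((p +++ q) t) r \<and> (\<forall>\<^sub>F z in nhds ((p +++ q) s). ?H s z = ?H t z)"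
      if s: "s \<in> {0..1}" "\<bar>s - t\<bar> < min (\<epsilon> / 2) (t - 1 / 2)" for s
    proof -
      have "s > 1 / 2" "2 * s - 1 \<in> {0..1}" "\<bar>(2 * s - 1) - (2 * t - 1)\<bar> < \<epsilon>"
        using s 3 by (auto simp: abs_if split: if_splits)
      then show ?thesis using r(4) 3 by (simp add: joinpaths_def)
    qed
    moreover have "min (\<epsilon> / 2) (t - 1 / 2) > 0" using r 3 by simp
    ultimately show ?thesis using r(1,2) 3
      by (intro exI[of _ r] conjI exI[of _ "min (\<epsilon> / 2) (t - 1 / 2)"] ballI impI) (auto simp: joinpaths_def)
  next
    case 2
    obtain r \<epsilon> where r: "r > 0" "F 1 holomorphic_on ball (p 1) r" "\<epsilon> > 0"
      "\<forall>s\<in>{0..1}. \<bar>s - 1\<bar> < \<epsilon> \<longrightarrow> p s \<in> ball (p 1) r \<and> (\<forall>\<^sub>F z in nhds (p s). F s z = F 1 z)"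
      using F unfolding analytic_continuation_along_def by (meson atLeastAtMost_iff order_refl zero_le_one)
    obtain r' \<epsilon>' where r': "r' > 0" "\<epsilon>' > 0"
      "\<forall>s\<in>{0..1}. \<bar>s - 0\<bar> < \<epsilon>' \<longrightarrow> q s \<in> ball (q 0) r' \<and> (\<forall>\<^sub>F z in nhds (q s). G s z = G 0 z)"
      using G unfolding analytic_continuation_along_def by (meson atLeastAtMost_iff order_refl zero_le_one)
    have p1: "p 1 = q 0" using pq by (simp add: pathfinish_def pathstart_def)
    \<comment> \<open>The germs match only near the junction; \<rho> is chosen so small that q,
      close to its start, stays where \<open>F 1\<close> and \<open>G 0\<close> coincide and
      \<open>F 1\<close> is holomorphic.\<close>
    obtain N where N: "open N" "q 0 \<in> N" "\<And>z. z \<in> N \<Longrightarrow> F 1 z = G 0 z"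
      using eq unfolding eventually_nhds by (auto simp: pathfinish_def p1)
    obtain \<rho> where \<rho>: "\<rho> > 0" "ball (q 0) \<rho> \<subseteq> N \<inter> ball (q 0) r"
      using openE[of "N \<inter> ball (q 0) r" "q 0"] N r(1) by (auto simp: open_Int)
    obtain \<delta> where \<delta>: "\<delta> > 0" "\<And>s. s \<in> {0..1} \<Longrightarrow> \<bar>s - 0\<bar> < \<delta> \<Longrightarrow> dist (q s) (q 0) < \<rho>"
      using q \<rho>(1) unfolding path_def continuous_on_iff dist_real_def
      by (meson atLeastAtMost_iff order_refl zero_le_one)
    \<comment> \<open>Halved because each path of the join is run through at double speed.\<close>
    define e where "e = min \<epsilon> (min \<epsilon>' \<delta>) / 2"
    have "(p +++ q) s \<in> ball ((p +++ q) t) r \<and> (\<forall>\<^sub>F z in nhds ((p +++ q) s). ?H s z = ?H t z)"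
      if s: "s \<in> {0..1}" "\<bar>s - t\<bar> < e" for s
    proof (cases "s \<le> 1 / 2")
      case True
      then have "2 * s \<in> {0..1}" "\<bar>2 * s - 1\<bar> < \<epsilon>" using s 2 by (auto simp: e_def)
      then show ?thesis using r(4) True unfolding 2 by (simp add: joinpaths_def)
    next
      case False
      then have s': "2 * s - 1 \<in> {0..1}" "\<bar>(2 * s - 1) - 0\<bar> < \<epsilon>'" "\<bar>(2 * s - 1) - 0\<bar> < \<delta>"
        using s 2 by (auto simp: e_def)
      have b: "q (2 * s - 1) \<in> ball (q 0) \<rho>" using \<delta>(2)[OF s'(1,3)] by (simp add: dist_commute)
      then have "\<forall>\<^sub>F z in nhds (q (2 * s - 1)). z \<in> N"
        using N(1) \<rho>(2) by (auto intro!: eventually_nhds_in_open)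
      moreover have "\<forall>\<^sub>F z in nhds (q (2 * s - 1)). G (2 * s - 1) z = G 0 z" using r'(3) s' by blast
      ultimately have "\<forall>\<^sub>F z in nhds (q (2 * s - 1)). G (2 * s - 1) z = F 1 z"
        by eventually_elim (simp add: N)
      moreover have "q (2 * s - 1) \<in> ball (q 0) r" using b \<rho>(2) by blast
      ultimately show ?thesis using False unfolding 2 by (simp add: joinpaths_def p1)
    qed
    moreover have "e > 0" using r r' \<delta> by (simp add: e_def)
    ultimately show ?thesis using r(1,2) unfolding 2
      by (intro exI[of _ r] conjI exI[of _ e] ballI impI) (auto simp: joinpaths_def)
  qed
qed


section \<open>Monodromy in terms of the connection matrices\<close>

context chart_system
begin

lemma sol_Y_mult: "I \<in> charts \<Longrightarrow> sol (cut_plane I) (\<lambda>z. (Y I z v* A) $ j)"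
  using sol_comb[OF open_chart sol_Y sol_Y, of I "A $ 1 $ j" 1 "A $ 2 $ j" 2]
  by (simp add: vector_matrix_mult_def sum_2 mult.commute)

section \<open>Following a germ along an arbitrary path\<close>

lemma Y_switch_lower:
  assumes "I \<in> charts" "J \<in> charts" "Im w < 0"
  shows "Y I w = Y J w v* (inv2 (C J) ** C I)"
proof -
  have "Y J w v* (inv2 (C J) ** C I) = Y {0<..<1} w v* (C J ** inv2 (C J) ** C I)"
    by (simp add: Y_lower[OF assms(2,3)] vector_matrix_mul_assoc matrix_mul_assoc)
  also have "\<dots> = Y I w" by (simp add: inv2_right det_C_nonzero assms Y_lower[OF assms(1,3)])
  finally show ?thesis by simp
qed

lemma transition:
  assumes "I \<in> charts" "J \<in> charts" "z \<in> cut_plane I" "z \<in> cut_plane J"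
  shows "(\<forall>\<^sub>F w in nhds z. Y I w = Y J w) \<or> (\<forall>\<^sub>F w in nhds z. Y I w = Y J w v* (inv2 (C J) ** C I))"
proof -
  consider "Im z > 0" | "Im z < 0" | "Im z = 0" by linarith
  then show ?thesis
  proof cases
    case 1
    then have "\<forall>\<^sub>F w in nhds z. w \<in> {w. Im w > 0}"
      by (intro eventually_nhds_in_open open_half_planes) auto
    then have "\<forall>\<^sub>F w in nhds z. Y I w = Y J w"
      by eventually_elim (use Y_upper[OF assms(1,2)] in auto)
    then show ?thesis ..
  next
    case 2
    then have "\<forall>\<^sub>F w in nhds z. w \<in> {w. Im w < 0}"
      by (intro eventually_nhds_in_open open_half_planes) auto
    then have "\<forall>\<^sub>F w in nhds z. Y I w = Y J w v* (inv2 (C J) ** C I)"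
      by eventually_elim (use Y_switch_lower[OF assms(1,2)] in auto)
    then show ?thesis ..
  next
    case 3
    then have "I = J" using charts_disjoint assms by blast
    then show ?thesis by simp
  qed
qed

text \<open>\<open>\<Gamma>\<close> is any set of coordinate matrices closed under change of chart.
  Having coordinates in \<open>\<Gamma>\<close> is a locally constant property of the parameter, and
  the unit interval is connected.\<close>

lemma continuation_stays:
  fixes F :: "real \<Rightarrow> complex \<Rightarrow> complex^2"
  assumes closed: "\<And>A I J. A \<in> \<Gamma> \<Longrightarrow> I \<in> charts \<Longrightarrow> J \<in> charts \<Longrightarrow> inv2 (C J) ** C I ** A \<in> \<Gamma>"
    and p: "path p" "path_image p \<subseteq> - {0, 1}"
    and F: "\<And>i. analytic_continuation_along p (\<lambda>t z. F t z $ i)"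
    and start: "I0 \<in> charts" "p 0 \<in> cut_plane I0" "A0 \<in> \<Gamma>" "\<forall>\<^sub>F z in nhds (p 0). F 0 z = Y I0 z v* A0"
    and t: "t \<in> {0..1}" "J \<in> charts" "p t \<in> cut_plane J"
  shows "\<exists>A\<in>\<Gamma>. \<forall>\<^sub>F z in nhds (p t). F t z = Y J z v* A"
proof -
  \<comment> \<open>Stated for all charts containing \<open>p t\<close>, so that the local argument
    may choose its chart; \<open>QI\<close> shows that one chart suffices.\<close>
  define Q where "Q t \<longleftrightarrow> (\<forall>J\<in>charts. p t \<in> cut_plane J \<longrightarrow> (\<exists>A\<in>\<Gamma>. \<forall>\<^sub>F z in nhds (p t). F t z = Y J z v* A))" for t
  have QI: "Q t" if I: "I \<in> charts" "p t \<in> cut_plane I" and A: "A \<in> \<Gamma>" "\<forall>\<^sub>F z in nhds (p t). F t z = Y I z v* A"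
    for t I A
    unfolding Q_def
  proof (intro ballI impI)
    fix J assume J: "J \<in> charts" "p t \<in> cut_plane J"
    from transition[OF I(1) J(1) I(2) J(2)]
    show "\<exists>A\<in>\<Gamma>. \<forall>\<^sub>F z in nhds (p t). F t z = Y J z v* A"
    proof
      assume "\<forall>\<^sub>F w in nhds (p t). Y I w = Y J w"
      then have "\<forall>\<^sub>F z in nhds (p t). F t z = Y J z v* A" using A(2) by eventually_elim simp
      then show ?thesis using A(1) by blast
    next
      assume "\<forall>\<^sub>F w in nhds (p t). Y I w = Y J w v* (inv2 (C J) ** C I)"
      then have "\<forall>\<^sub>F z in nhds (p t). F t z = Y J z v* (inv2 (C J) ** C I ** A)" using A(2)
        by eventually_elim (simp add: vector_matrix_mul_assoc)
      then show ?thesis using closed[OF A(1) I(1) J(1)] by blast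
    qed
  qed
  have "Q t"
  proof (rule connected_induction_simple[of "{0..1}" 0 t Q])
    show "Q 0" using QI start by blast
    fix t :: real assume t: "t \<in> {0..1}"
    then have "p t \<in> path_image p" by (simp add: path_image_def)
    then obtain I where I: "I \<in> charts" "p t \<in> cut_plane I" using p(2) charts_cover[of "p t"] by blast
    have "\<exists>r>0. \<exists>\<epsilon>>0. (\<lambda>z. F t z $ i) holomorphic_on ball (p t) r \<and>
       (\<forall>s\<in>{0..1}. \<bar>s - t\<bar> < \<epsilon> \<longrightarrow> (\<forall>\<^sub>F z in nhds (p s). F s z $ i = F t z $ i))" for i
      using F[of i] t unfolding analytic_continuation_along_def by meson
    note loc = this
    obtain r1 \<epsilon>1 where 1: "r1 > 0" "\<epsilon>1 > 0" "(\<lambda>z. F t z $ 1) holomorphic_on ball (p t) r1"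
      "\<And>s. s \<in> {0..1} \<Longrightarrow> \<bar>s - t\<bar> < \<epsilon>1 \<Longrightarrow> \<forall>\<^sub>F z in nhds (p s). F s z $ 1 = F t z $ 1"
      using loc[of 1] by blast
    obtain r2 \<epsilon>2 where 2: "r2 > 0" "\<epsilon>2 > 0" "(\<lambda>z. F t z $ 2) holomorphic_on ball (p t) r2"
      "\<And>s. s \<in> {0..1} \<Longrightarrow> \<bar>s - t\<bar> < \<epsilon>2 \<Longrightarrow> \<forall>\<^sub>F z in nhds (p s). F s z $ 2 = F t z $ 2"
      using loc[of 2] by blast
    obtain \<rho>0 where \<rho>0: "\<rho>0 > 0" "ball (p t) \<rho>0 \<subseteq> cut_plane I" using openE[OF open_chart] I by blast
    define \<rho> where "\<rho> = min \<rho>0 (min r1 r2)"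
    have \<rho>: "\<rho> > 0" "ball (p t) \<rho> \<subseteq> cut_plane I" "\<rho> \<le> r1" "\<rho> \<le> r2"
      using \<rho>0 1(1) 2(1) by (auto simp: \<rho>_def)
    have holF: "(\<lambda>z. F t z $ i) holomorphic_on ball (p t) \<rho>" for i
      using exhaust_2[of i] holomorphic_on_subset[OF 1(3), of "ball (p t) \<rho>"]
        holomorphic_on_subset[OF 2(3), of "ball (p t) \<rho>"] \<rho>(3,4) subset_ball[of \<rho>] by auto
    obtain \<delta> where \<delta>: "\<delta> > 0" "\<And>s. s \<in> {0..1} \<Longrightarrow> \<bar>s - t\<bar> < \<delta> \<Longrightarrow> dist (p s) (p t) < \<rho>"
      using p(1) t \<rho>(1) unfolding path_def continuous_on_iff dist_real_def by meson
    define e where "e = min \<delta> (min \<epsilon>1 \<epsilon>2)"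
    have e: "e > 0" "e \<le> \<epsilon>1" "e \<le> \<epsilon>2" "e \<le> \<delta>" using \<delta>(1) 1(2) 2(2) by (auto simp: e_def)
    define T where "T = {0..1} \<inter> ball t e"
    have T: "p s \<in> ball (p t) \<rho>" "\<forall>\<^sub>F z in nhds (p s). F s z = F t z" if "s \<in> T" for s
    proof -
      have s: "s \<in> {0..1}" "\<bar>s - t\<bar> < e" using that by (auto simp: T_def dist_real_def)
      show "p s \<in> ball (p t) \<rho>" using \<delta>(2)[of s] s e(4) by (simp add: dist_commute)
      have "\<forall>\<^sub>F z in nhds (p s). F s z $ 1 = F t z $ 1" "\<forall>\<^sub>F z in nhds (p s). F s z $ 2 = F t z $ 2"
        using 1(4)[OF s(1)] 2(4)[OF s(1)] s(2) e by auto
      then show "\<forall>\<^sub>F z in nhds (p s). F s z = F t z"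
        by eventually_elim (simp add: vec_eq_iff forall_2)
    qed
    \<comment> \<open>Identity theorem on the ball: the coordinates of the fixed representative
      \<open>F t\<close> relative to chart \<open>I\<close> are the same at all parameters near
      t.\<close>
    have spread: "\<forall>\<^sub>F z in nhds (p y). F t z = Y I z v* A"
      if xy: "x \<in> T" "y \<in> T" "\<forall>\<^sub>F z in nhds (p x). F t z = Y I z v* A" for x y A
    proof -
      have "\<forall>\<^sub>F z in nhds (p x). F t z = Y I z v* A \<and> z \<in> ball (p t) \<rho>"
        using xy(3) T(1)[OF xy(1)] by (intro eventually_conj eventually_nhds_in_open) auto
      then obtain N where N: "open N" "p x \<in> N" "\<And>z. z \<in> N \<Longrightarrow> F t z = Y I z v* A" "N \<subseteq> ball (p t) \<rho>"
        unfolding eventually_nhds by blast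
      have "F t z $ i = (Y I z v* A) $ i" if z: "z \<in> ball (p t) \<rho>" for z i
      proof (rule analytic_continuation_open[of N "ball (p t) \<rho>" "\<lambda>z. F t z $ i" "\<lambda>z. (Y I z v* A) $ i"])
        show "(\<lambda>z. F t z $ i) holomorphic_on ball (p t) \<rho>"
          by (rule holF)
        show "(\<lambda>z. (Y I z v* A) $ i) holomorphic_on ball (p t) \<rho>"
          using sol_holomorphic[OF sol_Y_mult[OF I(1)]] holomorphic_on_subset \<rho>(2) by blast
      qed (use N z in auto)
      moreover have "\<forall>\<^sub>F z in nhds (p y). z \<in> ball (p t) \<rho>"
        using T(1)[OF xy(2)] by (intro eventually_nhds_in_open) auto
      ultimately show ?thesis by (auto simp: vec_eq_iff elim: eventually_mono)
    qed
    have "Q y" if xy: "x \<in> T" "y \<in> T" "Q x" for x y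
    proof -
      have "p x \<in> cut_plane I" "p y \<in> cut_plane I" using T(1)[OF xy(1)] T(1)[OF xy(2)] \<rho>(2) by auto
      then obtain A where A: "A \<in> \<Gamma>" "\<forall>\<^sub>F z in nhds (p x). F x z = Y I z v* A"
        using xy(3) I(1) unfolding Q_def by blast
      have "\<forall>\<^sub>F z in nhds (p x). F t z = Y I z v* A" using A(2) T(2)[OF xy(1)] by eventually_elim simp
      then have "\<forall>\<^sub>F z in nhds (p y). F t z = Y I z v* A" by (rule spread[OF xy(1,2)])
      then have "\<forall>\<^sub>F z in nhds (p y). F y z = Y I z v* A" using T(2)[OF xy(2)] by eventually_elim simp
      then show "Q y" using QI I(1) \<open>p y \<in> cut_plane I\<close> A(1) by blast
    qed
    moreover have "openin (top_of_set {0..1}) T" unfolding T_def by (simp add: openin_open_Int)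
    moreover have "t \<in> T" using t e(1) by (simp add: T_def)
    ultimately show "\<exists>T. openin (top_of_set {0..1}) T \<and> t \<in> T \<and> (\<forall>x\<in>T. \<forall>y\<in>T. Q x \<longrightarrow> Q y)" by blast
  qed (use t in auto)
  then show ?thesis using t unfolding Q_def by blast
qed

text \<open>Applies \<open>continuation_stays\<close> to the coset of matrices B with
  \<open>inv2 P ** B\<close> in \<open>SL2Z\<close>: it contains the starting coordinates P, and
  changes of chart act on it through the conjugated connection matrices.\<close>

lemma monodromy_subset_SL2Z:
  assumes P: "det P \<noteq> 0" "\<And>I. I \<in> charts \<Longrightarrow> inv2 P ** C I ** P \<in> SL2Z"
    and I0: "I0 \<in> charts" "z0 \<in> cut_plane I0"
  shows "monodromy z0 (\<lambda>z. Y I0 z v* P) \<subseteq> SL2Z"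
proof
  fix G assume "G \<in> monodromy z0 (\<lambda>z. Y I0 z v* P)"
  then obtain p F where p: "path p" "path_image p \<subseteq> - {0, 1}" "pathstart p = z0" "pathfinish p = z0"
    and F: "\<And>i. analytic_continuation_along p (\<lambda>t z. F t z $ i)"
    "\<forall>\<^sub>F z in nhds z0. F 0 z = Y I0 z v* P" "\<forall>\<^sub>F z in nhds z0. Y I0 z v* P = F 1 z v* G"
    unfolding monodromy_def monodromy_matrix_def by blast
  have "\<exists>A\<in>{B. inv2 P ** B \<in> SL2Z}. \<forall>\<^sub>F z in nhds (p 1). F 1 z = Y I0 z v* A"
  proof (rule continuation_stays[OF _ p(1,2) F(1) I0(1)])
    fix A I J assume A: "A \<in> {B. inv2 P ** B \<in> SL2Z}" and IJ: "I \<in> charts" "J \<in> charts"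
    have inv: "inv2 (inv2 P ** C J ** P) = inv2 P ** inv2 (C J) ** P"
      using P(1) det_C_nonzero[OF IJ(2)]
      by (simp add: inv2_mult det_mul det_inv2 inv2_inv2 matrix_mul_assoc)
    have "inv2 (inv2 P ** C J ** P) ** (inv2 P ** C I ** P) ** (inv2 P ** A)
        = inv2 P ** inv2 (C J) ** (P ** inv2 P) ** C I ** (P ** inv2 P) ** A"
      unfolding inv by (simp only: matrix_mul_assoc)
    also have "\<dots> = inv2 P ** (inv2 (C J) ** C I ** A)"
      by (simp add: inv2_right[OF P(1)] matrix_mul_assoc)
    finally have "inv2 P ** (inv2 (C J) ** C I ** A)
        = inv2 (inv2 P ** C J ** P) ** (inv2 P ** C I ** P) ** (inv2 P ** A)" by simp
    also have "\<dots> \<in> SL2Z"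
      using A by (intro SL2Z_mult[OF SL2Z_mult[OF SL2Z_inv2[OF P(2)[OF IJ(2)]] P(2)[OF IJ(1)]]]) auto
    finally show "inv2 (C J) ** C I ** A \<in> {B. inv2 P ** B \<in> SL2Z}" by simp
  next
    show "P \<in> {B. inv2 P ** B \<in> SL2Z}" using P(1) by (auto simp: inv2_left SL2Z_def forall_2)
  qed (use p I0 F(2) in \<open>auto simp: pathstart_def pathfinish_def\<close>)
  then obtain B where B: "inv2 P ** B \<in> SL2Z" "\<forall>\<^sub>F z in nhds z0. F 1 z = Y I0 z v* B"
    using p(4) by (auto simp: pathfinish_def)
  have "\<forall>\<^sub>F z in nhds z0. Y I0 z v* P = Y I0 z v* (B ** G) \<and> z \<in> cut_plane I0"
    using F(3) B(2) eventually_nhds_in_open[OF open_chart[OF I0(1)] I0(2)]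
    by eventually_elim (simp add: vector_matrix_mul_assoc)
  then obtain N where N: "open N" "z0 \<in> N" "\<And>z. z \<in> N \<Longrightarrow> Y I0 z v* P = Y I0 z v* (B ** G)" "N \<subseteq> cut_plane I0"
    unfolding eventually_nhds by blast
  \<comment> \<open>The convention Y = Y* G: the basis with coordinates P is continued to the one
    with coordinates B, so G is the inverse of P^-1 B.\<close>
  have "P = B ** G" by (rule Y_mult_cancel[OF I0(1) N(1,4,2,3)])
  then have "(inv2 P ** B) ** G = mat 1" using inv2_left[OF P(1)] by (simp flip: matrix_mul_assoc)
  then have "G = inv2 (inv2 P ** B)" by (rule inv2_unique)
  then show "G \<in> SL2Z" using SL2Z_inv2[OF B(1)] by simp
qed

section \<open>Germs of solutions in the chart bases\<close>

lemma solution_near_expand: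
  assumes I: "I \<in> charts" "z0 \<in> cut_plane I" and u: "hypergeometric_solution_near \<alpha> \<beta> \<gamma> z0 u"
  obtains a b where "\<forall>\<^sub>F z in nhds z0. u z = a * Y I z $ 1 + b * Y I z $ 2"
proof -
  obtain U where U: "open U" "z0 \<in> U" "sol U u" using u unfolding hypergeometric_solution_near_def by blast
  then obtain r where r: "r > 0" "ball z0 r \<subseteq> U \<inter> cut_plane I"
    using openE[of "U \<inter> cut_plane I" z0] I open_chart by blast
  obtain a b where "\<And>z. z \<in> ball z0 r \<Longrightarrow> u z = a * Y I z $ 1 + b * Y I z $ 2"
  proof (rule sol_expand[of "ball z0 r" "\<lambda>z. Y I z $ 1" "\<lambda>z. Y I z $ 2" u])
    show "sol (ball z0 r) u" using U(3) sol_subset r(2) by blast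
    show "sol (ball z0 r) (\<lambda>z. Y I z $ 1)" "sol (ball z0 r) (\<lambda>z. Y I z $ 2)"
      using sol_Y[OF I(1)] sol_subset r(2) by blast+
    show "wr (\<lambda>z. Y I z $ 1) (\<lambda>z. Y I z $ 2) z \<noteq> 0" if "z \<in> ball z0 r" for z
      using wrv_nonzero[OF I(1), of z] that r(2) by (auto simp: wrv_def)
  qed auto
  moreover have "\<forall>\<^sub>F z in nhds z0. z \<in> ball z0 r" using r(1) by (intro eventually_nhds_in_open) auto
  ultimately have "\<forall>\<^sub>F z in nhds z0. u z = a * Y I z $ 1 + b * Y I z $ 2" by (auto elim: eventually_mono)
  then show ?thesis by (rule that)
qed

lemma Y_near_zero:
  assumes "I \<in> charts" "z0 \<in> cut_plane I" "\<forall>\<^sub>F z in nhds z0. a * Y I z $ 1 + b * Y I z $ 2 = 0"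
  shows "a = 0 \<and> b = 0"
proof -
  have "\<forall>\<^sub>F z in nhds z0. a * Y I z $ 1 + b * Y I z $ 2 = 0 \<and> z \<in> cut_plane I"
    using assms(3) eventually_nhds_in_open[OF open_chart[OF assms(1)] assms(2)] by eventually_elim simp
  then obtain N where N: "open N" "z0 \<in> N" "\<And>z. z \<in> N \<Longrightarrow> a * Y I z $ 1 + b * Y I z $ 2 = 0" "N \<subseteq> cut_plane I"
    unfolding eventually_nhds by blast
  show ?thesis by (rule Y_combination_zero[OF assms(1) N(1,4,2,3)])
qed

lemma solution_basis_Y:
  assumes I: "I \<in> charts" "z0 \<in> cut_plane I" and P: "det P \<noteq> 0"
  shows "solution_basis \<alpha> \<beta> \<gamma> z0 (\<lambda>z. Y I z v* P)"
  unfolding solution_basis_def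
proof (intro conjI allI impI)
  fix i show "hypergeometric_solution_near \<alpha> \<beta> \<gamma> z0 (\<lambda>z. (Y I z v* P) $ i)"
    unfolding hypergeometric_solution_near_def
    using open_chart[OF I(1)] I chart_subset[OF I(1)] sol_Y_mult[OF I(1)] by blast
next
  fix v :: "complex^2"
  assume "\<forall>\<^sub>F z in nhds z0. (\<Sum>i\<in>UNIV. v $ i * (Y I z v* P) $ i) = 0"
  then have "\<forall>\<^sub>F z in nhds z0. (P *v v) $ 1 * Y I z $ 1 + (P *v v) $ 2 * Y I z $ 2 = 0"
    by eventually_elim (simp add: sum_2 vector_matrix_mult_def matrix_vector_mult_def algebra_simps)
  from Y_near_zero[OF I this] have "P *v v = 0" by (simp add: vec_eq_iff forall_2)
  then have "inv2 P *v (P *v v) = 0" by simp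
  then show "v = 0" by (simp add: matrix_vector_mul_assoc inv2_left[OF P])
next
  fix u assume "hypergeometric_solution_near \<alpha> \<beta> \<gamma> z0 u"
  then obtain a b where "\<forall>\<^sub>F z in nhds z0. u z = a * Y I z $ 1 + b * Y I z $ 2"
    using solution_near_expand[OF I] by blast
  moreover define v where "v = inv2 P *v (vector [a, b] :: complex^2)"
  have "P *v v = vector [a, b]" unfolding v_def by (simp add: matrix_vector_mul_assoc inv2_right[OF P])
  then have "a = (P *v v) $ 1" "b = (P *v v) $ 2" by simp_all
  ultimately have "\<forall>\<^sub>F z in nhds z0. u z = (\<Sum>i\<in>UNIV. v $ i * (Y I z v* P) $ i)"
    by (auto simp: sum_2 vector_matrix_mult_def matrix_vector_mult_def algebra_simps elim!: eventually_mono)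
  then show "\<exists>v. \<forall>\<^sub>F z in nhds z0. u z = (\<Sum>i\<in>UNIV. v $ i * (Y I z v* P) $ i)" by blast
qed

lemma solution_basis_eq_Y_mult:
  assumes I: "I \<in> charts" "z0 \<in> cut_plane I" and X: "solution_basis \<alpha> \<beta> \<gamma> z0 X"
  obtains B where "det B \<noteq> 0" "\<forall>\<^sub>F z in nhds z0. X z = Y I z v* B"
proof -
  have near: "hypergeometric_solution_near \<alpha> \<beta> \<gamma> z0 (\<lambda>z. X z $ i)" for i
    using X unfolding solution_basis_def by blast
  obtain a1 b1 where ab1: "\<forall>\<^sub>F z in nhds z0. X z $ 1 = a1 * Y I z $ 1 + b1 * Y I z $ 2"
    using solution_near_expand[OF I near] .
  obtain a2 b2 where ab2: "\<forall>\<^sub>F z in nhds z0. X z $ 2 = a2 * Y I z $ 1 + b2 * Y I z $ 2"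
    using solution_near_expand[OF I near] .
  define B where "B = (vector [vector [a1, a2], vector [b1, b2]] :: complex^2^2)"
  have B: "\<forall>\<^sub>F z in nhds z0. X z = Y I z v* B"
    using ab1 ab2
    by eventually_elim (simp add: vec_eq_iff forall_2 vector_matrix_mult_def sum_2 B_def mult.commute)
  have "det B \<noteq> 0"
  proof
    assume d: "det B = 0"
    have "v = 0" if "B *v v = 0" for v
    proof -
      have "\<forall>\<^sub>F z in nhds z0. (\<Sum>i\<in>UNIV. v $ i * X z $ i) = 0"
        using B
      proof eventually_elim
        case (elim z)
        have "(\<Sum>i\<in>UNIV. v $ i * X z $ i) = (B *v v) $ 1 * Y I z $ 1 + (B *v v) $ 2 * Y I z $ 2"
          unfolding elim by (simp add: sum_2 vector_matrix_mult_def matrix_vector_mult_def algebra_simps)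
        then show ?case by (simp add: that)
      qed
      then show ?thesis using X unfolding solution_basis_def by blast
    qed
    note ker = this
    \<comment> \<open>For singular B the columns of its adjugate lie, up to sign, in the kernel.
      Both then vanish, so B = 0, and the kernel contains every vector.\<close>
    have "(vector [B $ 2 $ 2, - B $ 2 $ 1] :: complex^2) = 0" "(vector [B $ 1 $ 2, - B $ 1 $ 1] :: complex^2) = 0"
      by (rule ker, use d in \<open>simp add: vec_eq_iff forall_2 matrix_vector_mult_def sum_2 det_2 algebra_simps\<close>)+
    then have "B = 0" by (simp add: vec_eq_iff forall_2)
    from ker[of 1] this have "(1 :: complex^2) = 0" by simp
    then show False by simp
  qed
  then show ?thesis using that B by blast
qed

section \<open>Realising monodromy matrices by explicit loops\<close>

text \<open>Hiding the path behind a quantifier leaves a calculus of coordinates: moves inside a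
  chart and switches above the axis keep A, switches below multiply it by
  \<open>inv2 (C J) ** C I\<close>.\<close>

definition reach :: "(complex \<Rightarrow> complex^2) \<Rightarrow> complex \<Rightarrow> real set \<Rightarrow> complex \<Rightarrow> complex^2^2 \<Rightarrow> bool" where
  "reach X z0 I w A \<longleftrightarrow> w \<in> cut_plane I \<and> (\<exists>p F. path p \<and> path_image p \<subseteq> - {0, 1} \<and> pathstart p = z0 \<and> pathfinish p = w \<and>
     (\<forall>i. analytic_continuation_along p (\<lambda>t z. F t z $ i)) \<and>
     (\<forall>\<^sub>F z in nhds z0. F 0 z = X z) \<and> (\<forall>\<^sub>F z in nhds w. F 1 z = Y I z v* A))"

lemma reach_start:
  assumes I: "I \<in> charts" "z0 \<in> cut_plane I" and A: "\<forall>\<^sub>F z in nhds z0. X z = Y I z v* A"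
  shows "reach X z0 I z0 A"
  unfolding reach_def
proof (intro conjI exI[of _ "linepath z0 z0"] exI[of _ "\<lambda>t z. Y I z v* A"] allI)
  show "analytic_continuation_along (linepath z0 z0) (\<lambda>t z. (Y I z v* A) $ i)" for i
    by (rule analytic_continuation_along_const[OF _ open_chart[OF I(1)] _ sol_holomorphic[OF sol_Y_mult[OF I(1)]]])
       (use I in auto)
  show "\<forall>\<^sub>F z in nhds z0. Y I z v* A = X z" using A by eventually_elim simp
qed (use I chart_subset[OF I(1)] in auto)

lemma reach_move:
  assumes I: "I \<in> charts" and R: "reach X z0 I w A" and w': "w' \<in> cut_plane I"
  shows "reach X z0 I w' A"
proof -
  obtain p F where p: "path p" "path_image p \<subseteq> - {0, 1}" "pathstart p = z0" "pathfinish p = w"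
    and w: "w \<in> cut_plane I"
    and F: "\<And>i. analytic_continuation_along p (\<lambda>t z. F t z $ i)"
      "\<forall>\<^sub>F z in nhds z0. F 0 z = X z" "\<forall>\<^sub>F z in nhds w. F 1 z = Y I z v* A"
    using R unfolding reach_def by blast
  obtain q where q: "path q" "path_image q \<subseteq> cut_plane I" "pathstart q = w" "pathfinish q = w'"
    using connected_open_path_connected[OF open_chart[OF I] connected_chart[OF I]] w w'
    unfolding path_connected_def by blast
  define H where "H t = (if t \<le> 1 / 2 then F (2 * t) else (\<lambda>z. Y I z v* A))" for t :: real
  have "analytic_continuation_along (p +++ q) (\<lambda>t z. H t z $ i)" for i
  proof -
    have "\<forall>\<^sub>F z in nhds (pathfinish p). F 1 z $ i = (Y I z v* A) $ i"
      using F(3) unfolding p(4) by eventually_elim simp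
    from analytic_continuation_along_join[OF F(1)[of i]
        analytic_continuation_along_const[OF q(1) open_chart[OF I] q(2) sol_holomorphic[OF sol_Y_mult[OF I]]] q(1) _ this]
    have "analytic_continuation_along (p +++ q)
      (\<lambda>t. if t \<le> 1 / 2 then \<lambda>z. F (2 * t) z $ i else (\<lambda>z. (Y I z v* A) $ i))"
      by (simp add: p q)
    moreover have "(\<lambda>t. if t \<le> 1 / 2 then \<lambda>z. F (2 * t) z $ i else (\<lambda>z. (Y I z v* A) $ i)) = (\<lambda>t z. H t z $ i)"
      by (auto simp: H_def fun_eq_iff)
    ultimately show ?thesis by simp
  qed
  moreover have "\<forall>\<^sub>F z in nhds z0. H 0 z = X z" using F(2) by (simp add: H_def)
  moreover have "\<forall>\<^sub>F z in nhds w'. H 1 z = Y I z v* A" by (simp add: H_def)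
  moreover have "path (p +++ q)" "path_image (p +++ q) \<subseteq> - {0, 1}"
    using p q chart_subset[OF I] by (auto simp: path_image_join)
  moreover have "pathstart (p +++ q) = z0" "pathfinish (p +++ q) = w'" using p q by simp_all
  ultimately show ?thesis unfolding reach_def using w' by blast
qed

lemma reach_switch_upper:
  assumes "I \<in> charts" "J \<in> charts" "Im w > 0" "reach X z0 I w A"
  shows "reach X z0 J w A"
proof -
  obtain p F where p: "path p" "path_image p \<subseteq> - {0, 1}" "pathstart p = z0" "pathfinish p = w"
      "\<forall>i. analytic_continuation_along p (\<lambda>t z. F t z $ i)" "\<forall>\<^sub>F z in nhds z0. F 0 z = X z"
    and F1: "\<forall>\<^sub>F z in nhds w. F 1 z = Y I z v* A"
    using assms(4) unfolding reach_def by blast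
  have "\<forall>\<^sub>F z in nhds w. z \<in> {z. Im z > 0}"
    using assms(3) by (intro eventually_nhds_in_open open_half_planes) auto
  then have "\<forall>\<^sub>F z in nhds w. F 1 z = Y J z v* A"
    using F1 by eventually_elim (use Y_upper[OF assms(1,2)] in \<open>auto simp: vector_matrix_mul_assoc\<close>)
  moreover have "w \<in> cut_plane J" using assms(3) by (simp add: cut_plane_def)
  ultimately show ?thesis unfolding reach_def using p by blast
qed

lemma reach_switch_lower:
  assumes "I \<in> charts" "J \<in> charts" "Im w < 0" "reach X z0 I w A"
  shows "reach X z0 J w (inv2 (C J) ** C I ** A)"
proof -
  obtain p F where p: "path p" "path_image p \<subseteq> - {0, 1}" "pathstart p = z0" "pathfinish p = w"
      "\<forall>i. analytic_continuation_along p (\<lambda>t z. F t z $ i)" "\<forall>\<^sub>F z in nhds z0. F 0 z = X z"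
    and F1: "\<forall>\<^sub>F z in nhds w. F 1 z = Y I z v* A"
    using assms(4) unfolding reach_def by blast
  have "\<forall>\<^sub>F z in nhds w. z \<in> {z. Im z < 0}"
    using assms(3) by (intro eventually_nhds_in_open open_half_planes) auto
  then have "\<forall>\<^sub>F z in nhds w. F 1 z = Y J z v* (inv2 (C J) ** C I ** A)"
    using F1 by eventually_elim (use Y_switch_lower[OF assms(1,2)] in \<open>auto simp: vector_matrix_mul_assoc\<close>)
  moreover have "w \<in> cut_plane J" using assms(3) by (simp add: cut_plane_def)
  ultimately show ?thesis unfolding reach_def using p by blast
qed

text \<open>The loop descends through the interval \<open>I\<close> and returns through \<open>J\<close>.\<close>
lemma conjugate_in_monodromy:
  assumes "z0 \<notin> {0, 1}" and X: "solution_basis \<alpha> \<beta> \<gamma> z0 X"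
  obtains B where "det B \<noteq> 0"
    "\<And>I J. I \<in> charts \<Longrightarrow> J \<in> charts \<Longrightarrow> inv2 B ** (inv2 (C I) ** C J) ** B \<in> monodromy z0 X"
proof -
  obtain K where K: "K \<in> charts" "z0 \<in> cut_plane K" using charts_cover[OF assms(1)] by blast
  obtain B where B: "det B \<noteq> 0" "\<forall>\<^sub>F z in nhds z0. X z = Y K z v* B"
    using solution_basis_eq_Y_mult[OF K X] .
  have pm: "\<i> \<in> cut_plane L" "-\<i> \<in> cut_plane L" for L by (auto simp: cut_plane_def)
  have "inv2 B ** (inv2 (C I) ** C J) ** B \<in> monodromy z0 X" if I: "I \<in> charts" and J: "J \<in> charts" for I J
  proof -
    let ?A = "inv2 (C J) ** C I ** B"
    have "reach X z0 K z0 B" by (rule reach_start[OF K B(2)])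
    then have "reach X z0 K \<i> B" using K(1) pm(1) reach_move by blast
    then have "reach X z0 I \<i> B" using K(1) I by (intro reach_switch_upper[of K I]) auto
    then have "reach X z0 I (-\<i>) B" using I pm(2) reach_move by blast
    then have "reach X z0 J (-\<i>) ?A" using I J by (intro reach_switch_lower) auto
    then have "reach X z0 J \<i> ?A" using J pm(1) reach_move by blast
    then have "reach X z0 K \<i> ?A" using K(1) J by (intro reach_switch_upper[of J K]) auto
    then have "reach X z0 K z0 ?A" using K reach_move by blast
    then obtain p F where p: "path p" "path_image p \<subseteq> - {0, 1}" "pathstart p = z0" "pathfinish p = z0"
      and F: "\<forall>i. analytic_continuation_along p (\<lambda>t z. F t z $ i)"
        "\<forall>\<^sub>F z in nhds z0. F 0 z = X z" "\<forall>\<^sub>F z in nhds z0. F 1 z = Y K z v* ?A"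
      unfolding reach_def by blast
    let ?G = "inv2 B ** (inv2 (C I) ** C J) ** B"
    \<comment> \<open>Near the base point X is \<open>Y K z v* B\<close> and its continuation is
      \<open>Y K z v* ?A\<close>, so the matrix G with Y = Y* G solves
      \<open>?A ** ?G = B\<close>.\<close>
    have "?A ** ?G = inv2 (C J) ** (C I ** (B ** inv2 B) ** inv2 (C I)) ** C J ** B"
      by (simp add: matrix_mul_assoc)
    also have "\<dots> = B" by (simp add: B(1) inv2_right inv2_left det_C_nonzero I J)
    finally have AG: "?A ** ?G = B" .
    have "\<forall>\<^sub>F z in nhds z0. X z = F 1 z v* ?G"
      using F(3) B(2) by eventually_elim (simp only: vector_matrix_mul_assoc AG)
    then show ?thesis unfolding monodromy_def monodromy_matrix_def using p F by blast
  qed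
  then show ?thesis using that B(1) by blast
qed

end

section \<open>Hypergeometric series\<close>

lemma tendsto_shift_ratio: "(\<lambda>n. (of_nat n + x) / (of_nat n + y) :: complex) \<longlonglongrightarrow> 1"
proof -
  have inf: "filterlim (\<lambda>n. of_nat n + y :: complex) at_infinity sequentially"
    by (rule tendsto_add_filterlim_at_infinity'[OF tendsto_of_nat tendsto_const])
  have "(\<lambda>n. 1 + (x - y) / (of_nat n + y)) \<longlonglongrightarrow> 1 + 0"
    by (intro tendsto_intros tendsto_divide_0[OF tendsto_const inf])
  moreover have "\<forall>\<^sub>F n in sequentially. 1 + (x - y) / (of_nat n + y) = (of_nat n + x) / (of_nat n + y)"
    using filterlim_at_infinity_imp_eventually_ne[OF inf, of 0]
    by eventually_elim (simp add: field_simps)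
  ultimately show ?thesis by (simp add: filterlim_cong)
qed

text \<open>If \<open>c = -k\<close> is a nonpositive integer, the series starts with the power \<open>z\<^sup>k\<^sup>+\<^sup>1\<close>, which belongs to
  the other exponent \<open>1 - c\<close>; this way there is a power series solution for every \<open>c\<close>.\<close>
lemma hypergeometric_coeffs_exist:
  fixes a b c :: complex
  obtains s :: "nat \<Rightarrow> complex" and m :: nat where
    "\<And>n. s (Suc n) * (of_nat (Suc n) * (of_nat n + c)) = (of_nat n + a) * (of_nat n + b) * s n"
    "s m \<noteq> 0" "\<And>n. m \<le> n \<Longrightarrow> of_nat n + c \<noteq> 0"
    "a \<in> \<int> \<Longrightarrow> b \<in> \<int> \<Longrightarrow> c \<in> \<int> \<Longrightarrow> range s \<subseteq> \<rat>"
proof -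
  \<comment> \<open>m is 0 unless c = -k for a natural k, when m = k + 1. The second property makes
    the recurrence at n = m - 1 read 0 = 0, so the series may start afresh at m.\<close>
  obtain m :: nat where m: "\<And>n. m \<le> n \<Longrightarrow> of_nat n + c \<noteq> 0" "\<And>n. Suc n = m \<Longrightarrow> of_nat n + c = 0"
  proof (cases "\<exists>k::nat. c = - of_nat k")
    case True
    then obtain k :: nat where k: "c = - of_nat k" by blast
    show ?thesis by (rule that[of "Suc k"]) (auto simp: k)
  next
    case False
    show ?thesis by (rule that[of 0]) (use False in \<open>auto simp: add_eq_0_iff\<close>)
  qed
  define f where "f k = ((of_nat k + a) * (of_nat k + b)) / (of_nat (Suc k) * (of_nat k + c))" for k
  define s where "s n = (if n < m then 0 else \<Prod>k\<in>{m..<n}. f k)" for n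
  have "s (Suc n) * (of_nat (Suc n) * (of_nat n + c)) = (of_nat n + a) * (of_nat n + b) * s n" for n
  proof (cases "m \<le> n")
    case True
    then have "s (Suc n) = s n * f n" by (simp add: s_def)
    moreover have "f n * (of_nat (Suc n) * (of_nat n + c)) = (of_nat n + a) * (of_nat n + b)"
      using m(1)[OF True] unfolding f_def by (simp del: of_nat_Suc)
    ultimately show ?thesis by (simp add: mult_ac del: of_nat_Suc)
  next
    case False
    then show ?thesis using m(2)[of n] by (cases "Suc n = m") (auto simp: s_def)
  qed
  moreover have "s m \<noteq> 0" by (simp add: s_def)
  moreover have "range s \<subseteq> \<rat>" if "a \<in> \<int>" "b \<in> \<int>" "c \<in> \<int>"
  proof -
    have Q: "a \<in> \<rat>" "b \<in> \<rat>" "c \<in> \<rat>" using that Ints_subset_Rats by auto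
    have "f k \<in> \<rat>" for k unfolding f_def by (intro Rats_divide Rats_mult Rats_add Rats_of_nat Q)
    then show ?thesis by (auto simp: s_def intro!: Rats_prod)
  qed
  ultimately show ?thesis using that m(1) by blast
qed

text \<open>The ratio test gives radius 1 unless a coefficient from m on vanishes, and then the
  recurrence kills all later ones. This dichotomy is what later forces an entire solution to be a
  polynomial.\<close>

lemma hypergeometric_conv_radius:
  fixes a b c :: complex and s :: "nat \<Rightarrow> complex"
  assumes rec: "\<And>n. s (Suc n) * (of_nat (Suc n) * (of_nat n + c)) = (of_nat n + a) * (of_nat n + b) * s n"
    and nz: "\<And>n. m \<le> n \<Longrightarrow> of_nat n + c \<noteq> 0"
  shows "(\<forall>\<^sub>F n in sequentially. s n = 0) \<and> conv_radius s = \<infinity> \<or> conv_radius s = 1"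
proof (cases "\<exists>N\<ge>m. s N = 0")
  case True
  then obtain N where N: "m \<le> N" "s N = 0" by blast
  have "s n = 0" if "N \<le> n" for n
    using that
  proof (induction n rule: dec_induct)
    case (step n)
    have "of_nat (Suc n) * (of_nat n + c) \<noteq> 0" using nz[of n] N step by (simp del: of_nat_Suc)
    then show ?case using rec[of n] step by simp
  qed (rule N)
  then have ev: "\<forall>\<^sub>F n in sequentially. s n = 0" unfolding eventually_sequentially by blast
  then have "conv_radius s = conv_radius (\<lambda>_. 0 :: complex)" by (rule conv_radius_cong')
  then show ?thesis using ev by simp
next
  case False
  have "(\<lambda>n. norm ((of_nat n + 1) / (of_nat n + a) * ((of_nat n + c) / (of_nat n + b)))) \<longlonglongrightarrow> norm (1 * 1 :: complex)"
    by (intro tendsto_intros tendsto_shift_ratio)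
  moreover have "\<forall>\<^sub>F n in sequentially. norm ((of_nat n + 1) / (of_nat n + a) * ((of_nat n + c) / (of_nat n + b)))
      = norm (s n) / norm (s (Suc n))"
    using eventually_ge_at_top[of m]
  proof eventually_elim
    case (elim n)
    then have s: "s n \<noteq> 0" "s (Suc n) \<noteq> 0" using False by auto
    have "of_nat (Suc n) * (of_nat n + c) \<noteq> 0" using nz[OF elim] by (simp del: of_nat_Suc)
    then have ab: "(of_nat n + a) * (of_nat n + b) \<noteq> 0" using rec[of n] s by (metis mult_eq_0_iff)
    have "(of_nat n + 1) / (of_nat n + a) * ((of_nat n + c) / (of_nat n + b)) = s n / s (Suc n)"
      using ab s rec[of n] by (simp add: field_simps)
    then show ?case by (simp only: norm_divide)
  qed
  ultimately have "(\<lambda>n. norm (s n) / norm (s (Suc n))) \<longlonglongrightarrow> 1" by (simp add: filterlim_cong)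
  then have "conv_radius s = ereal 1" by (intro conv_radius_ratio_limit_nonzero) auto
  then show ?thesis by (simp add: one_ereal_def)
qed

lemma unit_ball_subset_eball: "1 \<le> R \<Longrightarrow> ball (0::complex) 1 \<subseteq> eball 0 R"
  using less_le_trans[of "ereal _" 1 R] by (auto simp: in_eball_iff one_ereal_def)

text \<open>The recurrence is the coefficient of z^n in the equation cleared of denominators; the
  identity theorem carries the equation from germs at 0 to the unit disc. The parameters stay free
  because all three singular points use this series.\<close>

lemma hypergeometric_series_exists:
  fixes a b c :: complex
  obtains F :: "complex fps" where
    "F \<noteq> 0" "1 \<le> fps_conv_radius F"
    "\<And>z. z \<in> ball 0 1 \<Longrightarrow> (eval_fps F has_field_derivative eval_fps (fps_deriv F) z) (at z)"
    "\<And>z. z \<in> ball 0 1 \<Longrightarrow>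
       (eval_fps (fps_deriv F) has_field_derivative eval_fps (fps_deriv (fps_deriv F)) z) (at z)"
    "\<And>z. z \<in> ball 0 1 \<Longrightarrow> z * (1 - z) * eval_fps (fps_deriv (fps_deriv F)) z
       + (c - (1 + a + b) * z) * eval_fps (fps_deriv F) z - a * b * eval_fps F z = 0"
    "a \<in> \<int> \<Longrightarrow> b \<in> \<int> \<Longrightarrow> c \<in> \<int> \<Longrightarrow> range (fps_nth F) \<subseteq> \<rat>"
    "fps_conv_radius F = \<infinity> \<Longrightarrow> \<forall>\<^sub>F n in sequentially. fps_nth F n = 0"
proof -
  obtain s m where
    s: "\<And>n. s (Suc n) * (of_nat (Suc n) * (of_nat n + c)) = (of_nat n + a) * (of_nat n + b) * s n"
      "s m \<noteq> 0" "\<And>n. m \<le> n \<Longrightarrow> of_nat n + c \<noteq> 0" "a \<in> \<int> \<Longrightarrow> b \<in> \<int> \<Longrightarrow> c \<in> \<int> \<Longrightarrow> range s \<subseteq> \<rat>"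
    using hypergeometric_coeffs_exist[of c a b] by blast
  define F where "F = Abs_fps s"
  have nth: "fps_nth F = s" by (simp add: F_def fun_eq_iff)
  have R: "fps_conv_radius F = conv_radius s" by (simp add: fps_conv_radius_def nth)
  have rad: "(\<forall>\<^sub>F n in sequentially. s n = 0) \<and> conv_radius s = \<infinity> \<or> conv_radius s = 1"
    by (rule hypergeometric_conv_radius[OF s(1), of m]) (rule s(3))
  then have R1: "1 \<le> fps_conv_radius F" unfolding R by auto
  have R2: "1 \<le> fps_conv_radius (fps_deriv F)" "1 \<le> fps_conv_radius (fps_deriv (fps_deriv F))"
    using R1 fps_conv_radius_deriv[of F] fps_conv_radius_deriv[of "fps_deriv F"] by auto
  have der: "(eval_fps G has_field_derivative eval_fps (fps_deriv G) z) (at z)"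
    if "1 \<le> fps_conv_radius G" "z \<in> ball 0 1" for G :: "complex fps" and z
  proof (rule has_field_derivative_eval_fps)
    have "ereal (norm z) < 1" using that(2) by (simp add: one_ereal_def)
    then show "ereal (norm z) < fps_conv_radius G" using that(1) by (rule less_le_trans)
  qed
  let ?D = "\<lambda>z. z * (1 - z) * eval_fps (fps_deriv (fps_deriv F)) z
       + (c - (1 + a + b) * z) * eval_fps (fps_deriv F) z - a * b * eval_fps F z"
  let ?G = "fps_X * (1 - fps_X) * fps_deriv (fps_deriv F)
       + (fps_const c - fps_const (1 + a + b) * fps_X) * fps_deriv F - fps_const (a * b) * F"
  have pos: "0 < fps_conv_radius F" "0 < fps_conv_radius (fps_deriv F)" "0 < fps_conv_radius (fps_deriv (fps_deriv F))"
    using R1 R2 by (auto intro: less_le_trans[of 0 1])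
  have exp: "?D has_fps_expansion ?G"
    by (intro fps_expansion_intros eval_fps_has_fps_expansion pos)
  have "?G = 0"
  proof (rule fps_ext)
    fix n
    have G: "?G = fps_X * fps_deriv (fps_deriv F) - fps_X * (fps_X * fps_deriv (fps_deriv F))
       + fps_const c * fps_deriv F - fps_const (1 + a + b) * (fps_X * fps_deriv F) - fps_const (a * b) * F"
      by (simp add: algebra_simps)
    have "fps_nth ?G n = of_nat n * of_nat (Suc n) * s (Suc n) - of_nat n * (of_nat n - 1) * s n
       + c * (of_nat (Suc n) * s (Suc n)) - (1 + a + b) * (of_nat n * s n) - a * b * s n"
      unfolding G by (cases n; cases "n - 1") (simp_all add: nth algebra_simps)
    also have "\<dots> = s (Suc n) * (of_nat (Suc n) * (of_nat n + c)) - (of_nat n + a) * (of_nat n + b) * s n"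
      by (simp add: algebra_simps)
    also have "\<dots> = 0" using s(1)[of n] by simp
    finally show "fps_nth ?G n = fps_nth 0 n" by simp
  qed
  with exp have "?D has_fps_expansion 0" by simp
  moreover have "?D holomorphic_on ball 0 1"
    using R1 R2 by (intro holomorphic_intros unit_ball_subset_eball)
  ultimately have "?D z = 0" if "z \<in> ball 0 1" for z
    by (rule has_fps_expansion_0_analytic_continuation) (use that in auto)
  note ode = this
  show ?thesis
  proof (rule that[of F])
    show "F \<noteq> 0" using s(2) nth by auto
    show "\<forall>\<^sub>F n in sequentially. fps_nth F n = 0" if "fps_conv_radius F = \<infinity>"
      using rad that unfolding R nth by auto
  qed (use R1 R2 der s(4) ode nth in auto)
qed


section \<open>Local solutions at the singular points\<close>

context hypergeometric
begin

lemma solI_cleared: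
  assumes "open U" "U \<subseteq> - {0, 1}" and u: "\<And>z. z \<in> U \<Longrightarrow> (u has_field_derivative v z) (at z)"
    and v: "\<And>z. z \<in> U \<Longrightarrow> (v has_field_derivative w z) (at z)"
    and ode: "\<And>z. z \<in> U \<Longrightarrow> z * (1 - z) * w z + (\<gamma> - (1 + \<alpha> + \<beta>) * z) * v z - \<alpha> * \<beta> * u z = 0"
  shows "sol U u"
proof (rule solI[OF assms(1) u])
  fix z assume z: "z \<in> U"
  then have nz: "z * (1 - z) \<noteq> 0" using assms(2) by auto
  have "z * (1 - z) * w z = - (\<gamma> - (1 + \<alpha> + \<beta>) * z) * v z + \<alpha> * \<beta> * u z"
    using ode[OF z] by (simp add: algebra_simps)
  then have "w z = (- (\<gamma> - (1 + \<alpha> + \<beta>) * z) * v z + \<alpha> * \<beta> * u z) / (z * (1 - z))"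
    using nz by (metis nonzero_mult_div_cancel_left)
  also have "\<dots> = - hp z * v z + hq z * u z"
  proof -
    have "(- a * v + b * u) / d = - (a / d) * v + (b / d) * u" for a b d u v :: complex
      by (simp add: add_divide_distrib diff_divide_distrib)
    then show ?thesis unfolding hp_def hq_def .
  qed
  finally show "(v has_field_derivative - hp z * v z + hq z * u z) (at z)" using v[OF z] by simp
qed

lemma series_solution_at_0:
  obtains F where "F \<noteq> 0" "1 \<le> fps_conv_radius F" "sol (ball 0 1 - {0}) (eval_fps F)"
    "\<alpha> \<in> \<int> \<Longrightarrow> \<beta> \<in> \<int> \<Longrightarrow> \<gamma> \<in> \<int> \<Longrightarrow> range (fps_nth F) \<subseteq> \<rat>"
    "fps_conv_radius F = \<infinity> \<Longrightarrow> \<forall>\<^sub>F n in sequentially. fps_nth F n = 0"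
proof -
  obtain F :: "complex fps" where F: "F \<noteq> 0" "1 \<le> fps_conv_radius F"
    "\<And>z. z \<in> ball 0 1 \<Longrightarrow> (eval_fps F has_field_derivative eval_fps (fps_deriv F) z) (at z)"
    "\<And>z. z \<in> ball 0 1 \<Longrightarrow> (eval_fps (fps_deriv F) has_field_derivative eval_fps (fps_deriv (fps_deriv F)) z) (at z)"
    "\<And>z. z \<in> ball 0 1 \<Longrightarrow> z * (1 - z) * eval_fps (fps_deriv (fps_deriv F)) z
       + (\<gamma> - (1 + \<alpha> + \<beta>) * z) * eval_fps (fps_deriv F) z - \<alpha> * \<beta> * eval_fps F z = 0"
    "\<alpha> \<in> \<int> \<Longrightarrow> \<beta> \<in> \<int> \<Longrightarrow> \<gamma> \<in> \<int> \<Longrightarrow> range (fps_nth F) \<subseteq> \<rat>"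
    "fps_conv_radius F = \<infinity> \<Longrightarrow> \<forall>\<^sub>F n in sequentially. fps_nth F n = 0"
    by (rule hypergeometric_series_exists[of \<gamma> \<alpha> \<beta>]) blast
  have "sol (ball 0 1 - {0}) (eval_fps F)"
    by (rule solI_cleared[where v = "eval_fps (fps_deriv F)" and w = "eval_fps (fps_deriv (fps_deriv F))"])
       (use F(3-5) in auto)
  then show ?thesis by (rule that[OF F(1,2) _ F(6,7)])
qed

text \<open>The substitution of 1 - z for z keeps \<alpha> and \<beta> in the equation and replaces
  \<gamma> by \<alpha> + \<beta> + 1 - \<gamma>.\<close>

lemma series_solution_at_1:
  obtains F where "F \<noteq> 0" "1 \<le> fps_conv_radius F" "sol (ball 1 1 - {1}) (\<lambda>z. eval_fps F (1 - z))"
proof -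
  let ?c = "\<alpha> + \<beta> + 1 - \<gamma>"
  obtain F :: "complex fps" where F: "F \<noteq> 0" "1 \<le> fps_conv_radius F"
    "\<And>z. z \<in> ball 0 1 \<Longrightarrow> (eval_fps F has_field_derivative eval_fps (fps_deriv F) z) (at z)"
    "\<And>z. z \<in> ball 0 1 \<Longrightarrow> (eval_fps (fps_deriv F) has_field_derivative eval_fps (fps_deriv (fps_deriv F)) z) (at z)"
    "\<And>z. z \<in> ball 0 1 \<Longrightarrow> z * (1 - z) * eval_fps (fps_deriv (fps_deriv F)) z
       + (?c - (1 + \<alpha> + \<beta>) * z) * eval_fps (fps_deriv F) z - \<alpha> * \<beta> * eval_fps F z = 0"
    by (rule hypergeometric_series_exists[of ?c \<alpha> \<beta>]) blast
  have b: "1 - z \<in> ball 0 1" if "z \<in> ball 1 1 - {1}" for z :: complex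
    using that by (simp add: dist_norm norm_minus_commute)
  have refl: "((\<lambda>z::complex. 1 - z) has_field_derivative - 1) (at z)" for z
    by (auto intro!: derivative_eq_intros)
  have "sol (ball 1 1 - {1}) (\<lambda>z. eval_fps F (1 - z))"
  proof (rule solI_cleared[where v = "\<lambda>z. - eval_fps (fps_deriv F) (1 - z)"
        and w = "\<lambda>z. eval_fps (fps_deriv (fps_deriv F)) (1 - z)"])
    fix z :: complex assume z: "z \<in> ball 1 1 - {1}"
    show "((\<lambda>z. eval_fps F (1 - z)) has_field_derivative - eval_fps (fps_deriv F) (1 - z)) (at z)"
      using DERIV_chain2[OF F(3)[OF b[OF z]] refl] by simp
    show "((\<lambda>z. - eval_fps (fps_deriv F) (1 - z)) has_field_derivative eval_fps (fps_deriv (fps_deriv F)) (1 - z)) (at z)"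
      using DERIV_minus[OF DERIV_chain2[OF F(4)[OF b[OF z]] refl]] by simp
    show "z * (1 - z) * eval_fps (fps_deriv (fps_deriv F)) (1 - z)
        + (\<gamma> - (1 + \<alpha> + \<beta>) * z) * - eval_fps (fps_deriv F) (1 - z) - \<alpha> * \<beta> * eval_fps F (1 - z) = 0"
      using F(5)[OF b[OF z]] by (simp add: algebra_simps)
  qed (auto simp: dist_norm)
  then show ?thesis by (rule that[OF F(1,2)])
qed

text \<open>The local exponent \<alpha> at infinity: z^(-\<alpha>) times a hypergeometric series in
  1 / z with upper parameters \<alpha>, \<alpha> - \<gamma> + 1 and lower parameter \<alpha> -
  \<beta> + 1. The power enters only through its differential equation, so one series serves every
  branch E.\<close>

lemma series_solution_at_infinity:
  obtains F where "F \<noteq> 0" "1 \<le> fps_conv_radius F"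
    "\<And>U E. \<lbrakk>open U; U \<subseteq> {z. 1 < norm z}; \<And>z. z \<in> U \<Longrightarrow> (E has_field_derivative - \<alpha> * E z / z) (at z)\<rbrakk>
       \<Longrightarrow> sol U (\<lambda>z. E z * eval_fps F (inverse z))"
proof -
  let ?b = "\<alpha> - \<gamma> + 1" and ?c = "\<alpha> - \<beta> + 1"
  obtain F :: "complex fps" where F: "F \<noteq> 0" "1 \<le> fps_conv_radius F"
    "\<And>z. z \<in> ball 0 1 \<Longrightarrow> (eval_fps F has_field_derivative eval_fps (fps_deriv F) z) (at z)"
    "\<And>z. z \<in> ball 0 1 \<Longrightarrow> (eval_fps (fps_deriv F) has_field_derivative eval_fps (fps_deriv (fps_deriv F)) z) (at z)"
    "\<And>z. z \<in> ball 0 1 \<Longrightarrow> z * (1 - z) * eval_fps (fps_deriv (fps_deriv F)) z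
       + (?c - (1 + \<alpha> + ?b) * z) * eval_fps (fps_deriv F) z - \<alpha> * ?b * eval_fps F z = 0"
    by (rule hypergeometric_series_exists[of ?c \<alpha> ?b]) blast
  let ?h = "\<lambda>z. eval_fps F (inverse z)" and ?h1 = "\<lambda>z. eval_fps (fps_deriv F) (inverse z)"
    and ?h2 = "\<lambda>z. eval_fps (fps_deriv (fps_deriv F)) (inverse z)"
  have "sol U (\<lambda>z. E z * ?h z)"
    if U: "open U" "U \<subseteq> {z. 1 < norm z}" and E: "\<And>z. z \<in> U \<Longrightarrow> (E has_field_derivative - \<alpha> * E z / z) (at z)" for U E
  proof (rule solI_cleared[where v = "\<lambda>z. - E z * (\<alpha> * inverse z * ?h z + inverse z ^ 2 * ?h1 z)"
        and w = "\<lambda>z. E z * (\<alpha> * (\<alpha> + 1) * inverse z ^ 2 * ?h z + (2 * \<alpha> + 2) * inverse z ^ 3 * ?h1 z + inverse z ^ 4 * ?h2 z)"])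
    fix z assume z: "z \<in> U"
    then have "1 < norm z" using U(2) by auto
    then have nz: "z \<noteq> 0" and b: "inverse z \<in> ball 0 1" by (auto simp: norm_inverse inverse_less_1_iff)
    have inv: "(inverse has_field_derivative - (inverse z ^ 2)) (at z)"
      using DERIV_inverse[OF nz, of UNIV] by (simp add: power2_eq_square)
    note d = E[OF z] DERIV_chain2[OF F(3)[OF b] inv] DERIV_chain2[OF F(4)[OF b] inv] inv
    define w where "w = inverse z"
    have wz: "w * z = 1" "z * w = 1" using nz by (simp_all add: w_def)
    show "((\<lambda>z. E z * ?h z) has_field_derivative - E z * (\<alpha> * inverse z * ?h z + inverse z ^ 2 * ?h1 z)) (at z)"
      by (rule derivative_eq_intros d refl)+ (simp add: divide_inverse algebra_simps)
    show "((\<lambda>z. - E z * (\<alpha> * inverse z * ?h z + inverse z ^ 2 * ?h1 z)) has_field_derivative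
        E z * (\<alpha> * (\<alpha> + 1) * inverse z ^ 2 * ?h z + (2 * \<alpha> + 2) * inverse z ^ 3 * ?h1 z + inverse z ^ 4 * ?h2 z)) (at z)"
      by (rule derivative_eq_intros d refl)+ (simp add: divide_inverse algebra_simps power2_eq_square power3_eq_cube power4_eq_xxxx)
    have ode: "w * (1 - w) * ?h2 z + (?c - (1 + \<alpha> + ?b) * w) * ?h1 z - \<alpha> * ?b * ?h z = 0"
      using F(5)[OF b] by (simp add: w_def)
    \<comment> \<open>The cleared operator applied to the product E h(1/z) and divided by E is -w
      times the transformed operator in w = 1 / z.\<close>
    have "z * (1 - z) * (\<alpha> * (\<alpha> + 1) * w ^ 2 * ?h z + (2 * \<alpha> + 2) * w ^ 3 * ?h1 z + w ^ 4 * ?h2 z)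
        - (\<gamma> - (1 + \<alpha> + \<beta>) * z) * (\<alpha> * w * ?h z + w ^ 2 * ?h1 z) - \<alpha> * \<beta> * ?h z
      = - w * (w * (1 - w) * ?h2 z + (?c - (1 + \<alpha> + ?b) * w) * ?h1 z - \<alpha> * ?b * ?h z)"
      using wz by algebra
    then have *: "z * (1 - z) * (\<alpha> * (\<alpha> + 1) * w ^ 2 * ?h z + (2 * \<alpha> + 2) * w ^ 3 * ?h1 z + w ^ 4 * ?h2 z)
        - (\<gamma> - (1 + \<alpha> + \<beta>) * z) * (\<alpha> * w * ?h z + w ^ 2 * ?h1 z) - \<alpha> * \<beta> * ?h z = 0"
      unfolding ode by simp
    have "z * (1 - z) * (E z * (\<alpha> * (\<alpha> + 1) * w ^ 2 * ?h z + (2 * \<alpha> + 2) * w ^ 3 * ?h1 z + w ^ 4 * ?h2 z))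
        + (\<gamma> - (1 + \<alpha> + \<beta>) * z) * (- E z * (\<alpha> * w * ?h z + w ^ 2 * ?h1 z)) - \<alpha> * \<beta> * (E z * ?h z)
      = E z * (z * (1 - z) * (\<alpha> * (\<alpha> + 1) * w ^ 2 * ?h z + (2 * \<alpha> + 2) * w ^ 3 * ?h1 z + w ^ 4 * ?h2 z)
        - (\<gamma> - (1 + \<alpha> + \<beta>) * z) * (\<alpha> * w * ?h z + w ^ 2 * ?h1 z) - \<alpha> * \<beta> * ?h z)"
      by algebra
    also have "\<dots> = 0" unfolding * by simp
    finally show "z * (1 - z) * (E z * (\<alpha> * (\<alpha> + 1) * inverse z ^ 2 * ?h z + (2 * \<alpha> + 2) * inverse z ^ 3 * ?h1 z + inverse z ^ 4 * ?h2 z))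
        + (\<gamma> - (1 + \<alpha> + \<beta>) * z) * (- E z * (\<alpha> * inverse z * ?h z + inverse z ^ 2 * ?h1 z)) - \<alpha> * \<beta> * (E z * ?h z) = 0"
      unfolding w_def .
  qed (use U in auto)
  then show ?thesis using that[OF F(1,2)] by blast
qed

end

section \<open>Eigenvectors of the connection matrices\<close>

definition lc :: "complex^2 \<Rightarrow> complex^2 \<Rightarrow> complex" where
  "lc v y = v $ 1 * y $ 1 + v $ 2 * y $ 2"

text \<open>A change of the row basis by A becomes the action of A on coefficient columns;
  multiplicative jumps below the axis thus turn into eigenvector equations for the connection
  matrices.\<close>

lemma lc_mult: "lc v (y v* A) = lc (A *v v) y"
  by (simp add: lc_def vector_matrix_mult_def matrix_vector_mult_def sum_2 algebra_simps)

lemma lc_scale: "lc (c *s v) y = c * lc v y"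
  by (simp add: lc_def algebra_simps)

lemma lc_add: "lc (v + w) y = lc v y + lc w y"
  by (simp add: lc_def algebra_simps)

lemma lc_diff: "lc (v - w) y = lc v y - lc w y"
  by (simp add: lc_def algebra_simps)

lemma lc_0 [simp]: "lc 0 y = 0"
  by (simp add: lc_def)

lemma eval_fps_nonzero:
  assumes "F \<noteq> 0" "1 \<le> fps_conv_radius F" "open U" "U \<subseteq> ball 0 1" "w \<in> U"
    "\<And>z. z \<in> U \<Longrightarrow> eval_fps F z = (0::complex)"
  shows False
proof -
  have "eval_fps F holomorphic_on ball 0 1"
    using assms(2) by (intro holomorphic_on_eval_fps unit_ball_subset_eball)
  then have "eval_fps F z = 0" if "z \<in> ball 0 1" for z
    using analytic_continuation_open[of U "ball 0 1" "eval_fps F" "\<lambda>_. 0" z] assms that by auto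
  moreover have "\<forall>\<^sub>F z in nhds (0::complex). z \<in> ball 0 1" by (intro eventually_nhds_in_open) auto
  ultimately have "\<forall>\<^sub>F z in nhds 0. eval_fps F z = 0" by (auto elim: eventually_mono)
  moreover have "0 < fps_conv_radius F" using assms(2) by (auto intro: less_le_trans[of 0 1])
  ultimately have "F = 0"
    using eval_fps_has_fps_expansion[of F] has_fps_expansion_0_iff[of "eval_fps F"]
      fps_expansion_unique_complex[of "eval_fps F" F 0] by auto
  then show False using assms(1) by simp
qed

context chart_system
begin

lemma sol_lc: "I \<in> charts \<Longrightarrow> sol (cut_plane I) (\<lambda>z. lc v (Y I z))"
  unfolding lc_def by (intro sol_comb open_chart sol_Y)

lemma lc_zero_imp:
  assumes "I \<in> charts" "open U" "U \<subseteq> cut_plane I" "z \<in> U" "\<And>z. z \<in> U \<Longrightarrow> lc v (Y I z) = 0"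
  shows "v = 0"
  using Y_combination_zero[OF assms(1-4), of "v $ 1" "v $ 2"] assms(5)
  by (simp add: lc_def vec_eq_iff forall_2)

lemma lc_eq_imp:
  assumes "I \<in> charts" "open U" "U \<subseteq> cut_plane I" "z \<in> U" "\<And>z. z \<in> U \<Longrightarrow> lc v (Y I z) = lc w (Y I z)"
  shows "v = w"
  using lc_zero_imp[OF assms(1-4), of "v - w"] assms(5) by (simp add: lc_diff)

lemma sol_expand_lc:
  assumes I: "I \<in> charts" and U: "open U" "connected U" "U \<subseteq> cut_plane I" "sol U f"
  obtains v where "\<And>z. z \<in> U \<Longrightarrow> f z = lc v (Y I z)"
proof -
  obtain a b where "\<And>z. z \<in> U \<Longrightarrow> f z = a * Y I z $ 1 + b * Y I z $ 2"
  proof (rule sol_expand[OF U(1,2) sol_subset[OF sol_Y[OF I] U(3)] sol_subset[OF sol_Y[OF I] U(3)] U(4)])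
    show "wr (\<lambda>z. Y I z $ 1) (\<lambda>z. Y I z $ 2) z \<noteq> 0" if "z \<in> U" for z
      using wrv_nonzero[OF I, of z] that U(3) by (auto simp: wrv_def)
  qed blast
  then show ?thesis by (intro that[of "vector [a, b]"]) (simp add: lc_def)
qed

text \<open>f and g are the branches of one local solution in two charts, and B is a disc around a
  finite singular point or the exterior of the unit disc. The branches agree above the axis and so
  share the coefficient vector v; comparing them below relates \<open>C I\<close> to
  \<open>C J\<close>.\<close>

lemma local_solution_eigenvector:
  assumes IJ: "I \<in> charts" "J \<in> charts" and B: "open B" "connected (cut_plane I \<inter> B)" "connected (cut_plane J \<inter> B)"
    and w: "w1 \<in> B" "Im w1 > 0" "w2 \<in> B" "Im w2 < 0"
    and fg: "sol (cut_plane I \<inter> B) f" "sol (cut_plane J \<inter> B) g"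
      "\<And>z. z \<in> B \<Longrightarrow> Im z > 0 \<Longrightarrow> f z = g z" "\<And>z. z \<in> B \<Longrightarrow> Im z < 0 \<Longrightarrow> f z = \<mu> * g z"
  obtains v where "\<And>z. z \<in> cut_plane I \<inter> B \<Longrightarrow> f z = lc v (Y I z)"
    "\<And>z. z \<in> cut_plane J \<inter> B \<Longrightarrow> g z = lc v (Y J z)" "C I *v v = \<mu> *s (C J *v v)"
proof -
  obtain v where v: "\<And>z. z \<in> cut_plane I \<inter> B \<Longrightarrow> f z = lc v (Y I z)"
    using sol_expand_lc[OF IJ(1) open_Int[OF open_chart[OF IJ(1)] B(1)] B(2) _ fg(1)] by blast
  obtain v' where v': "\<And>z. z \<in> cut_plane J \<inter> B \<Longrightarrow> g z = lc v' (Y J z)"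
    using sol_expand_lc[OF IJ(2) open_Int[OF open_chart[OF IJ(2)] B(1)] B(3) _ fg(2)] by blast
  have up: "z \<in> cut_plane K" if "Im z > 0" for z K using that by (simp add: cut_plane_def)
  have lo: "z \<in> cut_plane K" if "Im z < 0" for z K using that by (simp add: cut_plane_def)
  have "v = v'"
  proof (rule lc_eq_imp[OF IJ(1), of "{z. Im z > 0} \<inter> B" w1])
    fix z assume z: "z \<in> {z. Im z > 0} \<inter> B"
    then have "lc v (Y I z) = f z" "lc v' (Y J z) = g z" using v[of z] v'[of z] up by auto
    then show "lc v (Y I z) = lc v' (Y I z)" using Y_upper[OF IJ, of z] fg(3)[of z] z by auto
  qed (use B(1) open_half_planes w up in auto)
  moreover have "C I *v v = \<mu> *s (C J *v v')"
  proof (rule lc_eq_imp[OF charts_mem(2), of "{z. Im z < 0} \<inter> B" w2])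
    fix z assume z: "z \<in> {z. Im z < 0} \<inter> B"
    have "lc (C I *v v) (Y {0<..<1} z) = lc v (Y I z)" "lc (C J *v v') (Y {0<..<1} z) = lc v' (Y J z)"
      using z Y_lower[OF IJ(1), of z] Y_lower[OF IJ(2), of z] by (simp_all add: lc_mult)
    moreover have "lc v (Y I z) = f z" "lc v' (Y J z) = g z" using v[of z] v'[of z] lo z by auto
    ultimately show "lc (C I *v v) (Y {0<..<1} z) = lc (\<mu> *s (C J *v v')) (Y {0<..<1} z)"
      using fg(4)[of z] z by (simp add: lc_scale)
  qed (use B(1) open_half_planes w lo in auto)
  ultimately show ?thesis using that v v' by blast
qed

text \<open>A power series is single valued around 0, so both branches are the same function and the
  multiplier is 1.\<close>

lemma eigenvector_at_0:
  assumes F: "F \<noteq> 0" "1 \<le> fps_conv_radius F" "sol (ball 0 1 - {0}) (eval_fps F)"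
  obtains v where "v \<noteq> 0" "CL *v v = v"
    "\<And>I z. I \<in> {{..<0}, {0<..<1}} \<Longrightarrow> z \<in> cut_plane I \<inter> ball 0 1 \<Longrightarrow> eval_fps F z = lc v (Y I z)"
proof -
  have s: "sol (cut_plane I \<inter> ball 0 1) (eval_fps F)" if "I \<in> charts" for I
    using F(3) by (rule sol_subset) (use chart_subset[OF that] in auto)
  obtain v where v: "\<And>z. z \<in> cut_plane {..<0} \<inter> ball 0 1 \<Longrightarrow> eval_fps F z = lc v (Y {..<0} z)"
    "\<And>z. z \<in> cut_plane {0<..<1} \<inter> ball 0 1 \<Longrightarrow> eval_fps F z = lc v (Y {0<..<1} z)"
    "CL *v v = 1 *s (C {0<..<1} *v v)"
  proof (rule local_solution_eigenvector[of "{..<0}" "{0<..<1}" "ball 0 1" "\<i> / 2" "- \<i> / 2" "eval_fps F" "eval_fps F" 1])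
    show "connected (cut_plane {..<0} \<inter> ball 0 1)"
      by (rule connected_cut_plane_Int[where c = "-1/2"]) (auto simp: charts_props)
    show "connected (cut_plane {0<..<1} \<inter> ball 0 1)"
      by (rule connected_cut_plane_Int[where c = "1/2"]) (auto simp: charts_props)
  qed (use s in \<open>auto simp: norm_divide\<close>)
  have "v \<noteq> 0"
  proof
    assume "v = 0"
    then have "eval_fps F z = 0" if "z \<in> {z. Im z > 0} \<inter> ball 0 1" for z
      using v(1)[of z] that by (auto simp: cut_plane_def)
    then show False
      using eval_fps_nonzero[OF F(1,2), of "{z. Im z > 0} \<inter> ball 0 1" "\<i> / 2"] open_half_planes
      by (auto simp: norm_divide open_Int)
  qed
  moreover have "CL *v v = v" using v(3) by (simp add: C_mid)
  ultimately show ?thesis by (rule that) (use v(1,2) in blast)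
qed

lemma eigenvector_at_1:
  obtains v F where "v \<noteq> 0" "CR *v v = v" "1 \<le> fps_conv_radius F"
    "\<And>I z. I \<in> {{1<..}, {0<..<1}} \<Longrightarrow> z \<in> cut_plane I \<inter> ball 1 1 \<Longrightarrow> eval_fps F (1 - z) = lc v (Y I z)"
proof -
  obtain F where F: "F \<noteq> 0" "1 \<le> fps_conv_radius F" "sol (ball 1 1 - {1}) (\<lambda>z. eval_fps F (1 - z))"
    by (rule series_solution_at_1)
  have s: "sol (cut_plane I \<inter> ball 1 1) (\<lambda>z. eval_fps F (1 - z))" if "I \<in> charts" for I
    using F(3) by (rule sol_subset) (use chart_subset[OF that] in auto)
  have b: "1 + \<i> / 2 \<in> ball 1 1" "1 - \<i> / 2 \<in> ball 1 1" by (auto simp: dist_norm norm_divide)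
  obtain v where v: "\<And>z. z \<in> cut_plane {1<..} \<inter> ball 1 1 \<Longrightarrow> eval_fps F (1 - z) = lc v (Y {1<..} z)"
    "\<And>z. z \<in> cut_plane {0<..<1} \<inter> ball 1 1 \<Longrightarrow> eval_fps F (1 - z) = lc v (Y {0<..<1} z)"
    "CR *v v = 1 *s (C {0<..<1} *v v)"
  proof (rule local_solution_eigenvector[of "{1<..}" "{0<..<1}" "ball 1 1" "1 + \<i> / 2" "1 - \<i> / 2"
        "\<lambda>z. eval_fps F (1 - z)" "\<lambda>z. eval_fps F (1 - z)" 1])
    show "connected (cut_plane {1<..} \<inter> ball 1 1)"
      by (rule connected_cut_plane_Int[where c = "3/2"]) (auto simp: charts_props dist_norm)
    show "connected (cut_plane {0<..<1} \<inter> ball 1 1)"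
      by (rule connected_cut_plane_Int[where c = "1/2"]) (auto simp: charts_props dist_norm)
  qed (use s b in auto)
  have "v \<noteq> 0"
  proof
    assume "v = 0"
    have "eval_fps F z = 0" if "z \<in> {z. Im z > 0} \<inter> ball 0 1" for z
      using v(1)[of "1 - z"] that \<open>v = 0\<close> by (auto simp: cut_plane_def dist_norm)
    then show False
      using eval_fps_nonzero[OF F(1,2), of "{z. Im z > 0} \<inter> ball 0 1" "\<i> / 2"] open_half_planes
      by (auto simp: norm_divide open_Int)
  qed
  moreover have "CR *v v = v" using v(3) by (simp add: C_mid)
  ultimately show ?thesis using F(2) by (rule that) (use v(1,2) in blast)
qed

text \<open>The two outer charts are neighbours around infinity. Below the axis the logarithm of the
  left one is ahead by 2 pi i, which gives the multiplier of z^(-\<alpha>).\<close>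

lemma eigenvector_at_infinity:
  obtains v where "v \<noteq> 0" "CL *v v = exp (- (2 * of_real pi * \<i> * \<alpha>)) *s (CR *v v)"
proof -
  obtain F where F: "F \<noteq> 0" "1 \<le> fps_conv_radius F"
    "\<And>U E. \<lbrakk>open U; U \<subseteq> {z. 1 < norm z}; \<And>z. z \<in> U \<Longrightarrow> (E has_field_derivative - \<alpha> * E z / z) (at z)\<rbrakk>
       \<Longrightarrow> sol U (\<lambda>z. E z * eval_fps F (inverse z))"
    using series_solution_at_infinity by blast
  define E where "E I z = exp (- \<alpha> * log_branch 0 I z)" for I z
  let ?B = "{z::complex. 1 < norm z}"
  have oB: "open ?B" by (intro open_Collect_less continuous_intros)
  have s: "sol (cut_plane I \<inter> ?B) (\<lambda>z. E I z * eval_fps F (inverse z))" if I: "I \<in> charts" for I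
  proof (rule F(3))
    show "open (cut_plane I \<inter> ?B)" using open_chart[OF I] oB by blast
    show "(E I has_field_derivative - \<alpha> * E I z / z) (at z)" if "z \<in> cut_plane I \<inter> ?B" for z
    proof -
      have "(E I has_field_derivative E I z * (- \<alpha> * (1 / (z - of_real 0)))) (at z)"
        unfolding E_def[abs_def]
        by (rule derivative_eq_intros log_branch_has_derivative charts_props[OF I] refl | use that in force)+
      then show ?thesis by (simp add: mult_ac)
    qed
  qed auto
  \<comment> \<open>Outside the unit disc a chart is not starlike; inversion carries it to a slit
    disc, which is.\<close>
  have conn: "connected (cut_plane I \<inter> ?B)"
    if J: "convex J" "c \<in> J" "\<bar>c\<bar> < 1" "0 \<notin> J"
      and IJ: "\<And>x. 1 < \<bar>x\<bar> \<Longrightarrow> x \<in> I \<longleftrightarrow> inverse x \<in> J" for I J :: "real set" and c :: real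
  proof -
    have "cut_plane I \<inter> ?B = inverse ` (cut_plane J \<inter> ball 0 1)"
    proof (intro equalityI subsetI)
      have aux: "z \<in> cut_plane I \<longleftrightarrow> inverse z \<in> cut_plane J" if "1 < norm z" for z
      proof (cases "Im z = 0")
        case True
        then have "z = of_real (Re z)" by (simp add: complex_eq_iff)
        then obtain x where x: "z = of_real x" by blast
        have "inverse z = of_real (inverse x)" unfolding x by simp
        then show ?thesis using IJ[of x] that x by (simp add: cut_plane_def del: of_real_inverse)
      next
        case False
        then have "Im (inverse z) \<noteq> 0" using that by (auto simp: complex_eq_iff)
        then show ?thesis using False by (simp add: cut_plane_def)
      qed
      {
        fix z assume z: "z \<in> cut_plane I \<inter> ?B"
        then have "inverse z \<in> cut_plane J \<inter> ball 0 1"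
          using aux[of z] by (auto simp: norm_inverse inverse_less_1_iff)
        then show "z \<in> inverse ` (cut_plane J \<inter> ball 0 1)" by (rule image_eqI[rotated]) simp
      next
        fix z assume "z \<in> inverse ` (cut_plane J \<inter> ball 0 1)"
        then obtain w where w: "z = inverse w" "w \<in> cut_plane J" "norm w < 1" by auto
        then have "w \<noteq> 0" using J(4) by (auto simp: cut_plane_def)
        then have "1 < norm z" using w by (simp add: norm_inverse one_less_inverse_iff)
        then show "z \<in> cut_plane I \<inter> ?B" using aux[of z] w by simp
      }
    qed
    moreover have "connected (inverse ` (cut_plane J \<inter> ball (0::complex) 1))"
    proof (rule connected_continuous_image[OF _ connected_cut_plane_Int[OF J(1,2)]])
      show "continuous_on (cut_plane J \<inter> ball 0 1) (inverse :: complex \<Rightarrow> complex)"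
        using J(4) by (intro continuous_intros) (auto simp: cut_plane_def)
    qed (use J in auto)
    ultimately show ?thesis by simp
  qed
  have b: "2 * \<i> \<in> ?B" "- 2 * \<i> \<in> ?B" by (simp_all add: norm_mult)
  obtain v where v: "\<And>z. z \<in> cut_plane {..<0} \<inter> ?B \<Longrightarrow> E {..<0} z * eval_fps F (inverse z) = lc v (Y {..<0} z)"
    "CL *v v = exp (- (2 * of_real pi * \<i> * \<alpha>)) *s (CR *v v)"
  proof (rule local_solution_eigenvector[of "{..<0}" "{1<..}" ?B "2 * \<i>" "- 2 * \<i>"
        "\<lambda>z. E {..<0} z * eval_fps F (inverse z)" "\<lambda>z. E {1<..} z * eval_fps F (inverse z)"
        "exp (- (2 * of_real pi * \<i> * \<alpha>))"])
    show "connected (cut_plane {..<0} \<inter> ?B)" by (rule conn[of "{..<0}" "- 1 / 2"]) auto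
    \<comment> \<open>For x of absolute value above 1, the condition x > 1 only says that 1 / x is
      positive, so the inverted interval is the whole positive half line.\<close>
    show "connected (cut_plane {1<..} \<inter> ?B)"
    proof (rule conn[of "{0<..}" "1 / 2"])
      show "x \<in> {1<..} \<longleftrightarrow> inverse x \<in> {0<..}" if "1 < \<bar>x\<bar>" for x :: real using that by auto
    qed auto
    show "E {..<0} z * eval_fps F (inverse z) = E {1<..} z * eval_fps F (inverse z)" if "Im z > 0" for z
      using that by (simp add: E_def log_branch_upper)
    show "E {..<0} z * eval_fps F (inverse z) = exp (- (2 * of_real pi * \<i> * \<alpha>)) * (E {1<..} z * eval_fps F (inverse z))"
      if "Im z < 0" for z
    proof -
      have "E {..<0} z = exp (- (2 * of_real pi * \<i> * \<alpha>)) * E {1<..} z"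
        unfolding E_def exp_add[symmetric]
        by (rule arg_cong[of _ _ exp]) (simp add: log_branch_lower[OF that] chart_position algebra_simps)
      then show ?thesis by simp
    qed
  qed (use s oB b in auto)
  have "v \<noteq> 0"
  proof
    assume "v = 0"
    have "eval_fps F z = 0" if z: "z \<in> {z. Im z > 0} \<inter> ball 0 1" for z
    proof -
      have "z \<noteq> 0" using z by auto
      then have "1 < norm (inverse z)" using z by (simp add: norm_inverse one_less_inverse_iff)
      moreover have "Im (inverse z) \<noteq> 0" using z by (auto simp: complex_eq_iff)
      ultimately have "inverse z \<in> cut_plane {..<0} \<inter> ?B" by (simp add: cut_plane_def)
      from v(1)[OF this] show ?thesis using \<open>v = 0\<close> by (simp add: E_def)
    qed
    then show False
      using eval_fps_nonzero[OF F(1,2), of "{z. Im z > 0} \<inter> ball 0 1" "\<i> / 2"] open_half_planes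
      by (auto simp: norm_divide open_Int)
  qed
  then show ?thesis using v(2) that by blast
qed

end

section \<open>Simultaneous conjugation into the integral special linear group\<close>

definition conj2 :: "complex^2^2 \<Rightarrow> complex^2^2 \<Rightarrow> complex^2^2" where
  "conj2 P M = inv2 P ** M ** P"

definition cols2 :: "complex^2 \<Rightarrow> complex^2 \<Rightarrow> complex^2^2" where
  "cols2 v w = vector [vector [v $ 1, w $ 1], vector [v $ 2, w $ 2]]"

lemma cols2_nth [simp]: "cols2 v w $ i $ 1 = v $ i" "cols2 v w $ i $ 2 = w $ i"
  using exhaust_2[of i] by (auto simp: cols2_def)

lemma det_cols2: "det (cols2 v w) = v $ 1 * w $ 2 - w $ 1 * v $ 2"
  by (simp add: det_2)

lemma det_conj2: "det P \<noteq> 0 \<Longrightarrow> det (conj2 P M) = det M"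
  by (simp add: conj2_def det_mul det_inv2)

lemma trace_conj2: "det P \<noteq> 0 \<Longrightarrow> trace (conj2 P M) = trace M"
  unfolding conj2_def trace_mul_sym[of "inv2 P ** M"] by (simp add: matrix_mul_assoc inv2_right)

lemma conj2_mult: "det P \<noteq> 0 \<Longrightarrow> conj2 P (M ** N) = conj2 P M ** conj2 P N"
proof -
  assume P: "det P \<noteq> 0"
  have "conj2 P M ** conj2 P N = inv2 P ** M ** (P ** inv2 P) ** N ** P"
    by (simp only: conj2_def matrix_mul_assoc)
  then show ?thesis by (simp add: inv2_right[OF P] conj2_def matrix_mul_assoc)
qed

lemma conj2_inv2:
  assumes "det P \<noteq> 0" "det M \<noteq> 0"
  shows "conj2 P (inv2 M) = inv2 (conj2 P M)"
proof (rule inv2_unique(1))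
  show "conj2 P M ** conj2 P (inv2 M) = mat 1"
    using assms by (simp add: conj2_mult[symmetric] inv2_right) (simp add: conj2_def inv2_left)
qed

lemma conj2_cols2_nth:
  assumes "det (cols2 v w) \<noteq> 0"
  shows "M *v v = a *s v + c *s w \<Longrightarrow> conj2 (cols2 v w) M $ 1 $ 1 = a \<and> conj2 (cols2 v w) M $ 2 $ 1 = c"
    and "M *v w = b *s v + d *s w \<Longrightarrow> conj2 (cols2 v w) M $ 1 $ 2 = b \<and> conj2 (cols2 v w) M $ 2 $ 2 = d"
proof -
  let ?P = "cols2 v w"
  have P: "?P *v x = x $ 1 *s v + x $ 2 *s w" for x
    by (simp add: vec_eq_iff forall_2 matrix_vector_mult_def sum_2 mult.commute)
  have key: "conj2 ?P M *v x = y" if "M *v (?P *v x) = ?P *v y" for x y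
    using that inv2_left[OF assms] by (simp add: conj2_def flip: matrix_vector_mul_assoc) (simp add: matrix_vector_mul_assoc)
  have col: "(A *v vector [1, 0]) $ i = A $ i $ 1" "(A *v vector [0, 1]) $ i = A $ i $ 2" for A :: "complex^2^2" and i
    by (simp_all add: matrix_vector_mult_def sum_2)
  {
    assume "M *v v = a *s v + c *s w"
    then have "conj2 ?P M *v vector [1, 0] = vector [a, c]" by (intro key) (simp add: P)
    then show "conj2 ?P M $ 1 $ 1 = a \<and> conj2 ?P M $ 2 $ 1 = c" by (metis col(1) vector_2)
  }
  {
    assume "M *v w = b *s v + d *s w"
    then have "conj2 ?P M *v vector [0, 1] = vector [b, d]" by (intro key) (simp add: P)
    then show "conj2 ?P M $ 1 $ 2 = b \<and> conj2 ?P M $ 2 $ 2 = d" by (metis col(2) vector_2)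
  }
qed

lemma cols2_expand:
  assumes "det (cols2 v w) \<noteq> 0"
  obtains a b where "x = a *s v + b *s w"
proof (rule that[of "(x $ 1 * w $ 2 - x $ 2 * w $ 1) / det (cols2 v w)" "(v $ 1 * x $ 2 - v $ 2 * x $ 1) / det (cols2 v w)"])
  show "x = ((x $ 1 * w $ 2 - x $ 2 * w $ 1) / det (cols2 v w)) *s v + ((v $ 1 * x $ 2 - v $ 2 * x $ 1) / det (cols2 v w)) *s w"
    using assms unfolding vec_eq_iff forall_2
    by (simp add: add_divide_distrib[symmetric] eq_divide_eq) (simp add: det_cols2 algebra_simps)
qed

text \<open>In the basis (v, w) the matrix is upper triangular with diagonal (1, d), and the
  determinant gives d = 1.\<close>

lemma unipotent_image:
  assumes "det (cols2 v w) \<noteq> 0" "det M = 1" "M *v v = v"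
  obtains a where "M *v w = w + a *s v"
proof -
  obtain a d where ad: "M *v w = a *s v + d *s w" using cols2_expand[OF assms(1)] .
  have "M *v v = 1 *s v + 0 *s w" using assms(3) by simp
  from conj2_cols2_nth(1)[OF assms(1) this] conj2_cols2_nth(2)[OF assms(1) ad]
  have "det (conj2 (cols2 v w) M) = d" by (simp add: det_2)
  then have "d = 1" using det_conj2[OF assms(1), of M] assms(2) by simp
  then show ?thesis using that[of a] ad by (simp add: add.commute)
qed

lemma unipotent_image':
  assumes "det (cols2 v w) \<noteq> 0" "det M = 1" "M *v w = w"
  obtains b where "M *v v = v + b *s w"
proof -
  have "det (cols2 w v) \<noteq> 0" using assms(1) by (simp add: det_cols2 mult.commute)
  then show ?thesis using unipotent_image[of w v M] assms that by blast
qed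

lemma det_cols2_scale: "det (cols2 v (s *s w)) = s * det (cols2 v w)"
  by (simp add: det_cols2 algebra_simps)

lemma SL2Z_conj2I:
  assumes "det P \<noteq> 0" "det M = 1" "\<And>i j. conj2 P M $ i $ j \<in> \<int>"
  shows "conj2 P M \<in> SL2Z"
  using assms by (simp add: SL2Z_def det_conj2)

text \<open>Replacing w by s w multiplies both off-diagonal entries by s, so only their ratio can
  obstruct integrality.\<close>

lemma conjugate_common_fixed_vector:
  assumes "det (cols2 v w) \<noteq> 0" "det M = 1" "det N = 1" "M *v v = v" "N *v v = v"
    and "M *v w = w + a *s v" "N *v w = w + b *s v"
    and s: "s \<noteq> 0" "s * a \<in> \<int>" "s * b \<in> \<int>"
  obtains P where "det P \<noteq> 0" "conj2 P M \<in> SL2Z" "conj2 P N \<in> SL2Z"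
proof -
  let ?P = "cols2 v (s *s w)"
  have P: "det ?P \<noteq> 0" using assms(1) s(1) by (simp add: det_cols2_scale)
  have "conj2 ?P A \<in> SL2Z" if "det A = 1" "A *v v = v" "A *v w = w + c *s v" "s * c \<in> \<int>" for A c
  proof (rule SL2Z_conj2I[OF P that(1)])
    have 1: "A *v v = 1 *s v + 0 *s (s *s w)" using that by simp
    have 2: "A *v (s *s w) = (s * c) *s v + 1 *s (s *s w)"
      using that by (simp add: matrix_vector_mult_scaleR vector_scalar_commute algebra_simps vector_add_ldistrib vector_smult_assoc)
    show "conj2 ?P A $ i $ j \<in> \<int>" for i j
      using conj2_cols2_nth(1)[OF P 1] conj2_cols2_nth(2)[OF P 2] exhaust_2[of i] exhaust_2[of j] that(4) by auto
  qed
  then show ?thesis using that[OF P] assms by blast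
qed

text \<open>In the basis (v, w) the matrices are upper and lower unitriangular with entries a and b,
  and the trace of N^-1 M is 2 - a b. Scaling w by s replaces (a, b) by (s a, b / s), so an integral
  product is enough.\<close>

lemma conjugate_independent_fixed_vectors:
  assumes vw: "det (cols2 v w) \<noteq> 0" and det: "det M = 1" "det N = 1" and fixed: "M *v v = v" "N *v w = w"
    and tr: "trace (inv2 N ** M) \<in> \<int>"
  obtains P where "det P \<noteq> 0" "conj2 P M \<in> SL2Z" "conj2 P N \<in> SL2Z"
proof -
  obtain a where a: "M *v w = w + a *s v" using unipotent_image[OF vw det(1) fixed(1)] .
  obtain b where b: "N *v v = v + b *s w" using unipotent_image'[OF vw det(2) fixed(2)] .
  have "a * b \<in> \<int>"
  proof -
    let ?P = "cols2 v w"
    have "M *v v = 1 *s v + 0 *s w" "M *v w = a *s v + 1 *s w"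
      "N *v v = 1 *s v + b *s w" "N *v w = 0 *s v + 1 *s w" using fixed a b by simp_all
    note nth = conj2_cols2_nth(1)[OF vw this(1)] conj2_cols2_nth(2)[OF vw this(2)]
      conj2_cols2_nth(1)[OF vw this(3)] conj2_cols2_nth(2)[OF vw this(4)]
    have "trace (inv2 N ** M) = trace (inv2 (conj2 ?P N) ** conj2 ?P M)"
      using det trace_conj2[OF vw, of "inv2 N ** M"] by (simp add: conj2_mult[OF vw] conj2_inv2[OF vw])
    also have "\<dots> = 2 - a * b"
      using nth det_conj2[OF vw, of N] det(2) by (simp add: trace_def sum_2 mult2_nth inv2_def algebra_simps)
    finally show ?thesis using tr Ints_diff[of 2 "2 - a * b"] by simp
  qed
  \<comment> \<open>Turns (a, b) into (1, a b), or into (0, 1) if only a vanishes, and leaves (0, 0)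
    alone.\<close>
  define s where "s = (if a \<noteq> 0 then 1 / a else if b \<noteq> 0 then b else 1)"
  have s: "s \<noteq> 0" "s * a \<in> \<int>" "b / s \<in> \<int>" using \<open>a * b \<in> \<int>\<close> by (auto simp: s_def mult.commute)
  let ?P = "cols2 v (s *s w)"
  have P: "det ?P \<noteq> 0" using vw s(1) by (simp add: det_cols2_scale)
  have M: "M *v v = 1 *s v + 0 *s (s *s w)" "M *v (s *s w) = (s * a) *s v + 1 *s (s *s w)"
    using fixed a by (simp_all add: vector_scalar_commute algebra_simps vector_add_ldistrib vector_smult_assoc)
  have N: "N *v v = 1 *s v + (b / s) *s (s *s w)" "N *v (s *s w) = 0 *s v + 1 *s (s *s w)"
    using fixed b s(1) by (simp_all add: vector_scalar_commute vector_smult_assoc)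
  have "conj2 ?P M \<in> SL2Z"
  proof (rule SL2Z_conj2I[OF P det(1)])
    show "conj2 ?P M $ i $ j \<in> \<int>" for i j
      using conj2_cols2_nth(1)[OF P M(1)] conj2_cols2_nth(2)[OF P M(2)] exhaust_2[of i] exhaust_2[of j] s by auto
  qed
  moreover have "conj2 ?P N \<in> SL2Z"
  proof (rule SL2Z_conj2I[OF P det(2)])
    show "conj2 ?P N $ i $ j \<in> \<int>" for i j
      using conj2_cols2_nth(1)[OF P N(1)] conj2_cols2_nth(2)[OF P N(2)] exhaust_2[of i] exhaust_2[of j] s by auto
  qed
  ultimately show ?thesis using that P by blast
qed

lemma eigenvalue_quadratic:
  fixes T :: "complex^2^2"
  assumes "T *v x = \<mu> *s x" "x \<noteq> 0"
  shows "\<mu>\<^sup>2 - trace T * \<mu> + det T = 0"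
proof -
  have 1: "T $ 1 $ 1 * x $ 1 + T $ 1 $ 2 * x $ 2 = \<mu> * x $ 1" and 2: "T $ 2 $ 1 * x $ 1 + T $ 2 $ 2 * x $ 2 = \<mu> * x $ 2"
    using assms(1) by (auto simp: vec_eq_iff forall_2 matrix_vector_mult_def sum_2)
  have "x $ 1 \<noteq> 0 \<or> x $ 2 \<noteq> 0" using assms(2) by (simp add: vec_eq_iff forall_2)
  moreover have "(\<mu>\<^sup>2 - trace T * \<mu> + det T) * x $ 1 = 0" "(\<mu>\<^sup>2 - trace T * \<mu> + det T) * x $ 2 = 0"
    unfolding trace_def sum_2 det_2 using 1 2 by algebra+
  ultimately show ?thesis by auto
qed

lemma dependent_imp_scale:
  assumes "det (cols2 v w) = 0" "v \<noteq> 0" "w \<noteq> 0"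
  obtains k where "k \<noteq> 0" "w = k *s v"
proof -
  have d: "v $ 1 * w $ 2 = w $ 1 * v $ 2" using assms(1) by (simp add: det_cols2)
  define k where "k = (if v $ 1 \<noteq> 0 then w $ 1 / v $ 1 else w $ 2 / v $ 2)"
  have "v $ 1 \<noteq> 0 \<or> v $ 2 \<noteq> 0" using assms(2) by (simp add: vec_eq_iff forall_2)
  then have "w = k *s v" using d by (auto simp: vec_eq_iff forall_2 k_def field_simps)
  then show ?thesis using that[of k] assms(3) by auto
qed

lemma two_fixed_vectors_imp_identity:
  assumes "det (cols2 v w) \<noteq> 0" "M *v v = v" "M *v w = w"
  shows "M = mat 1"
proof -
  have "M ** cols2 v w = cols2 v w"
    using assms(2,3) by (simp add: mat2_eq_iff mult2_nth vec_eq_iff forall_2 matrix_vector_mult_def sum_2)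
  then have "M ** (cols2 v w ** inv2 (cols2 v w)) = cols2 v w ** inv2 (cols2 v w)"
    by (simp add: matrix_mul_assoc)
  then show ?thesis by (simp add: inv2_right[OF assms(1)])
qed

lemma ex_independent_vector:
  assumes "v \<noteq> (0 :: complex^2)"
  obtains w where "det (cols2 v w) \<noteq> 0"
proof -
  have "v $ 1 \<noteq> 0 \<or> v $ 2 \<noteq> 0" using assms by (simp add: vec_eq_iff forall_2)
  then show ?thesis
    using that[of "vector [0, 1]"] that[of "vector [1, 0]"] by (auto simp: det_cols2)
qed

section \<open>Laurent germs with rational coefficients\<close>

definition rat_fps :: "complex fps \<Rightarrow> bool" where
  "rat_fps F \<longleftrightarrow> range (fps_nth F) \<subseteq> \<rat>"

lemma rat_fpsD: "rat_fps F \<Longrightarrow> fps_nth F n \<in> \<rat>"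
  by (auto simp: rat_fps_def)

lemma rat_fps_intros:
  "c \<in> \<rat> \<Longrightarrow> rat_fps (fps_const c)" "rat_fps fps_X" "rat_fps 1" "rat_fps 0"
  "rat_fps F \<Longrightarrow> rat_fps G \<Longrightarrow> rat_fps (F + G)" "rat_fps F \<Longrightarrow> rat_fps G \<Longrightarrow> rat_fps (F - G)"
  "rat_fps F \<Longrightarrow> rat_fps G \<Longrightarrow> rat_fps (F * G)" "rat_fps F \<Longrightarrow> rat_fps (fps_shift n F)"
  by (auto simp: rat_fps_def fps_mult_nth image_subset_iff intro!: Rats_sum)

lemma rat_fps_power: "rat_fps F \<Longrightarrow> rat_fps (F ^ n)"
  by (induction n) (auto intro: rat_fps_intros)

lemma rat_fps_sum: "(\<And>x. x \<in> A \<Longrightarrow> rat_fps (F x)) \<Longrightarrow> rat_fps (\<Sum>x\<in>A. F x)"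
  by (induction A rule: infinite_finite_induct) (auto intro: rat_fps_intros)

lemma rat_fps_inverse:
  assumes F: "rat_fps F" and F0: "fps_nth F 0 \<noteq> 0"
  shows "rat_fps (inverse F)"
proof -
  have "fps_nth (inverse F) n \<in> \<rat>" for n
  proof (induction n rule: less_induct)
    case (less n)
    have "F * inverse F = 1" using F0 by (simp add: inverse_mult_eq_1')
    then have "fps_nth (F * inverse F) n = (if n = 0 then 1 else 0)" by simp
    then have "fps_nth F 0 * fps_nth (inverse F) n
        = (if n = 0 then 1 else 0) - (\<Sum>i=1..n. fps_nth F i * fps_nth (inverse F) (n - i))"
      by (simp add: fps_mult_nth sum.atLeast_Suc_atMost algebra_simps)
    also have "\<dots> \<in> \<rat>"
      by (intro Rats_diff Rats_sum Rats_mult rat_fpsD[OF F] less) auto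
    finally have "fps_nth F 0 * fps_nth (inverse F) n / fps_nth F 0 \<in> \<rat>"
      using rat_fpsD[OF F] by (intro Rats_divide)
    then show ?case using F0 by simp
  qed
  then show ?thesis by (auto simp: rat_fps_def)
qed

text \<open>A Laurent germ at 0, with k only a bound for the pole order, which makes products
  immediate. The equation is imposed on a punctured neighbourhood and leaves the value at 0
  free.\<close>

definition rat_laurent :: "(complex \<Rightarrow> complex) \<Rightarrow> bool" where
  "rat_laurent f \<longleftrightarrow> (\<exists>k H F. H has_fps_expansion F \<and> rat_fps F \<and> (\<forall>\<^sub>F w in at 0. f w = H w / w ^ k))"

lemma rat_laurent_fps:
  assumes "f has_fps_expansion F" "rat_fps F"
  shows "rat_laurent f"
  unfolding rat_laurent_def using assms by (intro exI[of _ 0] exI[of _ f] exI[of _ F]) simp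

lemma rat_laurent_mult:
  assumes "rat_laurent f" "rat_laurent g"
  shows "rat_laurent (\<lambda>w. f w * g w)"
proof -
  obtain k H F where 1: "H has_fps_expansion F" "rat_fps F" "\<forall>\<^sub>F w in at 0. f w = H w / w ^ k"
    using assms(1) unfolding rat_laurent_def by blast
  obtain l K G where 2: "K has_fps_expansion G" "rat_fps G" "\<forall>\<^sub>F w in at 0. g w = K w / w ^ l"
    using assms(2) unfolding rat_laurent_def by blast
  have "\<forall>\<^sub>F w in at 0. f w * g w = H w * K w / w ^ (k + l)"
    using 1(3) 2(3) by eventually_elim (simp add: power_add)
  then show ?thesis unfolding rat_laurent_def
    using has_fps_expansion_mult[OF 1(1) 2(1)] rat_fps_intros(7)[OF 1(2) 2(2)] by blast
qed

lemma rat_laurent_inverse: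
  assumes "rat_laurent f"
  shows "rat_laurent (\<lambda>w. inverse (f w))"
proof -
  obtain k H F where 1: "H has_fps_expansion F" "rat_fps F" "\<forall>\<^sub>F w in at 0. f w = H w / w ^ k"
    using assms unfolding rat_laurent_def by blast
  show ?thesis
  proof (cases "F = 0")
    \<comment> \<open>f vanishes near 0, and by the convention \<open>inverse 0 = 0\<close> so does
      its inverse.\<close>
    case True
    then have "\<forall>\<^sub>F w in at 0. H w = 0"
      using 1(1) by (auto simp: has_fps_expansion_0_iff eventually_at_filter elim: eventually_mono)
    then have "\<forall>\<^sub>F w in at 0. inverse (f w) = 0 / w ^ 0" using 1(3) by eventually_elim simp
    then show ?thesis unfolding rat_laurent_def using has_fps_expansion_0 rat_fps_intros(4) by blast
  next
    case False
    \<comment> \<open>Split off the zero of order m of H; what remains has nonzero constant term and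
      is inverted as a power series.\<close>
    define m where "m = subdegree F"
    define H1 where "H1 = (\<lambda>w. if w = 0 then fps_nth F m else H w / w ^ m)"
    have H1: "H1 has_fps_expansion fps_shift m F" unfolding H1_def
      by (rule has_fps_expansion_shift[OF 1(1)]) (auto simp: m_def)
    have nz: "fps_nth (fps_shift m F) 0 \<noteq> 0" using False by (simp add: m_def nth_subdegree_nonzero)
    have "(\<lambda>w. w ^ k * inverse (H1 w)) has_fps_expansion fps_X ^ k * inverse (fps_shift m F)"
      by (intro fps_expansion_intros H1 nz)
    moreover have "rat_fps (fps_X ^ k * inverse (fps_shift m F))"
      by (intro rat_fps_intros rat_fps_power rat_fps_inverse 1 nz)
    moreover have "\<forall>\<^sub>F w in at 0. inverse (f w) = (w ^ k * inverse (H1 w)) / w ^ m"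
      using 1(3) eventually_neq_at_within[of 0 0 UNIV]
      by eventually_elim (simp add: H1_def)
    ultimately show ?thesis unfolding rat_laurent_def by blast
  qed
qed

lemma rat_laurent_power: "rat_laurent f \<Longrightarrow> rat_laurent (\<lambda>w. f w ^ n)"
  by (induction n) (auto intro: rat_laurent_mult rat_laurent_fps[OF has_fps_expansion_1 rat_fps_intros(3)])

lemma rat_laurent_power_int: "rat_laurent f \<Longrightarrow> rat_laurent (\<lambda>w. f w powi n)"
  by (cases "n \<ge> 0") (auto simp: power_int_def intro: rat_laurent_power rat_laurent_inverse)

text \<open>The number \<open>r\<close> is the residue.\<close>
lemma rat_laurent_primitive:
  assumes "rat_laurent f"
  obtains r S where "r \<in> \<rat>" "\<forall>\<^sub>F w in at 0. (S has_field_derivative f w - r / w) (at w)"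
proof -
  have prim: "\<exists>r S. r \<in> \<rat> \<and> (\<forall>\<^sub>F w in at 0. (S has_field_derivative H w / w ^ k - r / w) (at w))"
    if "H has_fps_expansion F" "rat_fps F" for H F k
    using that
  proof (induction k arbitrary: H F)
    case 0
    obtain U where U: "open U" "0 \<in> U" "H holomorphic_on U"
      using has_fps_expansion_imp_holomorphic[OF 0(1)] by metis
    obtain e where e: "e > 0" "ball 0 e \<subseteq> U" using U openE by blast
    obtain S where "\<And>w. w \<in> ball 0 e \<Longrightarrow> (S has_field_derivative H w) (at w within ball 0 e)"
      using holomorphic_convex_primitive'[OF convex_ball open_ball holomorphic_on_subset[OF U(3) e(2)]] by blast
    then have S: "(S has_field_derivative H w) (at w)" if "w \<in> ball 0 e" for w
      using that at_within_open[OF that open_ball] by metis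
    have "\<forall>\<^sub>F w in at 0. w \<in> ball (0::complex) e"
      using e(1) by (intro eventually_at_in_open') auto
    then have "\<forall>\<^sub>F w in at 0. (S has_field_derivative H w / w ^ 0 - 0 / w) (at w)"
      by eventually_elim (use S in simp)
    then show ?case using Rats_0 by blast
  next
    case (Suc k)
    \<comment> \<open>Peel off the leading coefficient. The term c / w^(k+1) has the primitive -c /
      (k w^k), except for k = 0, where c is added to the residue.\<close>
    define c where "c = fps_nth F 0"
    define G where "G = F - fps_const c"
    define K where "K = (\<lambda>w. if w = 0 then fps_nth G 1 else (H w - c) / w ^ 1)"
    have c: "c \<in> \<rat>" using rat_fpsD[OF Suc.prems(2)] by (simp add: c_def)
    have "K has_fps_expansion fps_shift 1 G" if "G \<noteq> 0"
      unfolding K_def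
    proof (rule has_fps_expansion_shift)
      show "(\<lambda>w. H w - c) has_fps_expansion G" unfolding G_def
        by (intro fps_expansion_intros Suc.prems)
      show "1 \<le> subdegree G" using that by (intro subdegree_geI) (auto simp: G_def c_def)
    qed auto
    moreover have "K has_fps_expansion fps_shift 1 G" if "G = 0"
    proof -
      have "(\<lambda>w. H w - c) has_fps_expansion G" unfolding G_def
        by (intro fps_expansion_intros Suc.prems)
      then have "\<forall>\<^sub>F w in nhds 0. H w - c = 0" using that by (simp add: has_fps_expansion_0_iff)
      then have "\<forall>\<^sub>F w in nhds 0. K w = 0" by eventually_elim (simp add: K_def that)
      then show ?thesis using that by (simp add: has_fps_expansion_0_iff)
    qed
    ultimately have "K has_fps_expansion fps_shift 1 G" by blast
    moreover have "rat_fps (fps_shift 1 G)" unfolding G_def by (intro rat_fps_intros Suc.prems c)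
    ultimately obtain r S where rS: "r \<in> \<rat>" "\<forall>\<^sub>F w in at 0. (S has_field_derivative K w / w ^ k - r / w) (at w)"
      using Suc.IH by blast
    have split: "H w / w ^ Suc k = K w / w ^ k + c / w ^ Suc k" if "w \<noteq> 0" for w
      using that by (simp add: K_def diff_divide_distrib)
    have ne: "\<forall>\<^sub>F w in at 0. w \<noteq> (0::complex)" by (simp add: eventually_neq_at_within)
    show ?case
    proof (cases k)
      case 0
      have "\<forall>\<^sub>F w in at 0. (S has_field_derivative H w / w ^ Suc k - (r + c) / w) (at w)"
        using rS(2) ne
      proof eventually_elim
        case (elim w)
        then show ?case using split[OF elim(2)] 0 by (simp add: add_divide_distrib)
      qed
      then show ?thesis using rS(1) c Rats_add by blast
    next
      case (Suc j)
      have "\<forall>\<^sub>F w in at 0. ((\<lambda>w. S w - c / of_nat k * inverse w ^ k) has_field_derivative H w / w ^ Suc k - r / w) (at w)"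
        using rS(2) ne
      proof eventually_elim
        case (elim w)
        have "((\<lambda>w. inverse w ^ k) has_field_derivative of_nat k * (- (inverse w ^ Suc (Suc 0)) * inverse w ^ (k - Suc 0))) (at w)"
          using elim(2) by (auto intro!: derivative_eq_intros)
        also have "of_nat k * (- (inverse w ^ Suc (Suc 0)) * inverse w ^ (k - Suc 0)) = - (of_nat k / w ^ Suc k)"
          using Suc elim(2) by (simp add: field_simps)
        finally have der: "((\<lambda>w. S w - c / of_nat k * inverse w ^ k) has_field_derivative
            (K w / w ^ k - r / w) - c / of_nat k * - (of_nat k / w ^ Suc k)) (at w)"
          by (intro DERIV_diff DERIV_cmult elim)
        have eq: "(K w / w ^ k - r / w) - c / of_nat k * - (of_nat k / w ^ Suc k) = H w / w ^ Suc k - r / w"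
          unfolding split[OF elim(2)] using Suc by (simp del: power_Suc of_nat_Suc)
        show ?case using der unfolding eq .
      qed
      then show ?thesis using rS(1) by blast
    qed
  qed
  obtain k H F where 1: "H has_fps_expansion F" "rat_fps F" "\<forall>\<^sub>F w in at 0. f w = H w / w ^ k"
    using assms unfolding rat_laurent_def by blast
  obtain r S where rS: "r \<in> \<rat>" "\<forall>\<^sub>F w in at 0. (S has_field_derivative H w / w ^ k - r / w) (at w)"
    using prim[OF 1(1,2)] by blast
  have "\<forall>\<^sub>F w in at 0. (S has_field_derivative f w - r / w) (at w)"
    using rS(2) 1(3) by eventually_elim simp
  then show ?thesis using that rS(1) by blast
qed

lemma common_denominator:
  assumes "x \<in> \<rat>" "y \<in> (\<rat> :: complex set)"
  obtains d :: complex where "d \<noteq> 0" "d * x \<in> \<int>" "d * y \<in> \<int>"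
proof -
  obtain a b where ab: "b > 0" "x = of_int a / of_int b" using assms(1) Rats_cases' by metis
  obtain c d where cd: "d > 0" "y = of_int c / of_int d" using assms(2) Rats_cases' by metis
  have "of_int b * of_int d * x = of_int (a * d)" "of_int b * of_int d * y = of_int (b * c)"
    using ab cd by simp_all
  then show ?thesis using that[of "of_int b * of_int d"] ab cd by (metis Ints_of_int less_irrefl mult_eq_0_iff of_int_eq_0_iff)
qed

section \<open>The case of a common invariant line\<close>

lemma exp_2pi_i_eq_1_iff: "exp (2 * of_real pi * \<i> * c) = 1 \<longleftrightarrow> c \<in> \<int>"
proof
  assume "exp (2 * of_real pi * \<i> * c) = 1"
  then obtain n :: int where n: "Re (2 * of_real pi * \<i> * c) = 0" "Im (2 * of_real pi * \<i> * c) = of_int (2 * n) * pi"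
    unfolding exp_eq_1 by blast
  then have "c = of_int n" by (simp add: complex_eq_iff)
  then show "c \<in> \<int>" by simp
next
  assume "c \<in> \<int>"
  then obtain n where "c = of_int n" by (auto elim: Ints_cases)
  then show "exp (2 * of_real pi * \<i> * c) = 1"
    unfolding exp_eq_1 by (auto intro!: exI[of _ n])
qed

lemma exp_minus_2pi_i_eq_1_iff: "exp (- (2 * of_real pi * \<i> * c)) = 1 \<longleftrightarrow> c \<in> \<int>"
  using exp_2pi_i_eq_1_iff[of c] by (simp add: exp_minus)

text \<open>Expanding at a rational centre x keeps all Laurent coefficients rational, in particular
  the residue. The point z1 shows that the polynomial g is nonzero, so its zeros are isolated and a
  punctured disc around x avoids them.\<close>

lemma rational_residue_at:
  fixes c :: "nat \<Rightarrow> complex" and x :: real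
  assumes c: "range c \<subseteq> \<rat>" and x: "of_real x \<in> (\<rat> :: complex set)"
    and nz: "(\<Sum>n<N. c n * z1 ^ n) \<noteq> 0"
  defines "g \<equiv> \<lambda>z. \<Sum>n<N. c n * z ^ n"
  obtains r S e where "r \<in> \<rat>" "0 < e" "e \<le> 1" "\<And>z. z \<in> ball (of_real x) e - {of_real x} \<Longrightarrow> g z \<noteq> 0"
    "\<And>z. z \<in> ball (of_real x) e - {of_real x} \<Longrightarrow>
       (S has_field_derivative z powi i * (z - 1) powi j / (g z)\<^sup>2 - r / (z - of_real x)) (at z)"
proof -
  let ?x = "complex_of_real x"
  have X: "(\<lambda>w. ?x + w) has_fps_expansion fps_const ?x + fps_X" "rat_fps (fps_const ?x + fps_X)"
    using x by (auto intro!: fps_expansion_intros rat_fps_intros)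
  have g: "(\<lambda>w. g (?x + w)) has_fps_expansion (\<Sum>n<N. fps_const (c n) * (fps_const ?x + fps_X) ^ n)"
    unfolding g_def by (intro fps_expansion_intros X)
  have gr: "rat_fps (\<Sum>n<N. fps_const (c n) * (fps_const ?x + fps_X) ^ n)"
    using c by (intro rat_fps_sum rat_fps_intros(7) rat_fps_power X rat_fps_intros(1)) auto
  have x1: "rat_laurent (\<lambda>w. ?x + w - 1)"
    by (rule rat_laurent_fps[of _ "fps_const ?x + fps_X - 1"]) (intro fps_expansion_intros X rat_fps_intros(6,3))+
  have "rat_laurent (\<lambda>w. (?x + w) powi i * (?x + w - 1) powi j * inverse (g (?x + w) ^ 2))"
    by (intro rat_laurent_mult rat_laurent_power_int rat_laurent_inverse rat_laurent_power x1
        rat_laurent_fps[OF X] rat_laurent_fps[OF g gr])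
  then obtain r S where r: "r \<in> \<rat>" and S: "\<forall>\<^sub>F w in at 0.
      (S has_field_derivative (?x + w) powi i * (?x + w - 1) powi j * inverse (g (?x + w) ^ 2) - r / w) (at w)"
    by (rule rat_laurent_primitive)
  have "\<forall>\<^sub>F z in at ?x. g z \<noteq> 0 \<and> z \<in> UNIV"
    by (rule non_zero_neighbour_alt[of g UNIV ?x z1]) (use nz in \<open>auto simp: g_def intro!: holomorphic_intros\<close>)
  then obtain e1 where e1: "e1 > 0" "\<And>z. z \<noteq> ?x \<Longrightarrow> dist z ?x < e1 \<Longrightarrow> g z \<noteq> 0"
    unfolding eventually_at by auto
  obtain e2 where e2: "e2 > 0" "\<And>w. w \<noteq> 0 \<Longrightarrow> dist w 0 < e2 \<Longrightarrow>
      (S has_field_derivative (?x + w) powi i * (?x + w - 1) powi j * inverse (g (?x + w) ^ 2) - r / w) (at w)"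
    using S unfolding eventually_at by auto
  show ?thesis
  \<comment> \<open>The cap 1 ensures that the interval (0, 1) has points at distance e / 2 from
    either endpoint.\<close>
  proof (rule that[OF r, of "min 1 (min e1 e2)" "\<lambda>z. S (z - ?x)"])
    fix z assume z: "z \<in> ball ?x (min 1 (min e1 e2)) - {?x}"
    then show "g z \<noteq> 0" using e1(2)[of z] by (auto simp: dist_commute)
    have "(S has_field_derivative z powi i * (z - 1) powi j / (g z)\<^sup>2 - r / (z - ?x)) (at (z - ?x))"
      using e2(2)[of "z - ?x"] z by (simp add: dist_norm norm_minus_commute divide_inverse)
    moreover have "((\<lambda>z. z - ?x) has_field_derivative 1) (at z)" by (auto intro!: derivative_eq_intros)
    ultimately show "((\<lambda>z. S (z - ?x)) has_field_derivative z powi i * (z - 1) powi j / (g z)\<^sup>2 - r / (z - ?x)) (at z)"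
      using DERIV_chain2 by fastforce
  qed (use e1 e2 in auto)
qed

section \<open>Quotients of solutions and the invariant solution for integer exponents\<close>

context chart_system
begin

text \<open>With integer exponents the branches of the logarithm disappear, and the Wronskian
  becomes the same rational function in all charts.\<close>

lemma weight_integer_exponents:
  assumes "\<gamma> = of_int c" "\<gamma> - 1 - \<alpha> - \<beta> = of_int d" "z \<notin> {0, 1}"
  shows "inverse (weight I z) = z powi (- c) * (z - 1) powi d"
proof -
  have "weight I z = exp (log_branch 0 I z) powi c * exp (log_branch 1 I z) powi (- d)"
    unfolding weight_def assms(1)[symmetric] exp_power_int assms(2)
    by (simp add: assms(1) flip: exp_add)
  also have "\<dots> = z powi c * (z - 1) powi (- d)"
    using assms(3) exp_log_branch[of z 0 I] exp_log_branch[of z 1 I] by simp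
  finally show ?thesis by (simp add: power_int_minus)
qed

lemma lc_common:
  assumes "I \<in> charts" "J \<in> charts" "C I *v v = v" "C J *v v = v" "z \<in> cut_plane I" "z \<in> cut_plane J"
  shows "lc v (Y I z) = lc v (Y J z)"
proof -
  consider "Im z > 0" | "Im z < 0" | "Im z = 0" by linarith
  then show ?thesis
  proof cases
    case 1 then show ?thesis using Y_upper[OF assms(1,2)] by simp
  next
    case 2
    then show ?thesis using Y_lower[OF assms(1) 2] Y_lower[OF assms(2) 2] assms(3,4) by (simp add: lc_mult)
  next
    case 3 then show ?thesis using charts_disjoint assms by blast
  qed
qed

text \<open>Reduction of order: once one solution is known, a second one is obtained by integrating
  the Wronskian over its square.\<close>

lemma quotient_has_derivative:
  assumes I: "I \<in> charts" and z: "z \<in> cut_plane I" and nz: "lc v (Y I z) \<noteq> 0"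
  shows "((\<lambda>z. lc w (Y I z) / lc v (Y I z)) has_field_derivative
    wrv (Y I) z * det (cols2 v w) / (lc v (Y I z))\<^sup>2) (at z)"
proof -
  note d = sol_has_derivs(1)[OF open_chart[OF I] sol_lc[OF I] z]
  have "((\<lambda>z. lc w (Y I z) / lc v (Y I z)) has_field_derivative
      wr (\<lambda>z. lc v (Y I z)) (\<lambda>z. lc w (Y I z)) z / (lc v (Y I z))\<^sup>2) (at z)"
    using nz by (auto intro!: derivative_eq_intros d simp: wr_def power2_eq_square mult.commute)
  also have "wr (\<lambda>z. lc v (Y I z)) (\<lambda>z. lc w (Y I z)) z = wrv (\<lambda>z. Y I z v* cols2 v w) z"
    by (simp add: wrv_def lc_def vector_matrix_mult_def sum_2 mult.commute)
  also have "\<dots> = wrv (Y I) z * det (cols2 v w)"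
    by (rule wrv_mult[OF open_chart[OF I] z sol_Y[OF I]]) simp
  finally show ?thesis .
qed

text \<open>The quotient of two solutions is a primitive of \<open>\<kappa> R\<close>; its jump at the branch point \<open>x\<close> is
  read off the logarithmic term \<open>\<kappa> r log (z - x)\<close> of that primitive.\<close>
lemma jump_from_residue:
  fixes x :: real
  assumes I: "I \<in> charts" "I \<subseteq> {..<x} \<or> I \<subseteq> {x<..}" "C I *v v = v"
    and J: "J \<in> charts" "J \<subseteq> {..<x} \<or> J \<subseteq> {x<..}" "C J *v v = v"
    and B: "e > 0" "connected (cut_plane I \<inter> ball (of_real x) e)" "connected (cut_plane J \<inter> ball (of_real x) e)"
    and nz: "\<And>K z. K \<in> {I, J} \<Longrightarrow> z \<in> cut_plane K \<inter> ball (of_real x) e \<Longrightarrow> lc v (Y K z) \<noteq> 0"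
    and R: "\<And>K z. K \<in> {I, J} \<Longrightarrow> z \<in> cut_plane K \<inter> ball (of_real x) e \<Longrightarrow>
      ((\<lambda>z. lc w (Y K z) / lc v (Y K z)) has_field_derivative \<kappa> * R z) (at z)"
    and S: "\<And>z. z \<in> ball (of_real x) e - {of_real x} \<Longrightarrow> (S has_field_derivative R z - r / (z - of_real x)) (at z)"
  shows "C I *v w = C J *v w + (\<kappa> * r * (if I \<subseteq> {x<..} then 0 else 2 * of_real pi * \<i>)
    - \<kappa> * r * (if J \<subseteq> {x<..} then 0 else 2 * of_real pi * \<i>)) *s v"
proof -
  let ?B = "ball (complex_of_real x) e"
  \<comment> \<open>Subtracting the logarithmic term and the single-valued part leaves a constant on
    each chart. The constants agree by comparison above the axis, so below it the quotients differ
    exactly as the logarithmic terms do.\<close>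
  define \<psi> where "\<psi> K z = lc w (Y K z) / lc v (Y K z) - \<kappa> * r * log_branch x K z - \<kappa> * S z" for K z
  have const: "\<exists>c. \<forall>z\<in>cut_plane K \<inter> ?B. \<psi> K z = c"
    if K: "K \<in> {I, J}" "K \<in> charts" "K \<subseteq> {..<x} \<or> K \<subseteq> {x<..}" "connected (cut_plane K \<inter> ?B)" for K
  proof -
    have "(\<psi> K has_field_derivative 0) (at z)" if z: "z \<in> cut_plane K \<inter> ?B" for z
    proof -
      have "z \<noteq> of_real x" using z K(3) by (auto simp: cut_plane_def)
      then have "(\<psi> K has_field_derivative \<kappa> * R z - \<kappa> * r * (1 / (z - of_real x)) - \<kappa> * (R z - r / (z - of_real x))) (at z)"
        unfolding \<psi>_def[abs_def] using z
        by (intro DERIV_diff DERIV_cmult R[OF K(1)] S log_branch_has_derivative[OF K(3)]) auto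
      then show ?thesis by (simp add: algebra_simps)
    qed
    then show ?thesis
      using has_field_derivative_0_imp_constant_on[of "cut_plane K \<inter> ?B" "\<psi> K"] K(4) open_chart[OF K(2)]
      unfolding constant_on_def by blast
  qed
  obtain cI where cI: "\<And>z. z \<in> cut_plane I \<inter> ?B \<Longrightarrow> \<psi> I z = cI" using const[of I] I B by blast
  obtain cJ where cJ: "\<And>z. z \<in> cut_plane J \<inter> ?B \<Longrightarrow> \<psi> J z = cJ" using const[of J] J B by blast
  define w1 where "w1 = of_real x + \<i> * of_real (e / 2)"
  define w2 where "w2 = of_real x - \<i> * of_real (e / 2)"
  have w: "w1 \<in> ?B" "Im w1 > 0" "w2 \<in> ?B" "Im w2 < 0"
    using B(1) by (auto simp: w1_def w2_def dist_norm norm_mult norm_divide)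
  have "\<psi> I w1 = \<psi> J w1"
    using w(2) by (simp add: \<psi>_def Y_upper[OF I(1) J(1)] log_branch_upper)
  then have c: "cI = cJ" using cI[of w1] cJ[of w1] w by (simp add: cut_plane_def)
  let ?\<Delta> = "\<kappa> * r * (if I \<subseteq> {x<..} then 0 else 2 * of_real pi * \<i>)
    - \<kappa> * r * (if J \<subseteq> {x<..} then 0 else 2 * of_real pi * \<i>)"
  show ?thesis
  proof (rule lc_eq_imp[OF charts_mem(2), of "{z. Im z < 0} \<inter> ?B" w2])
    fix z assume z: "z \<in> {z. Im z < 0} \<inter> ?B"
    then have low: "Im z < 0" and zI: "z \<in> cut_plane I \<inter> ?B" and zJ: "z \<in> cut_plane J \<inter> ?B"
      by (auto simp: cut_plane_def)
    have "\<psi> I z = \<psi> J z" using cI[OF zI] cJ[OF zJ] c by simp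
    then have "lc w (Y I z) / lc v (Y I z) = lc w (Y J z) / lc v (Y J z) + ?\<Delta>"
      by (simp add: \<psi>_def log_branch_lower[OF low] algebra_simps)
    moreover have v: "lc v (Y I z) = lc v (Y {0<..<1} z)" "lc v (Y J z) = lc v (Y {0<..<1} z)"
      using I(3) J(3) by (simp_all add: Y_lower[OF I(1) low] Y_lower[OF J(1) low] lc_mult)
    moreover have "lc v (Y {0<..<1} z) \<noteq> 0" using nz[of I z] zI v by simp
    ultimately have "lc w (Y I z) = lc w (Y J z) + ?\<Delta> * lc v (Y {0<..<1} z)" by (simp add: field_simps)
    then show "lc (C I *v w) (Y {0<..<1} z) = lc (C J *v w + ?\<Delta> *s v) (Y {0<..<1} z)"
      by (simp only: Y_lower[OF I(1) low] Y_lower[OF J(1) low] lc_mult lc_add lc_scale)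
  qed (use w open_half_planes half_planes_subset_chart in auto)
qed

text \<open>A nontrivial \<open>CL\<close> or \<open>CR\<close> has only one fixed line, so the
  invariant solution is proportional both to the series at 0 and to the one at 1. It therefore
  extends to an entire function, and a hypergeometric series of infinite radius terminates. The
  factor k rescales v to the series with rational coefficients.\<close>

lemma invariant_solution_polynomial:
  assumes int: "\<alpha> \<in> \<int>" "\<beta> \<in> \<int>" "\<gamma> \<in> \<int>"
    and ne: "CL \<noteq> mat 1" "CR \<noteq> mat 1"
    and v: "v \<noteq> 0" "CL *v v = v" "CR *v v = v"
  obtains k N and c :: "nat \<Rightarrow> complex" where "k \<noteq> 0" "range c \<subseteq> \<rat>"
    "\<And>I z. I \<in> charts \<Longrightarrow> z \<in> cut_plane I \<Longrightarrow> lc (k *s v) (Y I z) = (\<Sum>n<N. c n * z ^ n)"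
proof -
  obtain F where F: "F \<noteq> 0" "1 \<le> fps_conv_radius F" "sol (ball 0 1 - {0}) (eval_fps F)"
    "\<alpha> \<in> \<int> \<Longrightarrow> \<beta> \<in> \<int> \<Longrightarrow> \<gamma> \<in> \<int> \<Longrightarrow> range (fps_nth F) \<subseteq> \<rat>"
    "fps_conv_radius F = \<infinity> \<Longrightarrow> \<forall>\<^sub>F n in sequentially. fps_nth F n = 0"
    by (rule series_solution_at_0) blast
  obtain v0 where v0: "v0 \<noteq> 0" "CL *v v0 = v0"
    "\<And>I z. I \<in> {{..<0}, {0<..<1}} \<Longrightarrow> z \<in> cut_plane I \<inter> ball 0 1 \<Longrightarrow> eval_fps F z = lc v0 (Y I z)"
    by (rule eigenvector_at_0[OF F(1-3)]) blast
  obtain v1 F1 where v1: "v1 \<noteq> 0" "CR *v v1 = v1" "1 \<le> fps_conv_radius F1"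
    "\<And>I z. I \<in> {{1<..}, {0<..<1}} \<Longrightarrow> z \<in> cut_plane I \<inter> ball 1 1 \<Longrightarrow> eval_fps F1 (1 - z) = lc v1 (Y I z)"
    by (rule eigenvector_at_1) blast
  have "det (cols2 v v0) = 0" using two_fixed_vectors_imp_identity[OF _ v(2) v0(2)] ne(1) by blast
  then obtain k where k: "k \<noteq> 0" "v0 = k *s v" using dependent_imp_scale v(1) v0(1) by blast
  have "det (cols2 v v1) = 0" using two_fixed_vectors_imp_identity[OF _ v(3) v1(2)] ne(2) by blast
  then obtain l where l: "l \<noteq> 0" "v1 = l *s v" using dependent_imp_scale v(1) v1(1) by blast
  have Cv: "C I *v v0 = v0" if "I \<in> charts" for I
    using that v(2,3) v0(2) unfolding k(2) by (auto elim!: chartsE simp: C_mid vector_scalar_commute)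
  define ch where "ch z = (SOME I. I \<in> charts \<and> z \<in> cut_plane I)" for z
  have ch: "ch z \<in> charts" "z \<in> cut_plane (ch z)" if "z \<notin> {0, 1}" for z
    using someI_ex[of "\<lambda>I. I \<in> charts \<and> z \<in> cut_plane I"] charts_cover[OF that] unfolding ch_def by blast+
  \<comment> \<open>The two series supply the values at 0 and 1, where no chart reaches; k / l
    occurs because v0 = k v and v1 = l v.\<close>
  define g where "g z = (if z = 0 then eval_fps F 0 else if z = 1 then k / l * eval_fps F1 0 else lc v0 (Y (ch z) z))" for z
  have g_chart: "g z = lc v0 (Y I z)" if I: "I \<in> charts" and z: "z \<in> cut_plane I" for I z
  proof -
    have z01: "z \<notin> {0, 1}" using chart_subset[OF I] z by auto
    then have "g z = lc v0 (Y (ch z) z)" by (simp add: g_def)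
    also have "\<dots> = lc v0 (Y I z)" using lc_common[OF ch(1)[OF z01] I Cv[OF ch(1)[OF z01]] Cv[OF I] ch(2)[OF z01] z] .
    finally show ?thesis .
  qed
  have g_0: "g z = eval_fps F z" if z: "z \<in> ball 0 1" for z
  proof (cases "z = 0")
    case False
    have "z \<in> cut_plane {..<0} \<or> z \<in> cut_plane {0<..<1}"
    proof (cases "Im z = 0")
      case True
      then have "Re z \<noteq> 0" using False by (simp add: complex_eq_iff)
      moreover have "\<bar>Re z\<bar> < 1" using z abs_Re_le_cmod[of z] by simp
      ultimately show ?thesis by (auto simp: cut_plane_def)
    qed (simp add: cut_plane_def)
    then obtain I where I: "I \<in> {{..<0}, {0<..<1}}" "z \<in> cut_plane I" by blast
    then show ?thesis using v0(3)[OF I(1), of z] g_chart[of I z] z by auto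
  qed (simp add: g_def)
  have g_1: "g z = k / l * eval_fps F1 (1 - z)" if z: "z \<in> ball 1 1" for z
  proof (cases "z = 1")
    case False
    have "z \<in> cut_plane {1<..} \<or> z \<in> cut_plane {0<..<1}"
    proof (cases "Im z = 0")
      case True
      then have "Re z \<noteq> 1" using False by (simp add: complex_eq_iff)
      moreover have "\<bar>1 - Re z\<bar> < 1" using z abs_Re_le_cmod[of "1 - z"] by (simp add: dist_norm)
      ultimately show ?thesis by (auto simp: cut_plane_def)
    qed (simp add: cut_plane_def)
    then obtain I where I: "I \<in> {{1<..}, {0<..<1}}" "z \<in> cut_plane I" by blast
    then have "g z = lc v0 (Y I z)" using g_chart[of I z] by auto
    also have "\<dots> = k / l * lc v1 (Y I z)" using l(1) by (simp add: k(2) l(2) lc_scale)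
    also have "lc v1 (Y I z) = eval_fps F1 (1 - z)" using v1(4)[OF I(1), of z] I(2) z by simp
    finally show ?thesis .
  qed (simp add: g_def)
  have "g holomorphic_on UNIV"
  proof (rule holomorphic_on_subset)
    have "g holomorphic_on (ball 0 1 \<union> ball 1 1) \<union> (\<Union>I\<in>charts. cut_plane I)"
    proof (intro holomorphic_on_Un holomorphic_on_UN_open open_Un open_UN ballI)
      have "eval_fps F holomorphic_on ball 0 1"
        by (intro holomorphic_on_eval_fps unit_ball_subset_eball F(2))
      then show "g holomorphic_on ball 0 1" by (rule holomorphic_transform) (simp add: g_0)
      have "(eval_fps F1 \<circ> (\<lambda>z. 1 - z)) holomorphic_on ball 1 1"
      proof (rule holomorphic_on_compose_gen[where t = "ball 0 1"])
        show "eval_fps F1 holomorphic_on ball 0 1"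
          by (intro holomorphic_on_eval_fps unit_ball_subset_eball v1(3))
      qed (auto intro!: holomorphic_intros simp: dist_norm norm_minus_commute)
      then have "(\<lambda>z. k / l * eval_fps F1 (1 - z)) holomorphic_on ball 1 1"
        by (intro holomorphic_intros) (simp add: o_def)
      then show "g holomorphic_on ball 1 1" by (rule holomorphic_transform) (simp add: g_1)
      fix I assume I: "I \<in> charts"
      show "open (cut_plane I)" by (rule open_chart[OF I])
      show "g holomorphic_on cut_plane I"
        by (rule holomorphic_transform[OF sol_holomorphic[OF sol_lc[OF I, of v0]]]) (simp add: g_chart[OF I])
    qed (auto simp: open_chart)
    then show "g holomorphic_on (ball 0 1 \<union> ball 1 1) \<union> (\<Union>I\<in>charts. cut_plane I)" .
    show "UNIV \<subseteq> (ball 0 1 \<union> ball 1 1) \<union> (\<Union>I\<in>charts. cut_plane I)"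
    proof
      fix z :: complex
      show "z \<in> (ball 0 1 \<union> ball 1 1) \<union> (\<Union>I\<in>charts. cut_plane I)"
        using charts_cover[of z] by (cases "z \<in> {0, 1}") auto
    qed
  qed
  have "g has_fps_expansion F"
  proof -
    have "\<forall>\<^sub>F z in nhds (0::complex). z \<in> ball 0 1" by (intro eventually_nhds_in_open) auto
    then have "\<forall>\<^sub>F z in nhds 0. eval_fps F z = g z" by eventually_elim (simp add: g_0)
    moreover have "0 < fps_conv_radius F" using F(2) by (auto intro: less_le_trans[of 0 1])
    ultimately show ?thesis by (simp add: has_fps_expansion_def)
  qed
  then have "fps_expansion g 0 = F" by (rule fps_expansion_eqI)
  moreover have "fps_conv_radius (fps_expansion g 0) \<ge> \<infinity>"
    using \<open>g holomorphic_on UNIV\<close> by (intro conv_radius_fps_expansion) (auto intro: holomorphic_on_subset)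
  ultimately have R: "fps_conv_radius F = \<infinity>" by simp
  then obtain N where N: "\<And>n. n \<ge> N \<Longrightarrow> fps_nth F n = 0" using F(5) unfolding eventually_sequentially by blast
  have eval: "eval_fps F z = (\<Sum>n<N. fps_nth F n * z ^ n)" for z
    unfolding eval_fps_def by (rule suminf_finite) (auto simp: N not_less)
  have "g z = (\<Sum>n<N. fps_nth F n * z ^ n)" for z
  proof (rule analytic_continuation_open[of "ball 0 1" UNIV g "\<lambda>z. \<Sum>n<N. fps_nth F n * z ^ n" z])
    show "(\<lambda>z. \<Sum>n<N. fps_nth F n * z ^ n) holomorphic_on UNIV" by (intro holomorphic_intros)
  qed (use \<open>g holomorphic_on UNIV\<close> in \<open>auto simp: g_0 eval\<close>)
  then show ?thesis
    by (intro that[of k "fps_nth F" N]) (use k F(4)[OF int] g_chart in auto)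
qed

text \<open>Both jumps come from the single function z^(-\<gamma>) (z - 1)^(\<gamma> - 1 - \<alpha>
  - \<beta>) / g^2, whose residues at 0 and 1 are rational; the possibly irrational factors are
  shared and are collected in \<kappa>.\<close>

lemma rational_jumps:
  assumes int: "\<alpha> \<in> \<int>" "\<beta> \<in> \<int>" "\<gamma> \<in> \<int>"
    and ne: "CL \<noteq> mat 1" "CR \<noteq> mat 1"
    and v: "v \<noteq> 0" "CL *v v = v" "CR *v v = v" and vw: "det (cols2 v w) \<noteq> 0"
  obtains \<kappa> r s where "\<kappa> \<noteq> 0" "r \<in> \<rat>" "s \<in> \<rat>" "CL *v w = w + (\<kappa> * r) *s v" "CR *v w = w + (\<kappa> * s) *s v"
proof -
  obtain k N and c :: "nat \<Rightarrow> complex" where k: "k \<noteq> 0" and c: "range c \<subseteq> \<rat>"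
    and g: "\<And>I z. I \<in> charts \<Longrightarrow> z \<in> cut_plane I \<Longrightarrow> lc (k *s v) (Y I z) = (\<Sum>n<N. c n * z ^ n)"
    by (rule invariant_solution_polynomial[OF int ne v]) blast
  define v0 where "v0 = k *s v"
  have Cv: "C I *v v0 = v0" if "I \<in> charts" for I
    using that v(2,3) unfolding v0_def by (auto elim!: chartsE simp: C_mid vector_scalar_commute)
  have v0w: "det (cols2 v0 w) = k * det (cols2 v w)" by (simp add: v0_def det_cols2 algebra_simps)
  obtain i where i: "\<gamma> = of_int i" using int(3) by (auto elim: Ints_cases)
  have "\<gamma> - 1 - \<alpha> - \<beta> \<in> \<int>" using int by simp
  then obtain j where j: "\<gamma> - 1 - \<alpha> - \<beta> = of_int j" by (auto elim: Ints_cases)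
  obtain K where K: "K \<noteq> 0" "\<And>I z. I \<in> charts \<Longrightarrow> z \<in> cut_plane I \<Longrightarrow> wrv (Y I) z * weight I z = K"
    by (rule wrv_weight_constant) blast
  \<comment> \<open>The constant in front of the rational function: the normalisation K of the
    Wronskian times the determinant of the change of basis to (v0, w).\<close>
  define \<kappa> where "\<kappa> = K * det (cols2 v0 w)"
  have \<kappa>: "\<kappa> \<noteq> 0" using K(1) k vw by (simp add: \<kappa>_def v0w)
  let ?g = "\<lambda>z. \<Sum>n<N. c n * z ^ n"
  let ?R = "\<lambda>z. z powi (- i) * (z - 1) powi j / (?g z)\<^sup>2"
  have gv: "lc v0 (Y I z) = ?g z" if "I \<in> charts" "z \<in> cut_plane I" for I z
    using g[OF that] by (simp add: v0_def)
  have R: "((\<lambda>z. lc w (Y I z) / lc v0 (Y I z)) has_field_derivative \<kappa> * ?R z) (at z)"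
    if I: "I \<in> charts" "z \<in> cut_plane I" and nz: "?g z \<noteq> 0" for I z
  proof -
    have "wrv (Y I) z = K * inverse (weight I z)" using K(2)[OF I] by (simp add: field_simps)
    also have "\<dots> = K * (z powi (- i) * (z - 1) powi j)"
      using weight_integer_exponents[OF i j, of z I] chart_subset[OF I(1)] I(2) by auto
    finally have "wrv (Y I) z * det (cols2 v0 w) / (lc v0 (Y I z))\<^sup>2 = \<kappa> * ?R z"
      by (simp add: gv[OF I] \<kappa>_def)
    then show ?thesis using quotient_has_derivative[OF I, of v0 w] nz gv[OF I] by simp
  qed
  have "\<exists>z. ?g z \<noteq> 0"
  proof (rule ccontr)
    assume "\<not> (\<exists>z. ?g z \<noteq> 0)"
    then have "lc v0 (Y {0<..<1} z) = 0" if "z \<in> cut_plane {0<..<1}" for z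
      using gv[OF charts_mem(2) that] by simp
    then have "v0 = 0"
      using lc_zero_imp[OF charts_mem(2) open_chart[OF charts_mem(2)] subset_refl, of \<i> v0] by (simp add: cut_plane_def)
    then show False using k v(1) by (simp add: v0_def)
  qed
  then obtain z1 where z1: "?g z1 \<noteq> 0" by blast
  \<comment> \<open>One argument for both branch points: x is 0 or 1, \<open>I\<close> will be the
    outer chart beside it, and \<open>J\<close> is the middle chart, where \<open>C J\<close> is the
    identity.\<close>
  have jump: "\<exists>r\<in>\<rat>. C I *v w = w + (\<kappa> * r * (if I \<subseteq> {x<..} then 0 else 2 * of_real pi * \<i>)
        - \<kappa> * r * (if J \<subseteq> {x<..} then 0 else 2 * of_real pi * \<i>)) *s v0"
    if x: "x \<in> {0, 1}" and IJ: "I \<in> charts" "J = {0<..<1}"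
      and near: "\<And>L e. L \<in> {I, J} \<Longrightarrow> 0 < e \<Longrightarrow> e \<le> 1 \<Longrightarrow> \<exists>a\<in>L. \<bar>a - x\<bar> < e" for x :: real and I J
  proof -
    have "of_real x \<in> (\<rat> :: complex set)" using x by auto
    then obtain r S e where r: "r \<in> \<rat>" "0 < e" "e \<le> 1"
      and e: "\<And>z. z \<in> ball (of_real x) e - {of_real x} \<Longrightarrow> ?g z \<noteq> 0"
      and S: "\<And>z. z \<in> ball (of_real x) e - {of_real x} \<Longrightarrow>
       (S has_field_derivative z powi (- i) * (z - 1) powi j / (?g z)\<^sup>2 - r / (z - of_real x)) (at z)"
      by (rule rational_residue_at[OF c _ z1, where i = "- i" and j = j]) blast
    have L: "L \<in> charts" if "L \<in> {I, J}" for L using that IJ by auto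
    have side: "L \<subseteq> {..<x} \<or> L \<subseteq> {x<..}" if "L \<in> {I, J}" for L
      using charts_props(4,5)[OF L[OF that]] x by auto
    have conn: "connected (cut_plane L \<inter> ball (of_real x) e)" if L': "L \<in> {I, J}" for L
    proof -
      obtain a where "a \<in> L" "\<bar>a - x\<bar> < e" using near[OF L' r(2,3)] by blast
      moreover have "dist (of_real x) (complex_of_real a) = \<bar>a - x\<bar>"
        by (simp add: dist_of_real dist_real_def abs_minus_commute)
      ultimately show ?thesis
        by (intro connected_cut_plane_Int[OF charts_props(2)[OF L[OF L']], of a]) auto
    qed
    have pt: "z \<in> ball (of_real x) e - {of_real x}" if "L \<in> {I, J}" "z \<in> cut_plane L \<inter> ball (of_real x) e" for L z
      using that(2) side[OF that(1)] by (auto simp: cut_plane_def)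
    have IJm: "I \<in> {I, J}" "J \<in> {I, J}" by auto
    have "C I *v w = C J *v w + (\<kappa> * r * (if I \<subseteq> {x<..} then 0 else 2 * of_real pi * \<i>)
        - \<kappa> * r * (if J \<subseteq> {x<..} then 0 else 2 * of_real pi * \<i>)) *s v0"
    proof (rule jump_from_residue[where R = ?R and S = S and e = e])
      show "lc v0 (Y L z) \<noteq> 0" if "L \<in> {I, J}" "z \<in> cut_plane L \<inter> ball (of_real x) e" for L z
        using gv[OF L[OF that(1)], of z] e[OF pt[OF that]] that(2) by simp
      show "((\<lambda>z. lc w (Y L z) / lc v0 (Y L z)) has_field_derivative \<kappa> * ?R z) (at z)"
        if "L \<in> {I, J}" "z \<in> cut_plane L \<inter> ball (of_real x) e" for L z
        using R[OF L[OF that(1)], of z] e[OF pt[OF that]] that(2) by simp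
    qed (use L[OF IJm(1)] L[OF IJm(2)] side[OF IJm(1)] side[OF IJm(2)] conn[OF IJm(1)] conn[OF IJm(2)] Cv r(2) S in auto)
    then show ?thesis using r(1) IJ(2) by (auto simp: C_mid)
  qed
  obtain r where r: "r \<in> \<rat>" "CL *v w = w + (\<kappa> * r * (2 * of_real pi * \<i>)) *s v0"
  proof -
    have "\<exists>r\<in>\<rat>. CL *v w = w + (\<kappa> * r * (if {..<0::real} \<subseteq> {0<..} then 0 else 2 * of_real pi * \<i>)
        - \<kappa> * r * (if {0<..<1::real} \<subseteq> {0<..} then 0 else 2 * of_real pi * \<i>)) *s v0"
    proof (rule jump)
      fix L e assume "L \<in> {{..<0}, {0<..<1::real}}" "0 < e" "e \<le> (1::real)"
      then have "- e / 2 \<in> L \<or> e / 2 \<in> L" "\<bar>- e / 2 - 0\<bar> < e" "\<bar>e / 2 - 0\<bar> < e" by auto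
      then show "\<exists>a\<in>L. \<bar>a - 0\<bar> < e" by blast
    qed auto
    then show ?thesis using that by (auto simp: chart_position)
  qed
  obtain s where s: "s \<in> \<rat>" "CR *v w = w + (- (\<kappa> * s * (2 * of_real pi * \<i>))) *s v0"
  proof -
    have "\<exists>r\<in>\<rat>. CR *v w = w + (\<kappa> * r * (if {1::real<..} \<subseteq> {1<..} then 0 else 2 * of_real pi * \<i>)
        - \<kappa> * r * (if {0<..<1::real} \<subseteq> {1<..} then 0 else 2 * of_real pi * \<i>)) *s v0"
    proof (rule jump)
      fix L e assume "L \<in> {{1<..}, {0<..<1::real}}" "0 < e" "e \<le> (1::real)"
      then have "1 + e / 2 \<in> L \<or> 1 - e / 2 \<in> L" "\<bar>1 + e / 2 - 1\<bar> < e" "\<bar>1 - e / 2 - 1\<bar> < e" by auto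
      then show "\<exists>a\<in>L. \<bar>a - 1\<bar> < e" by blast
    qed auto
    then show ?thesis using that by (auto simp: chart_position)
  qed
  show ?thesis
  \<comment> \<open>The factor k returns from v0 to v. The sign of s reflects that at 1 it is the
    middle chart, lying to the left, whose logarithm carries the 2 pi i.\<close>
  proof (rule that[of "\<kappa> * (2 * of_real pi * \<i>) * k" r "- s"])
    show "\<kappa> * (2 * of_real pi * \<i>) * k \<noteq> 0" using \<kappa> k by simp
    show "CL *v w = w + (\<kappa> * (2 * of_real pi * \<i>) * k * r) *s v"
      using r(2) by (simp add: v0_def vector_smult_assoc mult_ac)
    show "CR *v w = w + (\<kappa> * (2 * of_real pi * \<i>) * k * - s) *s v"
      using s(2) by (simp add: v0_def vector_smult_assoc mult_ac)
  qed (use r(1) s(1) in auto)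
qed

section \<open>The monodromy criterion\<close>

text \<open>The matrix has determinant 1 and the eigenvalue exp (-2 pi i \<alpha>), so its trace is
  that number plus its inverse; integrality of \<alpha> + \<beta> identifies exp (-2 pi i \<alpha>)
  with exp (2 pi i \<beta>).\<close>

lemma trace_at_infinity:
  assumes "det CL = 1" "det CR = 1" "\<alpha> + \<beta> \<in> \<int>"
  shows "trace (inv2 CR ** CL) = exp (2 * of_real pi * \<i> * \<alpha>) + exp (2 * of_real pi * \<i> * \<beta>)"
proof -
  let ?\<mu> = "exp (- (2 * of_real pi * \<i> * \<alpha>))" and ?T = "inv2 CR ** CL"
  obtain x where x: "x \<noteq> 0" "CL *v x = ?\<mu> *s (CR *v x)" by (rule eigenvector_at_infinity)
  have "?T *v x = ?\<mu> *s (inv2 CR *v (CR *v x))"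
    by (simp add: x(2) vector_scalar_commute flip: matrix_vector_mul_assoc)
  also have "inv2 CR *v (CR *v x) = x" using assms(2) by (simp add: matrix_vector_mul_assoc inv2_left)
  finally have "?\<mu>\<^sup>2 - trace ?T * ?\<mu> + det ?T = 0" using x(1) by (intro eigenvalue_quadratic)
  moreover have "det ?T = 1" using assms by (simp add: det_mul det_inv2)
  ultimately have "trace ?T * ?\<mu> = ?\<mu> * ?\<mu> + 1" by (simp add: power2_eq_square algebra_simps)
  then have "trace ?T * ?\<mu> * exp (2 * of_real pi * \<i> * \<alpha>)
      = (?\<mu> * ?\<mu> + 1) * exp (2 * of_real pi * \<i> * \<alpha>)" by simp
  moreover have "?\<mu> * exp (2 * of_real pi * \<i> * \<alpha>) = 1" by (simp add: exp_minus)
  ultimately have "trace ?T = ?\<mu> + exp (2 * of_real pi * \<i> * \<alpha>)"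
    by (simp add: algebra_simps)
  moreover have "exp (2 * of_real pi * \<i> * \<beta>) = ?\<mu>"
  proof -
    have "exp (2 * of_real pi * \<i> * \<beta>) = exp (2 * of_real pi * \<i> * (\<alpha> + \<beta>)) * ?\<mu>"
      by (simp add: algebra_simps flip: exp_add)
    then show ?thesis using exp_2pi_i_eq_1_iff[of "\<alpha> + \<beta>"] assms(3) by simp
  qed
  ultimately show ?thesis by simp
qed

lemma integral_conjugate_exists:
  assumes int: "\<gamma> \<in> \<int>" "\<alpha> + \<beta> \<in> \<int>"
    and tr: "exp (2 * of_real pi * \<i> * \<alpha>) + exp (2 * of_real pi * \<i> * \<beta>) \<in> \<int>"
  obtains P where "det P \<noteq> 0" "conj2 P CL \<in> SL2Z" "conj2 P CR \<in> SL2Z"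
proof -
  have "\<gamma> - \<alpha> - \<beta> \<in> \<int>" using Ints_diff[OF int] by (simp add: algebra_simps)
  then have det: "det CL = 1" "det CR = 1"
    using int(1) by (simp_all add: det_CL det_CR exp_minus_2pi_i_eq_1_iff)
  have T: "trace (inv2 CR ** CL) = exp (2 * of_real pi * \<i> * \<alpha>) + exp (2 * of_real pi * \<i> * \<beta>)"
    using trace_at_infinity[OF det int(2)] .
  obtain F where F: "F \<noteq> 0" "1 \<le> fps_conv_radius F" "sol (ball 0 1 - {0}) (eval_fps F)"
    by (rule series_solution_at_0)
  obtain v where v: "v \<noteq> 0" "CL *v v = v" by (rule eigenvector_at_0[OF F])
  obtain v1 F1 where v1: "v1 \<noteq> 0" "CR *v v1 = v1" by (rule eigenvector_at_1)
  show ?thesis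
  proof (cases "det (cols2 v v1) = 0")
    case False
    then show ?thesis
      using conjugate_independent_fixed_vectors[OF False det v(2) v1(2)] tr that unfolding T by blast
  next
    case True
    then obtain k where k: "k \<noteq> 0" "v1 = k *s v" using dependent_imp_scale v(1) v1(1) by blast
    have "k *s (CR *v v) = k *s v" using v1(2) by (simp add: k(2) vector_scalar_commute)
    then have CRv: "CR *v v = v" using k(1) by simp
    obtain w where w: "det (cols2 v w) \<noteq> 0" using ex_independent_vector[OF v(1)] .
    obtain a where a: "CL *v w = w + a *s v" using unipotent_image[OF w det(1) v(2)] .
    obtain b where b: "CR *v w = w + b *s v" using unipotent_image[OF w det(2) CRv] .
    have "\<exists>s. s \<noteq> 0 \<and> s * a \<in> \<int> \<and> s * b \<in> \<int>"
    proof (cases "a = 0 \<or> b = 0")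
      case True
      \<comment> \<open>At most one entry is nonzero here, and it is scaled to 1.\<close>
      define s where "s = (if a \<noteq> 0 then 1 / a else if b \<noteq> 0 then 1 / b else 1)"
      have "s \<noteq> 0 \<and> s * a \<in> \<int> \<and> s * b \<in> \<int>" using True by (auto simp: s_def)
      then show ?thesis by blast
    next
      case False
      have ne: "CL \<noteq> mat 1" "CR \<noteq> mat 1" using False a b v(1) by auto
      \<comment> \<open>The common fixed vector gives the eigenvalue 1, and determinant 1 then
        forces trace 2. The two exponentials have sum 2 and product 1, hence both are 1, and all
        parameters are integers.\<close>
      have "trace (inv2 CR ** CL) = 2"
      proof -
        have "(inv2 CR ** CL) *v v = inv2 CR *v (CR *v v)"
          by (simp add: v(2) CRv flip: matrix_vector_mul_assoc)
        also have "\<dots> = 1 *s v" using det(2) by (simp add: matrix_vector_mul_assoc inv2_left)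
        finally have "1\<^sup>2 - trace (inv2 CR ** CL) * 1 + det (inv2 CR ** CL) = 0"
          using v(1) by (intro eigenvalue_quadratic)
        then show ?thesis using det by (simp add: det_mul det_inv2 algebra_simps)
      qed
      moreover have "exp (2 * of_real pi * \<i> * \<alpha>) * exp (2 * of_real pi * \<i> * \<beta>) = 1"
        using exp_2pi_i_eq_1_iff[of "\<alpha> + \<beta>"] int(2) by (simp add: algebra_simps flip: exp_add)
      moreover have "(a - 1)\<^sup>2 = 0" if "a + b = 2" "a * b = 1" for a b :: complex
      proof -
        have "(a - 1)\<^sup>2 = 1 - a * (2 - a)" by (simp add: power2_eq_square algebra_simps)
        also have "2 - a = b" using that(1) by (simp add: algebra_simps)
        finally show ?thesis using that(2) by simp
      qed
      ultimately have "(exp (2 * of_real pi * \<i> * \<alpha>) - 1)\<^sup>2 = 0" unfolding T by blast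
      then have "exp (2 * of_real pi * \<i> * \<alpha>) = 1" by simp
      then have \<alpha>: "\<alpha> \<in> \<int>" by (simp only: exp_2pi_i_eq_1_iff)
      have \<beta>: "\<beta> \<in> \<int>" using Ints_diff[OF int(2) \<alpha>] by simp
      obtain \<kappa> r s where \<kappa>: "\<kappa> \<noteq> 0" "r \<in> \<rat>" "s \<in> \<rat>"
        "CL *v w = w + (\<kappa> * r) *s v" "CR *v w = w + (\<kappa> * s) *s v"
        by (rule rational_jumps[OF \<alpha> \<beta> int(1) ne v CRv w])
      have ab: "a = \<kappa> * r" "b = \<kappa> * s" using \<kappa>(4,5) a b v(1) by (auto simp: vector_mul_rcancel)
      obtain d where d: "d \<noteq> 0" "d * r \<in> \<int>" "d * s \<in> \<int>" by (rule common_denominator[OF \<kappa>(2,3)])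
      \<comment> \<open>Dividing by \<kappa> removes the common factor of a and b, and d clears the
        denominators of r and s.\<close>
      show ?thesis by (rule exI[of _ "d / \<kappa>"]) (use d \<kappa>(1) ab in auto)
    qed
    then obtain s where "s \<noteq> 0" "s * a \<in> \<int>" "s * b \<in> \<int>" by blast
    then show ?thesis using conjugate_common_fixed_vector[OF w det v(2) CRv a b] that by blast
  qed
qed

text \<open>Since \<open>C {0<..<1}\<close> is the identity, loops descending through the middle
  interval give conjugates of each \<open>C J\<close> and hence the determinants; the loop
  descending through the right interval and returning through the left one gives the trace. Both are
  invariant under the unknown conjugation by B.\<close>

lemma monodromy_in_SL2Z_imp:
  assumes z0: "z0 \<notin> {0, 1}" and X: "solution_basis \<alpha> \<beta> \<gamma> z0 X" "monodromy z0 X \<subseteq> SL2Z"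
  shows "\<gamma> \<in> \<int>" "\<alpha> + \<beta> \<in> \<int>" "exp (2 * of_real pi * \<i> * \<alpha>) + exp (2 * of_real pi * \<i> * \<beta>) \<in> \<int>"
proof -
  obtain B where B: "det B \<noteq> 0"
    and mon: "\<And>I J. I \<in> charts \<Longrightarrow> J \<in> charts \<Longrightarrow> inv2 B ** (inv2 (C I) ** C J) ** B \<in> monodromy z0 X"
    by (rule conjugate_in_monodromy[OF z0 X(1)]) blast
  have S: "conj2 B (inv2 (C I) ** C J) \<in> SL2Z" if "I \<in> charts" "J \<in> charts" for I J
    using mon[OF that] X(2) unfolding conj2_def by blast
  have one: "inv2 (mat 1) = mat 1" by (rule inv2_unique(1)[symmetric]) simp
  have det: "det (C J) = 1" if "J \<in> charts" for J
  proof -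
    have "det (conj2 B (inv2 (C {0<..<1}) ** C J)) = 1" using S[OF charts_mem(2) that] by (simp add: SL2Z_def)
    then show ?thesis by (simp add: det_conj2[OF B] C_mid one)
  qed
  show \<gamma>: "\<gamma> \<in> \<int>" using det[OF charts_mem(1)] by (simp only: det_CL exp_minus_2pi_i_eq_1_iff)
  have "\<gamma> - \<alpha> - \<beta> \<in> \<int>" using det[OF charts_mem(3)] by (simp only: det_CR exp_minus_2pi_i_eq_1_iff)
  from Ints_diff[OF \<gamma> this] show ab: "\<alpha> + \<beta> \<in> \<int>" by (simp add: algebra_simps)
  have "trace (conj2 B (inv2 CR ** CL)) \<in> \<int>"
    using S[OF charts_mem(3,1)] by (simp add: SL2Z_def trace_def sum_2)
  then show "exp (2 * of_real pi * \<i> * \<alpha>) + exp (2 * of_real pi * \<i> * \<beta>) \<in> \<int>"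
    using trace_at_infinity[OF det det ab] by (simp add: trace_conj2[OF B])
qed

end

theorem mainTheorem6:
  fixes \<alpha> \<beta> \<gamma> z0 :: complex
  assumes "z0 \<notin> {0, 1}"
  shows "hypergeometric_monodromy_in_SL2Z \<alpha> \<beta> \<gamma> z0 \<longleftrightarrow>
           \<gamma> \<in> \<int> \<and> \<alpha> + \<beta> \<in> \<int> \<and>
           exp (2 * of_real pi * \<i> * \<alpha>) + exp (2 * of_real pi * \<i> * \<beta>) \<in> \<int>"
proof -
  obtain Y C where "chart_system \<alpha> \<beta> \<gamma> Y C" using hypergeometric.chart_system_exists by blast
  then interpret chart_system \<alpha> \<beta> \<gamma> Y C .
  show ?thesis
  proof
    assume "hypergeometric_monodromy_in_SL2Z \<alpha> \<beta> \<gamma> z0"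
    then obtain X where "solution_basis \<alpha> \<beta> \<gamma> z0 X" "monodromy z0 X \<subseteq> SL2Z"
      unfolding hypergeometric_monodromy_in_SL2Z_def by blast
    from monodromy_in_SL2Z_imp[OF assms this]
    show "\<gamma> \<in> \<int> \<and> \<alpha> + \<beta> \<in> \<int> \<and> exp (2 * of_real pi * \<i> * \<alpha>) + exp (2 * of_real pi * \<i> * \<beta>) \<in> \<int>" by blast
  next
    assume "\<gamma> \<in> \<int> \<and> \<alpha> + \<beta> \<in> \<int> \<and> exp (2 * of_real pi * \<i> * \<alpha>) + exp (2 * of_real pi * \<i> * \<beta>) \<in> \<int>"
    then obtain P where P: "det P \<noteq> 0" "conj2 P CL \<in> SL2Z" "conj2 P CR \<in> SL2Z"
      using integral_conjugate_exists by blast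
    obtain I where I: "I \<in> charts" "z0 \<in> cut_plane I" using charts_cover[OF assms] by blast
    have "mat 1 \<in> SL2Z" by (auto simp: SL2Z_def forall_2)
    then have "conj2 P (C J) \<in> SL2Z" if "J \<in> charts" for J
      using that P by (auto elim!: chartsE simp: C_mid conj2_def inv2_left)
    then have "monodromy z0 (\<lambda>z. Y I z v* P) \<subseteq> SL2Z"
      by (intro monodromy_subset_SL2Z P(1) I) (simp add: conj2_def)
    then show "hypergeometric_monodromy_in_SL2Z \<alpha> \<beta> \<gamma> z0"
      unfolding hypergeometric_monodromy_in_SL2Z_def using solution_basis_Y[OF I P(1)] by blast
  qed
qed

end
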